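(* Suppose $\gamma>0$. Then the covariance matrix $\Sigma\in\mathbb{R}^{2N\times 2N}$ of the limiting distribution (weak limit as $t\to\infty$) of the process $\tilde Z(t)=(Q(t),p(t)-u\mathbf{1})^\top$ is given by $$\Sigma=\begin{bmatrix} V_1 & V_2 \\ V_2^\top & V_3 \end{bmatrix},$$ where $V_1,V_2,V_3\in\mathbb{R}^{N\times N}$ are as follows: $V_3$ is the circulant matrix $$V_3=\begin{bmatrix}v_0&v_{N-1}&\cdots&v_1\\ v_1&v_0&\cdots&v_2\\ \vdots&\vdots&&\vdots\\ v_{N-1}&v_{N-2}&\cdots&v_0\end{bmatrix}$$ with first column $(v_0,\dots,v_{N-1})^\top$ given by $$v_j=\frac{\sigma^2}{2N}\sum_{k=0}^{N-1}\frac{\cos(2\pi jk/N)}{\gamma+4\beta\sin^2(\pi k/N)},\qquad j\in\{0,1,\dots,N-1\},$$ $V_2=0$, and $$V_1=\alpha^{-2}\Bigl(V_3-\frac{\sigma^2}{2\gamma N}\,\overline{\mathbf{1}}\Bigr),$$ where $\overline{\mathbf{1}}\in\mathbb{R}^{N\times N}$ is the matrix all of whose entries equal $1$.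
   Context: Parameters: $N\in\{3,4,\dots\}$ (number of agents), $L$ (length of the periodic segment), $\alpha,\beta\in(0,\infty)$, $\gamma\in[0,\infty)$, $\sigma\in\mathbb{R}$, $u\in\mathbb{R}$. $\mathbf{1}\in\mathbb{R}^N$ is the all-ones vector and $I$ the $N\times N$ identity matrix. $W=(W_n)_{n=1}^N$ is an $N$-dimensional standard Brownian motion on a probability space $(\Omega,\mathcal F,\mathbb P)$. Indices of agents are cyclic: $n+1=1$ when $n=N$ and $n-1=N$ when $n=1$. Initial data: deterministic positions $0\le q_1(0)\le q_2(0)\le\dots\le q_N(0)\le L$ and velocities $p(0)=\mathfrak{p}\in\mathbb{R}^N$; the distances are $Q_n=q_{n+1}-q_n$ for $n\in\{1,\dots,N-1\}$ and $Q_N=L+q_1-q_N$, so the initial distance vector $Q(0)=\mathfrak{Q}\in[0,\infty)^N$ satisfies $\sum_{n=1}^N Q_n(0)=L$. Model: with the quadratic potential $U(x)=\frac12(\alpha x)^2$ (so $U'(x)=\alpha^2x$), the process $(Q,p)$ solves, for $t\in[0,\infty)$ and $n\in\{1,\dots,N\}$, $$dQ_n(t)=(p_{n+1}(t)-p_n(t))\,dt,$$ $$dp_n(t)=\bigl(U'(Q_n(t))-U'(Q_{n-1}(t))\bigr)dt+\beta\bigl(p_{n+1}(t)-2p_n(t)+p_{n-1}(t)\bigr)dt+\gamma\bigl(u-p_n(t)\bigr)dt+\sigma\,dW_n(t),$$ with $Q(0)=\mathfrak{Q}$, $p(0)=\mathfrak{p}$. Equivalently, $\tilde Z(t)=(Q(t),p(t)-u\mathbf{1})^\top$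 satisfies $d\tilde Z(t)=B\tilde Z(t)\,dt+G\,dW(t)$ with $$B=\begin{bmatrix}0&A\\-\alpha^2A^\top&-\beta A^\top A-\gamma I\end{bmatrix}\in\mathbb{R}^{2N\times 2N},\qquad G=\begin{bmatrix}0\\ \sigma I\end{bmatrix}\in\mathbb{R}^{2N\times N},$$ where $A\in\mathbb{R}^{N\times N}$ has $A_{n,n}=-1$ for all $n$, $A_{n,n+1}=1$ for $n\in\{1,\dots,N-1\}$, $A_{N,1}=1$ and all other entries $0$. The limiting distribution referred to in the claim: for $\gamma>0$, $\tilde Z(t)$ converges weakly as $t\to\infty$ to a (possibly degenerate) Gaussian distribution on $\mathbb{R}^{2N}$ with mean vector having first $N$ components $L/N$ and last $N$ components $0$. *)

theory Defs
  imports "HOL-Probability.Probability"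
begin

section \<open>Cyclically ordered agents\<close>

text \<open>
  The agents are the elements of a finite linearly ordered type \<open>'n\<close>; a type with \<open>N\<close> elements
  stands for \<open>{1, \<dots>, N}\<close>. The zero-based rank \<open>idx\<close> is used for the entries of circulant matrices.
\<close>

definition nxt :: "'n::{finite,linorder} \<Rightarrow> 'n" where
  "nxt n = (if n = Max UNIV then Min UNIV else Min {n<..})"

definition prv :: "'n::{finite,linorder} \<Rightarrow> 'n" where
  "prv n = (if n = Min UNIV then Max UNIV else Max {..<n})"

definition idx :: "'n::{finite,linorder} \<Rightarrow> nat" where
  "idx n = card {..<n}"

definition distances :: "real \<Rightarrow> real ^ 'n::{finite,linorder} \<Rightarrow> real ^ 'n::{finite,linorder}" where
  "distances L q =
    (\<chi> n. if n = Max UNIV then L + q $ Min UNIV - q $ n else q $ nxt n - q $ n)"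


section \<open>Brownian motion and the stochastic differential equation\<close>

locale standard_brownian_motion = prob_space M
  for M :: "'a measure" +
  fixes W :: "real \<Rightarrow> 'a \<Rightarrow> real ^ 'n::finite"
  assumes random_variable_W: "t \<ge> 0 \<Longrightarrow> W t \<in> borel_measurable M"
    and W_zero: "AE \<omega> in M. W 0 \<omega> = 0"
    and independent_increments:
      "0 \<le> r 0 \<Longrightarrow> (\<And>i. i < k \<Longrightarrow> r i < r (Suc i)) \<Longrightarrow>
        indep_vars (\<lambda>_. borel) (\<lambda>i \<omega>. W (r (Suc i)) \<omega> - W (r i) \<omega>) {..<(k::nat)}"
    and independent_components:
      "0 \<le> s \<Longrightarrow> s < t \<Longrightarrow>
        indep_vars (\<lambda>_. borel) (\<lambda>n \<omega>. W t \<omega> $ n - W s \<omega> $ n) UNIV"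
    and normal_increments:
      "0 \<le> s \<Longrightarrow> s < t \<Longrightarrow>
        distributed M lborel (\<lambda>\<omega>. W t \<omega> $ n - W s \<omega> $ n) (normal_density 0 (sqrt (t - s)))"
    and continuous_paths: "AE \<omega> in M. continuous_on {0..} (\<lambda>t. W t \<omega>)"

definition potential :: "real \<Rightarrow> real \<Rightarrow> real" where
  "potential \<alpha> x = (\<alpha> * x)\<^sup>2 / 2"

text \<open>
  The noise is additive, so the stochastic integral of the constant \<open>\<sigma>\<close> with respect to \<open>W $ n\<close> over
  \<open>[0, t]\<close> is \<open>\<sigma> * W t \<omega> $ n\<close>, and the equation in integral form is an ordinary pathwise integral
  equation. Its solutions are pathwise unique, whence adaptedness need not be required.
\<close>

definition solves_model ::
  "'a measure \<Rightarrow> (real \<Rightarrow> 'a \<Rightarrow> real ^ 'n::{finite,linorder}) \<Rightarrow>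
    real \<Rightarrow> real \<Rightarrow> real \<Rightarrow> real \<Rightarrow> real \<Rightarrow> real ^ 'n::{finite,linorder} \<Rightarrow> real ^ 'n::{finite,linorder} \<Rightarrow>
    (real \<Rightarrow> 'a \<Rightarrow> real ^ 'n::{finite,linorder}) \<Rightarrow> (real \<Rightarrow> 'a \<Rightarrow> real ^ 'n::{finite,linorder}) \<Rightarrow> bool" where
  "solves_model M W \<alpha> \<beta> \<gamma> \<sigma> u Q0 p0 Q p \<longleftrightarrow>
    (\<forall>t\<ge>0. Q t \<in> borel_measurable M \<and> p t \<in> borel_measurable M) \<and>
    (AE \<omega> in M.
      continuous_on {0..} (\<lambda>t. Q t \<omega>) \<and> continuous_on {0..} (\<lambda>t. p t \<omega>) \<and>
      (\<forall>t\<ge>0. \<forall>n.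
        Q t \<omega> $ n = Q0 $ n + integral {0..t} (\<lambda>s. p s \<omega> $ nxt n - p s \<omega> $ n) \<and>
        p t \<omega> $ n = p0 $ n
          + integral {0..t} (\<lambda>s.
              deriv (potential \<alpha>) (Q s \<omega> $ n) - deriv (potential \<alpha>) (Q s \<omega> $ prv n)
              + \<beta> * (p s \<omega> $ nxt n - 2 * p s \<omega> $ n + p s \<omega> $ prv n)
              + \<gamma> * (u - p s \<omega> $ n))
          + \<sigma> * W t \<omega> $ n))"

definition stacked :: "real ^ 'n \<Rightarrow> real ^ 'n \<Rightarrow> real ^ ('n + 'n)" where
  "stacked x y = (\<chi> i. case i of Inl n \<Rightarrow> x $ n | Inr n \<Rightarrow> y $ n)"


section \<open>Limiting distributions and covariance matrices\<close>

definition limiting_distribution ::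
  "'a measure \<Rightarrow> (real \<Rightarrow> 'a \<Rightarrow> 'b::topological_space) \<Rightarrow> 'b measure \<Rightarrow> bool" where
  "limiting_distribution M Z \<mu> \<longleftrightarrow>
    prob_space \<mu> \<and> sets \<mu> = sets borel \<and>
    (\<forall>f :: 'b \<Rightarrow> real. continuous_on UNIV f \<longrightarrow> bounded (range f) \<longrightarrow>
      ((\<lambda>t. integral\<^sup>L (distr M borel (Z t)) f) \<longlongrightarrow> integral\<^sup>L \<mu> f) at_top)"

definition square_integrable :: "(real ^ 'd) measure \<Rightarrow> bool" where
  "square_integrable \<mu> \<longleftrightarrow> (\<forall>i. integrable \<mu> (\<lambda>x. (x $ i)\<^sup>2))"

definition covariance_matrix :: "(real ^ 'd) measure \<Rightarrow> real ^ 'd ^ 'd" where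
  "covariance_matrix \<mu> =
    (\<chi> i j. \<integral>x. (x $ i - (\<integral>y. y $ i \<partial>\<mu>)) * (x $ j - (\<integral>y. y $ j \<partial>\<mu>)) \<partial>\<mu>)"


section \<open>Matrices\<close>

definition block_matrix ::
  "real ^ 'n ^ 'n \<Rightarrow> real ^ 'n ^ 'n \<Rightarrow> real ^ 'n ^ 'n \<Rightarrow> real ^ 'n ^ 'n \<Rightarrow>
    real ^ ('n + 'n) ^ ('n + 'n)" where
  "block_matrix A B C D =
    (\<chi> i j. case i of
        Inl k \<Rightarrow> (case j of Inl l \<Rightarrow> A $ k $ l | Inr l \<Rightarrow> B $ k $ l)
      | Inr k \<Rightarrow> (case j of Inl l \<Rightarrow> C $ k $ l | Inr l \<Rightarrow> D $ k $ l))"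

text \<open>The circulant matrix with first column \<open>v 0, \<dots>, v (N - 1)\<close>.\<close>

definition circulant :: "(nat \<Rightarrow> real) \<Rightarrow> real ^ 'n::{finite,linorder} ^ 'n::{finite,linorder}" where
  "circulant v = (\<chi> i j. v ((idx i + CARD('n) - idx j) mod CARD('n)))"

end

theory Submission
  imports Defs "HOL-Real_Asymp.Real_Asymp"
begin

text \<open>
  By variation of constants, the coordinate of the solution along a basis vector \<open>b\<close> is a
  deterministic term plus the Wiener integral of \<open>s \<mapsto> G\<^sup>T y(t - s)\<close> over \<open>[0, t]\<close>, where \<open>y\<close> solves
  \<open>y' = B\<^sup>T y\<close>, \<open>y(0) = b\<close>. Increments of Brownian motion over a uniform grid are exchangeable, so at
  each fixed time the solution has the law of the vector with the time-reversed integrands \<open>s \<mapsto> G\<^sup>T y(s)\<close>.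
  The reversed vector converges in mean as \<open>t \<rightarrow> \<infinity>\<close>, which gives the weak limit, and its second moments
  follow from the Ito isometry. With the asserted \<open>\<Sigma>\<close>, the form \<open>S(y) = y \<bullet> \<Sigma> y\<close> satisfies the
  Lyapunov identity \<open>d/dt S(y(t)) = - \<parallel>G\<^sup>T y(t)\<parallel>\<^sup>2\<close> and tends to \<open>0\<close> along the flow, so that
  \<open>\<integral>\<^sub>0\<^sup>\<infinity> \<parallel>G\<^sup>T y\<parallel>\<^sup>2 = S(b)\<close>.
\<close>

section \<open>Cyclic differences and circulant matrices\<close>

text \<open>The drift \<open>B\<close> is singular: the total length is conserved, so
  \<open>(1, 0)\<close> is a fixed point of the transposed flow and \<open>y(t)\<close> tends to
  some \<open>(c 1, 0)\<close> instead of \<open>0\<close>. For the same reason the Lyapunov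
  equation alone does not determine the covariance: adding a multiple of the all-ones matrix to the
  block \<open>V1\<close> preserves it. The multiple subtracted in \<open>V1\<close> is the one that
  gives \<open>V1 1 = 0\<close>; then \<open>S\<close> does not see the limit of \<open>y\<close>
  and tends to \<open>0\<close>. The Lyapunov identity rests on two facts about \<open>V3\<close>:
  it commutes with the difference operator \<open>A\<close>, which cancels the mixed terms, and
  \<open>(\<gamma> I + \<beta> A^T A) V3 = (\<sigma>^2 / 2) I\<close>, which is Fourier inversion on
  the cycle, \<open>A^T A\<close> having the eigenvalues \<open>4 sin^2 (pi k / N)\<close>. Time has
  to be reversed because the integrand \<open>G^T y(t - s)\<close> changes with \<open>t\<close>
  everywhere, so that the integral settles in law only. After reversal only the upper limit moves,
  and the missing part beyond \<open>t\<close> has second moment \<open>S(y(t))\<close>. Mixed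
  moments follow by polarization, so all estimates concern scalar integrals along a single
  flow.\<close>

lemma idx_less: "idx (n::'n::{finite,linorder}) < CARD('n)"
proof -
  have "{..<n} \<subset> UNIV" by auto
  then show ?thesis unfolding idx_def by (intro psubset_card_mono) auto
qed

lemma idx_strict_mono: "m < n \<Longrightarrow> idx m < idx (n::'n::{finite,linorder})"
  unfolding idx_def by (intro psubset_card_mono) auto

lemma idx_eq_iff [simp]: "idx m = idx n \<longleftrightarrow> m = (n::'n::{finite,linorder})"
  by (metis idx_strict_mono less_irrefl linorder_less_linear)

lemma nxt_prv [simp]: "nxt (prv n) = (n::'n::{finite,linorder})"
proof (cases "n = Min UNIV")
  case False
  then have ne: "{..<n} \<noteq> {}"
    by (metis Min_in Min_le UNIV_I UNIV_not_empty empty_iff finite lessThan_iff order_less_le)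
  define m where "m = Max {..<n}"
  have "m \<in> {..<n}" unfolding m_def using ne by (intro Max_in) auto
  then have "m < n" by simp
  moreover have "m \<noteq> Max UNIV"
    using \<open>m < n\<close> Max_ge[of UNIV n] by auto
  moreover have "Min {m<..} = n"
  proof (rule Min_eqI)
    show "n \<le> y" if "y \<in> {m<..}" for y
      using that unfolding m_def by (metis Max_ge finite greaterThan_iff leD leI lessThan_iff)
  qed (use \<open>m < n\<close> in auto)
  ultimately show ?thesis using False by (simp add: nxt_def prv_def m_def)
qed (simp add: nxt_def prv_def)

lemma bij_nxt: "bij (nxt :: 'n::{finite,linorder} \<Rightarrow> 'n)"
proof -
  have "surj (nxt :: 'n \<Rightarrow> 'n)" by (metis nxt_prv surjI)
  then show ?thesis by (simp add: bij_def finite_UNIV_surj_inj)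
qed

lemma prv_nxt [simp]: "prv (nxt n) = (n::'n::{finite,linorder})"
  by (metis bij_nxt bij_pointE nxt_prv)

text \<open>The bridge from the order-theoretic successor to arithmetic modulo \<open>N\<close>, in
  which the entries of a circulant matrix are indexed.\<close>

lemma idx_nxt: "idx (nxt (n::'n::{finite,linorder})) = (idx n + 1) mod CARD('n)"
proof (cases "n = Max UNIV")
  case True
  have "{..<Max (UNIV::'n set)} = UNIV - {Max UNIV}"
    by (auto simp: order_less_le)
  moreover have "{..<Min (UNIV::'n set)} = {}" by (auto simp: not_less)
  ultimately show ?thesis using True by (simp add: idx_def nxt_def card_Diff_singleton)
next
  case False
  then have ne: "{n<..} \<noteq> {}"
    by (metis Max_ge Max_in UNIV_I UNIV_not_empty empty_iff finite greaterThan_iff order_less_le)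
  have "{..<nxt n} = insert n {..<n}"
  proof (rule set_eqI)
    fix x
    have "x < Min {n<..} \<longleftrightarrow> x \<le> n"
      using ne Min_in[of "{n<..}"] Min_le[of "{n<..}" x] by force
    then show "x \<in> {..<nxt n} \<longleftrightarrow> x \<in> insert n {..<n}"
      using False by (auto simp: nxt_def)
  qed
  then have "idx (nxt n) = idx n + 1" by (simp add: idx_def)
  then show ?thesis using idx_less[of "nxt n"] by simp
qed

lemma sum_nxt: "(\<Sum>n\<in>UNIV. f (nxt (n::'n::{finite,linorder}))) = (\<Sum>n\<in>UNIV. f n)"
  using sum.reindex_bij_betw[OF bij_nxt] .

section \<open>Difference operators on the cycle\<close>

definition fdiff :: "real ^ 'n::{finite,linorder} \<Rightarrow> real ^ 'n::{finite,linorder}" where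
  "fdiff x = (\<chi> n. x $ nxt n - x $ n)"

text \<open>\<open>fdiff\<close> is the matrix \<open>A\<close> of the model as an operator and
  \<open>bdiff\<close> its transpose, by \<open>inner_fdiff\<close>; so
  \<open>bdiff (fdiff x)\<close> is \<open>A^T A x\<close>, the negative discrete Laplacian of the
  cycle.\<close>

definition bdiff :: "real ^ 'n::{finite,linorder} \<Rightarrow> real ^ 'n::{finite,linorder}" where
  "bdiff x = (\<chi> n. x $ prv n - x $ n)"

lemma linear_fdiff: "linear fdiff"
  by (rule linearI) (auto simp: fdiff_def vec_eq_iff algebra_simps)

lemma linear_bdiff: "linear bdiff"
  by (rule linearI) (auto simp: bdiff_def vec_eq_iff algebra_simps)

lemma inner_fdiff: "fdiff x \<bullet> y = x \<bullet> bdiff y"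
proof -
  have "(\<Sum>n\<in>UNIV. x $ nxt n * y $ n) = (\<Sum>n\<in>UNIV. x $ n * y $ prv n)"
    using sum_nxt[of "\<lambda>n. x $ n * y $ prv n"] by simp
  then show ?thesis
    by (simp add: inner_vec_def fdiff_def bdiff_def algebra_simps sum_subtractf)
qed

lemma bdiff_one [simp]: "bdiff 1 = 0"
  by (simp add: bdiff_def vec_eq_iff)

lemma fdiff_one [simp]: "fdiff 1 = 0"
  by (simp add: fdiff_def vec_eq_iff)

lemma inner_one_fdiff [simp]: "1 \<bullet> fdiff x = 0" "fdiff x \<bullet> 1 = 0"
  by (simp_all add: inner_commute[of 1] inner_fdiff)

lemma inner_one_bdiff [simp]: "1 \<bullet> bdiff x = 0" "bdiff x \<bullet> 1 = 0"
  by (simp_all add: inner_commute[of _ 1] flip: inner_fdiff)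

lemma inner_one_one: "(1 :: real ^ 'n) \<bullet> 1 = real CARD('n)"
  by (simp add: inner_vec_def)

text \<open>The cycle is connected, so the kernel of the difference operator consists of the
  constants; the induction walks back along \<open>prv\<close> to the first agent.\<close>

lemma bdiff_eq_0D:
  assumes "bdiff x = 0" shows "x $ n = x $ Min UNIV"
proof (induction "idx n" arbitrary: n rule: less_induct)
  case less
  show ?case
  proof (cases "n = Min UNIV")
    case False
    then have ne: "{..<n} \<noteq> {}"
      by (metis Min_in Min_le UNIV_I UNIV_not_empty empty_iff finite lessThan_iff order_less_le)
    have "prv n < n" using Max_in[OF _ ne] False by (simp add: prv_def)
    then have "x $ prv n = x $ Min UNIV" using less idx_strict_mono by blast
    then show ?thesis using assms by (simp add: bdiff_def vec_eq_iff)
  qed simp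
qed

text \<open>Adding the mean makes \<open>bdiff\<close> injective.\<close>

lemma bdiff_bounded_below:
  obtains \<kappa> where "\<kappa> > 0"
    "\<And>x :: real ^ 'n::{finite,linorder}. x \<bullet> 1 = 0 \<Longrightarrow> \<kappa> * norm x \<le> norm (bdiff x)"
proof -
  define f where "f x = bdiff x + (x \<bullet> 1) *\<^sub>R (1 :: real ^ 'n::{finite,linorder})" for x
  have lin: "linear f"
    unfolding f_def by (rule linearI)
      (auto simp: linear_add[OF linear_bdiff] linear_scale[OF linear_bdiff] algebra_simps)
  have "inj f"
  proof (subst linear_injective_0[OF lin], safe)
    fix x assume *: "f x = 0"
    \<comment> \<open>Pairing with \<open>1\<close> isolates the mean, because the range of
      \<open>bdiff\<close> is orthogonal to \<open>1\<close>.\<close>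
    then have "f x \<bullet> 1 = 0" by simp
    then have 0: "x \<bullet> 1 = 0" by (simp add: f_def inner_add_left inner_one_one)
    then have "bdiff x = 0" using * by (simp add: f_def)
    then have c: "x = x $ Min UNIV *\<^sub>R 1" using bdiff_eq_0D[of x] by (simp add: vec_eq_iff)
    then have "x \<bullet> 1 = x $ Min UNIV * CARD('n)"
      by (metis inner_one_one inner_scaleR_left)
    then show "x = 0" using 0 c by simp
  qed
  then obtain B where "B > 0" "\<And>x. B * norm x \<le> norm (f x)"
    using linear_inj_bounded_below_pos[OF lin] by metis
  \<comment> \<open>On vectors of mean zero \<open>f\<close> coincides with \<open>bdiff\<close>, so
    the bound carries over.\<close>
  then show ?thesis using that[of B] by (metis add_0_right f_def scaleR_zero_left)
qed

text \<open>Real part of the geometric sum of the powers of an \<open>N\<close>-th root of unity.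
  This orthogonality relation produces the identity matrix in
  \<open>circulant_resolvent\<close>.\<close>

lemma sum_cos_roots_of_unity:
  assumes "N > 0"
  shows "(\<Sum>k<N. cos (2 * pi * real_of_int m * real k / real N)) = (if int N dvd m then real N else 0)"
proof -
  define x where "x = 2 * pi * real_of_int m / real N"
  have eq: "cis x = 1 \<longleftrightarrow> int N dvd m"
  proof
    assume "cis x = 1"
    then have "cos x = 1" by (metis cis.sel(1) one_complex.sel(1))
    then obtain j where "x = of_int j * 2 * pi" using cos_one_2pi_int by blast
    then have "of_int m = (of_int (j * int N) :: real)" using assms by (simp add: x_def field_simps)
    then show "int N dvd m" by (metis dvd_triv_right of_int_eq_iff)
  next
    assume "int N dvd m"
    then obtain j where "m = int N * j" by blast
    then have "x = 2 * pi * of_int j" using assms by (simp add: x_def)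
    then show "cis x = 1" by (simp add: cis_multiple_2pi)
  qed
  have "(\<Sum>k<N. cos (2 * pi * real_of_int m * real k / real N)) = (\<Sum>k<N. cos (real k * x))"
    by (simp add: x_def field_simps)
  also have "\<dots> = Re (\<Sum>k<N. cis x ^ k)" by (simp add: Complex.DeMoivre del: Re_power_real)
  also have "(\<Sum>k<N. cis x ^ k) = (if int N dvd m then of_nat N else 0)"
  proof (cases "int N dvd m")
    case False
    have "cis x ^ N = cis (real N * x)" by (rule Complex.DeMoivre)
    also have "real N * x = 2 * pi * of_int m" using assms by (simp add: x_def)
    also have "cis \<dots> = 1" by (rule cis_multiple_2pi) auto
    finally show ?thesis using False eq by (simp add: sum_gp_strict)
  qed (use eq in simp)
  finally show ?thesis by simp
qed

section \<open>The circulant covariance as a Green function on the cycle\<close>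

context
  fixes N :: nat and \<beta> \<gamma> \<sigma> :: real and v :: "nat \<Rightarrow> real"
  assumes N: "N > 0" and \<beta>: "\<beta> > 0" and \<gamma>: "\<gamma> > 0"
    and v: "\<And>j. j < N \<Longrightarrow> v j = \<sigma>\<^sup>2 / (2 * real N) *
        (\<Sum>k = 0..N - 1. cos (2 * pi * real j * real k / real N) /
          (\<gamma> + 4 * \<beta> * (sin (pi * real k / real N))\<^sup>2))"
begin

text \<open>The extension of \<open>v\<close> to an even function of period \<open>N\<close> on all
  integers; neighbours \<open>m + 1\<close> and \<open>m - 1\<close> then need no case distinction
  at the ends of the range.\<close>

definition cov_kernel :: "int \<Rightarrow> real" where
  "cov_kernel m = \<sigma>\<^sup>2 / (2 * real N) *
        (\<Sum>k<N. cos (2 * pi * real_of_int m * real k / real N) /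
          (\<gamma> + 4 * \<beta> * (sin (pi * real k / real N))\<^sup>2))"

lemma cov_kernel_minus [simp]: "cov_kernel (- m) = cov_kernel m"
  by (simp add: cov_kernel_def)

lemma cov_kernel_add: "cov_kernel (m + int N * q) = cov_kernel m"
proof -
  have "cos (2 * pi * real_of_int (m + int N * q) * real k / real N) =
     cos (2 * pi * real_of_int m * real k / real N)" for k
  proof -
    have "2 * pi * real_of_int (m + int N * q) * real k / real N =
      2 * pi * real_of_int m * real k / real N + 2 * pi * real_of_int (q * int k)"
      using N by (simp add: field_simps)
    then show ?thesis by (simp only: cos_add cos_int_2pin sin_int_2pin)
  qed
  then show ?thesis by (simp only: cov_kernel_def)
qed

lemma cov_kernel_cong: "m mod int N = m' mod int N \<Longrightarrow> cov_kernel m = cov_kernel m'"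
  by (metis cov_kernel_add mod_mult_div_eq add.commute)

text \<open>For fixed \<open>k\<close> the cosine is an eigenfunction of the negative second
  difference in \<open>m\<close>, with eigenvalue \<open>4 sin^2 (pi k / N)\<close>. The operator
  therefore multiplies each summand by exactly its denominator, and a bare sum of cosines is
  left.\<close>

lemma cov_kernel_difference:
  "\<gamma> * cov_kernel m + \<beta> * (2 * cov_kernel m - cov_kernel (m + 1) - cov_kernel (m - 1)) =
    (if int N dvd m then \<sigma>\<^sup>2 / 2 else 0)"
proof -
  define d where "d k = \<gamma> + 4 * \<beta> * (sin (pi * real k / real N))\<^sup>2" for k
  define c where "c m k = cos (2 * pi * real_of_int m * real k / real N)" for m k
  have d: "d k \<noteq> 0" for k
  proof -
    have "0 \<le> 4 * \<beta> * (sin (pi * real k / real N))\<^sup>2" using \<beta> by simp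
    then show ?thesis using \<gamma> by (simp add: d_def)
  qed
  have *: "\<gamma> * (c m k / d k) + \<beta> * (2 * (c m k / d k) - c (m + 1) k / d k - c (m - 1) k / d k) = c m k" for k
  proof -
    define x y where "x = 2 * pi * real_of_int m * real k / real N" and "y = pi * real k / real N"
    have "c (m + 1) k = cos (x + 2 * y)" "c (m - 1) k = cos (x - 2 * y)"
      by (simp_all add: c_def x_def y_def algebra_simps add_divide_distrib diff_divide_distrib)
    then have "2 * c m k - c (m + 1) k - c (m - 1) k = 2 * cos x * (1 - cos (2 * y))"
      by (simp add: cos_add cos_diff c_def x_def algebra_simps)
    also have "\<dots> = 4 * (sin y)\<^sup>2 * c m k"
      by (simp add: cos_double_sin c_def x_def)
    finally have **: "2 * c m k - c (m + 1) k - c (m - 1) k = 4 * (sin y)\<^sup>2 * c m k" .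
    have "\<gamma> * (c m k / d k) + \<beta> * (2 * (c m k / d k) - c (m + 1) k / d k - c (m - 1) k / d k)
      = (\<gamma> * c m k + \<beta> * (2 * c m k - c (m + 1) k - c (m - 1) k)) / d k"
      by (simp add: diff_divide_distrib add_divide_distrib algebra_simps)
    also have "\<gamma> * c m k + \<beta> * (2 * c m k - c (m + 1) k - c (m - 1) k) = d k * c m k"
      unfolding ** by (simp add: d_def y_def algebra_simps)
    finally show ?thesis using d by simp
  qed
  have "\<gamma> * cov_kernel m + \<beta> * (2 * cov_kernel m - cov_kernel (m + 1) - cov_kernel (m - 1)) =
    \<sigma>\<^sup>2 / (2 * real N) * (\<Sum>k<N. \<gamma> * (c m k / d k) + \<beta> * (2 * (c m k / d k) - c (m + 1) k / d k - c (m - 1) k / d k))"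
  proof -
    have a: "cov_kernel m = \<sigma>\<^sup>2 / (2 * real N) * (\<Sum>k<N. c m k / d k)" for m
      by (simp add: cov_kernel_def c_def d_def)
    have e: "(\<Sum>k<N. \<gamma> * (c m k / d k) + \<beta> * (2 * (c m k / d k) - c (m + 1) k / d k - c (m - 1) k / d k))
      = \<gamma> * (\<Sum>k<N. c m k / d k) + \<beta> * (2 * (\<Sum>k<N. c m k / d k) - (\<Sum>k<N. c (m + 1) k / d k) - (\<Sum>k<N. c (m - 1) k / d k))"
      unfolding sum.distrib sum_subtractf sum_distrib_left[symmetric] ..
    show ?thesis unfolding a e by (simp only: algebra_simps)
  qed
  also have "\<dots> = \<sigma>\<^sup>2 / (2 * real N) * (\<Sum>k<N. c m k)" by (simp only: *)
  also have "\<dots> = \<sigma>\<^sup>2 / (2 * real N) * (if int N dvd m then real N else 0)"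
    by (simp only: c_def sum_cos_roots_of_unity[OF N])
  finally show ?thesis using N by simp
qed

context
  fixes V :: "real ^ 'n::{finite,linorder} ^ 'n::{finite,linorder}"
  assumes card: "N = CARD('n)" and V: "V = circulant v"
begin

lemma circulant_cov_kernel: "V $ i $ j = cov_kernel (int (idx i) - int (idx j))"
proof -
  define m where "m = (idx i + N - idx j) mod N"
  have "V $ i $ j = v m" by (simp add: V circulant_def m_def card)
  also have "m < N" using N by (simp add: m_def)
  then have "v m = cov_kernel (int m)"
    using N by (subst v) (auto simp: cov_kernel_def intro!: sum.cong)
  also have "\<dots> = cov_kernel (int (idx i) - int (idx j))"
  proof (rule cov_kernel_cong)
    \<comment> \<open>This makes the natural-number subtraction in \<open>circulant\<close> an exact
      one; the added \<open>N\<close> disappears modulo \<open>N\<close>.\<close>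
    have "idx j \<le> idx i + N" using idx_less[of j] by (simp add: card)
    then have "int m = (int (idx i) - int (idx j) + int N) mod int N"
      by (simp add: m_def zmod_int of_nat_diff algebra_simps)
    then show "int m mod int N = (int (idx i) - int (idx j)) mod int N" by simp
  qed
  finally show ?thesis .
qed

lemma int_idx_nxt: "int (idx (nxt (i::'n))) mod int N = (int (idx i) + 1) mod int N"
  by (simp add: idx_nxt zmod_int card add.commute)

lemma int_idx_prv: "int (idx (prv (i::'n))) mod int N = (int (idx i) - 1) mod int N"
  using int_idx_nxt[of "prv i"] by (metis add_diff_cancel_right' mod_diff_left_eq nxt_prv)

lemma circulant_sym: "V $ i $ j = V $ j $ i"
  using cov_kernel_minus[of "int (idx i) - int (idx j)"] by (simp add: circulant_cov_kernel)

lemma circulant_shift: "V $ nxt i $ nxt j = V $ i $ j"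
  unfolding circulant_cov_kernel
proof (rule cov_kernel_cong)
  have "(int (idx (nxt i)) - int (idx (nxt j))) mod int N = ((int (idx i) + 1) - (int (idx j) + 1)) mod int N"
    using int_idx_nxt by (metis mod_diff_eq)
  then show "(int (idx (nxt i)) - int (idx (nxt j))) mod int N = (int (idx i) - int (idx j)) mod int N"
    by simp
qed

lemma inner_circulant: "(V *v x) \<bullet> y = x \<bullet> (V *v y)"
proof -
  have "transpose V = V" by (simp add: vec_eq_iff transpose_def circulant_sym)
  then show ?thesis by (metis dot_lmul_matrix vector_transpose_matrix)
qed

text \<open>A circulant matrix commutes with the cyclic shift. In the Lyapunov identity this is what
  cancels the terms mixing distances and velocities.\<close>

lemma fdiff_circulant: "fdiff (V *v x) = V *v fdiff x"
proof -
  have "(\<Sum>j\<in>UNIV. V $ nxt i $ j * x $ j) = (\<Sum>j\<in>UNIV. V $ i $ j * x $ nxt j)" for i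
    using sum_nxt[of "\<lambda>j. V $ nxt i $ j * x $ j"] by (simp add: circulant_shift)
  then show ?thesis
    by (simp add: vec_eq_iff fdiff_def matrix_vector_mult_def right_diff_distrib sum_subtractf)
qed

text \<open>The entrywise form is \<open>cov_kernel_difference\<close> at the difference of two
  ranks. Ranks differ by less than \<open>N\<close>, so this difference is a multiple of
  \<open>N\<close> on the diagonal only, and the right-hand side is a multiple of the identity
  matrix.\<close>

lemma circulant_resolvent: "\<gamma> *\<^sub>R (V *v x) + \<beta> *\<^sub>R bdiff (fdiff (V *v x)) = (\<sigma>\<^sup>2 / 2) *\<^sub>R x"
proof (rule vec_eq_iff[THEN iffD2], rule allI)
  fix i
  have e: "\<gamma> * V $ i $ j + \<beta> * (2 * V $ i $ j - V $ nxt i $ j - V $ prv i $ j) = (if j = i then \<sigma>\<^sup>2 / 2 else 0)" for j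
  proof -
    define m where "m = int (idx i) - int (idx j)"
    have "V $ nxt i $ j = cov_kernel (m + 1)"
      unfolding circulant_cov_kernel m_def
    proof (rule cov_kernel_cong)
      show "(int (idx (nxt i)) - int (idx j)) mod int N = (int (idx i) - int (idx j) + 1) mod int N"
        using mod_diff_cong[OF int_idx_nxt[of i] refl, of "int (idx j)"] by (simp only: diff_add_eq)
    qed
    moreover have "V $ prv i $ j = cov_kernel (m - 1)"
      unfolding circulant_cov_kernel m_def
    proof (rule cov_kernel_cong)
      show "(int (idx (prv i)) - int (idx j)) mod int N = (int (idx i) - int (idx j) - 1) mod int N"
        using mod_diff_cong[OF int_idx_prv[of i] refl, of "int (idx j)"]
        by (simp only: cancel_ab_semigroup_add_class.diff_right_commute[of "int (idx i)" 1 "int (idx j)"])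
    qed
    moreover have "V $ i $ j = cov_kernel m" by (simp add: circulant_cov_kernel m_def)
    moreover have "int N dvd m \<longleftrightarrow> j = i"
    proof
      assume "int N dvd m"
      moreover have "\<bar>m\<bar> < int N" using idx_less[of i] idx_less[of j] by (simp add: m_def card)
      ultimately have "m = 0" using zdvd_imp_le[of "int N" "\<bar>m\<bar>"] by force
      then show "j = i" by (metis m_def eq_iff_diff_eq_0 idx_eq_iff of_nat_eq_iff)
    qed (simp add: m_def)
    ultimately show ?thesis using cov_kernel_difference[of m] by simp
  qed
  have "(\<gamma> *\<^sub>R (V *v x) + \<beta> *\<^sub>R bdiff (fdiff (V *v x))) $ i =
    \<gamma> * (V *v x) $ i + \<beta> * (2 * (V *v x) $ i - (V *v x) $ nxt i - (V *v x) $ prv i)"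
    by (simp add: fdiff_def bdiff_def)
  also have "\<dots> = (\<Sum>j\<in>UNIV. \<gamma> * (V $ i $ j * x $ j) +
      \<beta> * (2 * (V $ i $ j * x $ j) - V $ nxt i $ j * x $ j - V $ prv i $ j * x $ j))"
    by (simp only: matrix_vector_mult_def vec_lambda_beta sum.distrib sum_subtractf flip: sum_distrib_left)
  also have "\<dots> = (\<Sum>j\<in>UNIV. (\<gamma> * V $ i $ j + \<beta> * (2 * V $ i $ j - V $ nxt i $ j - V $ prv i $ j)) * x $ j)"
    by (intro sum.cong refl) (simp only: algebra_simps)
  also have "\<dots> = (\<Sum>j\<in>UNIV. if j = i then \<sigma>\<^sup>2 / 2 * x $ j else 0)"
    unfolding e by (intro sum.cong) auto
  finally show "(\<gamma> *\<^sub>R (V *v x) + \<beta> *\<^sub>R bdiff (fdiff (V *v x))) $ i = ((\<sigma>\<^sup>2 / 2) *\<^sub>R x) $ i"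
    by simp
qed

text \<open>On constants the difference term of \<open>circulant_resolvent\<close> vanishes. Divided
  by \<open>N\<close>, the resulting eigenvalue is the constant subtracted in
  \<open>V1\<close>.\<close>

lemma circulant_one: "V *v 1 = (\<sigma>\<^sup>2 / (2 * \<gamma>)) *\<^sub>R 1"
proof -
  have "fdiff (V *v 1) = 0" by (simp add: fdiff_circulant)
  then have "\<gamma> *\<^sub>R (V *v 1) = (\<sigma>\<^sup>2 / 2) *\<^sub>R 1"
    using circulant_resolvent[of 1] by (simp add: linear_0[OF linear_bdiff])
  then have "(1 / \<gamma>) *\<^sub>R (\<gamma> *\<^sub>R (V *v 1)) = (1 / \<gamma>) *\<^sub>R ((\<sigma>\<^sup>2 / 2) *\<^sub>R 1)" by simp
  then show ?thesis using \<gamma> by (simp add: field_simps)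
qed

end

end


section \<open>Linear flows and their decay\<close>

text \<open>The solution is \<open>exp (t C) x\<close>, built coordinatewise: \<open>g b\<close> is
  the scalar power series of the coordinate along \<open>b\<close>, and it converges everywhere
  because \<open>(C ^^ n) x\<close> grows at most geometrically.\<close>

lemma linear_ode_solution:
  fixes C :: "'a::euclidean_space \<Rightarrow> 'a"
  assumes lin: "linear C"
  obtains y where "y 0 = x" "\<And>t. (y has_vector_derivative C (y t)) (at t)"
proof -
  obtain K where K: "K > 0" "\<And>x. norm (C x) \<le> K * norm x"
    using linear_bounded_pos[OF lin] by blast
  define c where "c b n = (b \<bullet> (C ^^ n) x) / fact n" for b n
  define g where "g b t = (\<Sum>n. c b n * t ^ n)" for b t
  have nrm: "norm ((C ^^ n) x) \<le> norm x * K ^ n" for n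
  proof (induction n)
    case (Suc n)
    have "norm ((C ^^ Suc n) x) \<le> K * norm ((C ^^ n) x)" using K by simp
    also have "\<dots> \<le> K * (norm x * K ^ n)" using Suc K by (intro mult_left_mono) auto
    finally show ?case by (simp add: ac_simps)
  qed simp
  have summ: "summable (\<lambda>n. c b n * t ^ n)" for b t
  proof (rule summable_comparison_test)
    show "summable (\<lambda>n. (norm b * norm x) * ((K * \<bar>t\<bar>) ^ n /\<^sub>R fact n))"
      by (intro summable_mult summable_exp_generic)
    have "norm (c b n * t ^ n) \<le> norm b * norm x * ((K * \<bar>t\<bar>) ^ n /\<^sub>R fact n)" for n
    proof -
      have "\<bar>b \<bullet> (C ^^ n) x\<bar> \<le> norm b * norm ((C ^^ n) x)" by (rule Cauchy_Schwarz_ineq2)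
      also have "\<dots> \<le> norm b * (norm x * K ^ n)" by (intro mult_left_mono nrm) auto
      finally have "\<bar>b \<bullet> (C ^^ n) x\<bar> / fact n * \<bar>t\<bar> ^ n \<le> norm b * (norm x * K ^ n) / fact n * \<bar>t\<bar> ^ n"
        by (intro mult_right_mono divide_right_mono) auto
      then show ?thesis
        by (simp add: c_def abs_mult power_abs power_mult_distrib divide_inverse ac_simps)
    qed
    then show "\<exists>N. \<forall>n\<ge>N. norm (c b n * t ^ n) \<le> norm b * norm x * ((K * \<bar>t\<bar>) ^ n /\<^sub>R fact n)" by blast
  qed
  \<comment> \<open>Termwise differentiation raises the power of \<open>C\<close> by one; expanding
    \<open>(C ^^ n) x\<close> in the basis expresses the result by the coefficients of the other
    coordinates, which closes the system.\<close>
  have diffs: "diffs (c b) n = (\<Sum>b'\<in>Basis. (C b' \<bullet> b) * c b' n)" for b n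
  proof -
    have "diffs (c b) n = (b \<bullet> C ((C ^^ n) x)) / fact n"
      by (simp add: diffs_def c_def field_simps del: of_nat_Suc)
    moreover have "C ((C ^^ n) x) = (\<Sum>b'\<in>Basis. ((C ^^ n) x \<bullet> b') *\<^sub>R C b')"
      by (subst euclidean_representation[of "(C ^^ n) x", symmetric])
        (simp add: linear_sum[OF lin] linear_scale[OF lin])
    moreover have "(C b' \<bullet> b) * c b' n = ((C ^^ n) x \<bullet> b') * (b \<bullet> C b') / fact n" for b'
      by (simp add: c_def inner_commute)
    ultimately show ?thesis
      by (simp add: inner_sum_right sum_divide_distrib)
  qed
  have der: "((g b) has_real_derivative (\<Sum>b'\<in>Basis. (C b' \<bullet> b) * g b' t)) (at t)" for b t
  proof -
    have "((g b) has_real_derivative (\<Sum>n. diffs (c b) n * t ^ n)) (at t)"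
      unfolding g_def by (rule termdiffs_strong_converges_everywhere[OF summ])
    also have "(\<Sum>n. diffs (c b) n * t ^ n) = (\<Sum>n. \<Sum>b'\<in>Basis. (C b' \<bullet> b) * (c b' n * t ^ n))"
      by (simp add: diffs sum_distrib_right mult.assoc)
    also have "\<dots> = (\<Sum>b'\<in>Basis. \<Sum>n. (C b' \<bullet> b) * (c b' n * t ^ n))"
      by (intro suminf_sum summable_mult summ)
    also have "\<dots> = (\<Sum>b'\<in>Basis. (C b' \<bullet> b) * g b' t)"
      by (intro sum.cong refl) (simp add: g_def suminf_mult[OF summ])
    finally show ?thesis .
  qed
  define y where "y t = (\<Sum>b\<in>Basis. g b t *\<^sub>R b)" for t
  show ?thesis
  proof
    have "g b 0 = x \<bullet> b" for b
      using suminf_finite[of "{0}" "\<lambda>n. c b n * 0 ^ n"] by (simp add: g_def c_def inner_commute)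
    then show "y 0 = x" by (simp add: y_def euclidean_representation)
  next
    fix t
    have "(y has_vector_derivative (\<Sum>b\<in>Basis. (\<Sum>b'\<in>Basis. (C b' \<bullet> b) * g b' t) *\<^sub>R b)) (at t)"
      unfolding y_def[abs_def]
      by (intro has_vector_derivative_sum has_vector_derivative_scaleR[where g="\<lambda>_. _" and g'=0, simplified] der)
    also have "(\<Sum>b\<in>Basis. (\<Sum>b'\<in>Basis. (C b' \<bullet> b) * g b' t) *\<^sub>R b) = C (y t)"
    proof (rule euclidean_eqI)
      fix b :: 'a assume "b \<in> Basis"
      then show "(\<Sum>b\<in>Basis. (\<Sum>b'\<in>Basis. (C b' \<bullet> b) * g b' t) *\<^sub>R b) \<bullet> b = C (y t) \<bullet> b"
        by (simp add: y_def linear_sum[OF lin] linear_scale[OF lin] inner_sum_left ac_simps)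
    qed
    finally show "(y has_vector_derivative C (y t)) (at t)" .
  qed
qed

text \<open>
  The derivative of the energy \<open>\<parallel>q\<parallel>\<^sup>2 + \<alpha>\<^sup>2 \<parallel>p\<parallel>\<^sup>2\<close> along the flow only controls \<open>p\<close>;
  the small cross term \<open>p \<bullet> A\<^sup>T q\<close> makes it dissipate in \<open>q\<close> as well.
\<close>

lemma damped_flow_decay:
  fixes A A' :: "'v::euclidean_space \<Rightarrow> 'v" and q p :: "real \<Rightarrow> 'v"
  assumes lin: "linear A" "linear A'" and adj: "\<And>x y. A x \<bullet> y = x \<bullet> A' y"
    and pos: "\<alpha> > 0" "\<beta> > 0" "\<gamma> > 0" "\<kappa> > 0"
    and q': "\<And>t. (q has_vector_derivative - (\<alpha>\<^sup>2 *\<^sub>R A (p t))) (at t)"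
    and p': "\<And>t. (p has_vector_derivative A' (q t) - \<beta> *\<^sub>R A' (A (p t)) - \<gamma> *\<^sub>R p t) (at t)"
    and below: "\<And>t. \<kappa> * norm (q t) \<le> norm (A' (q t))"
  shows "(q \<longlongrightarrow> 0) at_top" "(p \<longlongrightarrow> 0) at_top"
proof -
  obtain K1 where K1: "K1 > 0" "\<And>x. norm (A x) \<le> K1 * norm x"
    using linear_bounded_pos[OF lin(1)] by blast
  obtain K2 where K2: "K2 > 0" "\<And>x. norm (A' x) \<le> K2 * norm x"
    using linear_bounded_pos[OF lin(2)] by blast
  \<comment> \<open>\<open>M\<close> collects what the cross term contributes with the wrong sign,
    measured against the square of \<open>norm (p t)\<close>: the squared damping force, after
    Young's inequality, and the part coming from the derivative of \<open>q\<close>.\<close>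
  define M where "M = (\<beta> * K2 * K1 + \<gamma>)\<^sup>2 + 2 * \<alpha>\<^sup>2 * K1\<^sup>2"
  have "M > 0"
  proof -
    have "\<beta> * K2 * K1 + \<gamma> > 0" using pos K1 K2 by (intro add_pos_pos mult_pos_pos)
    then show ?thesis unfolding M_def by (intro add_pos_nonneg) auto
  qed
  \<comment> \<open>The first entry lets \<open>M\<close> consume at most half of the dissipation in
    \<open>p\<close>; the other two keep the cross term below \<open>E / 2\<close>, so that
    \<open>F\<close> stays comparable to \<open>E\<close>.\<close>
  define \<epsilon> where "\<epsilon> = min (\<alpha>\<^sup>2 * \<gamma> / M) (min (1 / (2 * K2)) (\<alpha>\<^sup>2 / (2 * K2)))"
  have \<epsilon>: "\<epsilon> > 0" "\<epsilon> * M \<le> \<alpha>\<^sup>2 * \<gamma>" "\<epsilon> * K2 \<le> 1 / 2" "\<epsilon> * K2 \<le> \<alpha>\<^sup>2 / 2"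
  proof -
    show "\<epsilon> > 0" using pos K2 \<open>M > 0\<close> by (simp add: \<epsilon>_def)
    have "\<epsilon> \<le> \<alpha>\<^sup>2 * \<gamma> / M" "\<epsilon> \<le> 1 / (2 * K2)" "\<epsilon> \<le> \<alpha>\<^sup>2 / (2 * K2)" by (simp_all add: \<epsilon>_def)
    then show "\<epsilon> * M \<le> \<alpha>\<^sup>2 * \<gamma>" "\<epsilon> * K2 \<le> 1 / 2" "\<epsilon> * K2 \<le> \<alpha>\<^sup>2 / 2"
      using K2 \<open>M > 0\<close> by (simp_all add: field_simps)
  qed
  define E where "E t = (norm (q t))\<^sup>2 + \<alpha>\<^sup>2 * (norm (p t))\<^sup>2" for t
  define F where "F t = E t - 2 * \<epsilon> * (p t \<bullet> A' (q t))" for t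
  \<comment> \<open>The dissipation rates that remain in the two parts of the energy:
    \<open>\<gamma>\<close> for \<open>p\<close> and, through the lower bound on \<open>A'\<close>,
    the other one for \<open>q\<close>.\<close>
  define c where "c = min \<gamma> (\<epsilon> * \<kappa>\<^sup>2)"
  have c: "c > 0" using pos \<epsilon> by (simp add: c_def)
  have cross: "\<bar>2 * \<epsilon> * (p t \<bullet> A' (q t))\<bar> \<le> E t / 2" for t
  proof -
    have "\<bar>p t \<bullet> A' (q t)\<bar> \<le> norm (p t) * (K2 * norm (q t))"
      by (rule order_trans[OF Cauchy_Schwarz_ineq2 mult_left_mono]) (use K2 in auto)
    then have "\<bar>2 * \<epsilon> * (p t \<bullet> A' (q t))\<bar> \<le> 2 * \<epsilon> * (norm (p t) * (K2 * norm (q t)))"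
      using \<epsilon> by (simp add: abs_mult)
    also have "\<dots> = \<epsilon> * K2 * (2 * norm (p t) * norm (q t))" by simp
    also have "\<dots> \<le> \<epsilon> * K2 * ((norm (p t))\<^sup>2 + (norm (q t))\<^sup>2)"
      using \<epsilon> K2 by (intro mult_left_mono sum_squares_bound) auto
    also have "\<dots> \<le> \<alpha>\<^sup>2 / 2 * (norm (p t))\<^sup>2 + 1 / 2 * (norm (q t))\<^sup>2"
      unfolding distrib_left by (intro add_mono mult_right_mono \<epsilon>) auto
    finally show ?thesis by (simp add: E_def field_simps)
  qed
  define F' where "F' t = 2 * (q t \<bullet> (- (\<alpha>\<^sup>2 *\<^sub>R A (p t))))
      + \<alpha>\<^sup>2 * (2 * (p t \<bullet> (A' (q t) - \<beta> *\<^sub>R A' (A (p t)) - \<gamma> *\<^sub>R p t)))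
      - 2 * \<epsilon> * (p t \<bullet> A' (- (\<alpha>\<^sup>2 *\<^sub>R A (p t)))
          + (A' (q t) - \<beta> *\<^sub>R A' (A (p t)) - \<gamma> *\<^sub>R p t) \<bullet> A' (q t))" for t
  have bl: "bounded_linear A'" using lin(2) by (simp add: linear_conv_bounded_linear)
  have A'q: "((\<lambda>t. A' (q t)) has_vector_derivative A' (- (\<alpha>\<^sup>2 *\<^sub>R A (p t)))) (at t)" for t
    by (rule bounded_linear.has_vector_derivative[OF bl q'])
  note inner_der = bounded_bilinear.has_vector_derivative[OF bounded_bilinear_inner]
  have F': "(F has_real_derivative F' t) (at t)" for t
  proof -
    have "((\<lambda>t. q t \<bullet> q t) has_real_derivative 2 * (q t \<bullet> (- (\<alpha>\<^sup>2 *\<^sub>R A (p t))))) (at t)"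
      using inner_der[OF q' q', of t]
      by (simp add: has_real_derivative_iff_has_vector_derivative inner_commute)
    moreover have "((\<lambda>t. p t \<bullet> p t) has_real_derivative
      2 * (p t \<bullet> (A' (q t) - \<beta> *\<^sub>R A' (A (p t)) - \<gamma> *\<^sub>R p t))) (at t)"
      using inner_der[OF p' p', of t]
      by (simp add: has_real_derivative_iff_has_vector_derivative inner_commute)
    moreover have "((\<lambda>t. p t \<bullet> A' (q t)) has_real_derivative
      (p t \<bullet> A' (- (\<alpha>\<^sup>2 *\<^sub>R A (p t))) + (A' (q t) - \<beta> *\<^sub>R A' (A (p t)) - \<gamma> *\<^sub>R p t) \<bullet> A' (q t))) (at t)"
      using inner_der[OF p' A'q, of t]
      by (simp add: has_real_derivative_iff_has_vector_derivative)
    ultimately show ?thesis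
      unfolding F_def[abs_def] F'_def E_def power2_norm_eq_inner
      by (intro DERIV_diff DERIV_add DERIV_cmult)
  qed
  have F'_le: "F' t \<le> - (c / 2) * F t" for t
  proof -
    define r where "r = \<beta> *\<^sub>R A' (A (p t)) + \<gamma> *\<^sub>R p t"
    have r: "norm r \<le> (\<beta> * K2 * K1 + \<gamma>) * norm (p t)"
    proof -
      have "norm (A' (A (p t))) \<le> K2 * (K1 * norm (p t))"
        by (rule order_trans[OF K2(2)]) (use K1 K2 in auto)
      then have "\<beta> * norm (A' (A (p t))) \<le> \<beta> * (K2 * (K1 * norm (p t)))"
        using pos by (intro mult_left_mono) auto
      moreover have "norm r \<le> \<beta> * norm (A' (A (p t))) + \<gamma> * norm (p t)"
        unfolding r_def by (rule order_trans[OF norm_triangle_ineq]) (use pos in auto)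
      ultimately show ?thesis by (simp add: algebra_simps)
    qed
    then have r2: "r \<bullet> r \<le> (\<beta> * K2 * K1 + \<gamma>)\<^sup>2 * (p t \<bullet> p t)"
      using power_mono[OF r, of 2] by (simp add: power_mult_distrib power2_norm_eq_inner)
    have Ap: "A (p t) \<bullet> A (p t) \<le> K1\<^sup>2 * (p t \<bullet> p t)"
      using power_mono[OF K1(2)[of "p t"], of 2] by (simp add: power_mult_distrib power2_norm_eq_inner)
    have bel: "\<kappa>\<^sup>2 * (q t \<bullet> q t) \<le> A' (q t) \<bullet> A' (q t)"
      using power_mono[OF below[of t], of 2] pos by (simp add: power_mult_distrib power2_norm_eq_inner)
    \<comment> \<open>Half of the dissipation
      \<open>- 2 * \<epsilon> * (A' (q t) \<bullet> A' (q t))\<close> pays for the mixed term; the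
      other half remains to damp \<open>q\<close>.\<close>
    have young: "2 * (r \<bullet> A' (q t)) \<le> r \<bullet> r + A' (q t) \<bullet> A' (q t)"
      using inner_ge_zero[of "r - A' (q t)"] by (simp add: inner_diff inner_commute algebra_simps)
    have a1: "p t \<bullet> A' (A (p t)) = A (p t) \<bullet> A (p t)" by (simp add: adj)
    have a2: "q t \<bullet> A (p t) = p t \<bullet> A' (q t)" by (metis adj inner_commute)
    have "F' t = - (2 * \<alpha>\<^sup>2 * \<beta> * (A (p t) \<bullet> A (p t))) - 2 * \<alpha>\<^sup>2 * \<gamma> * (p t \<bullet> p t)
      - 2 * \<epsilon> * (A' (q t) \<bullet> A' (q t)) + \<epsilon> * (2 * (r \<bullet> A' (q t))) + 2 * \<epsilon> * \<alpha>\<^sup>2 * (A (p t) \<bullet> A (p t))"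
      unfolding F'_def r_def
      by (simp add: inner_diff_left inner_diff_right inner_add_left linear_scale[OF lin(2)] linear_neg[OF lin(2)] a1 a2 algebra_simps)
    also have "\<dots> \<le> 0 - 2 * \<alpha>\<^sup>2 * \<gamma> * (p t \<bullet> p t)
      - 2 * \<epsilon> * (A' (q t) \<bullet> A' (q t)) + \<epsilon> * ((\<beta> * K2 * K1 + \<gamma>)\<^sup>2 * (p t \<bullet> p t) + A' (q t) \<bullet> A' (q t)) + 2 * \<epsilon> * \<alpha>\<^sup>2 * (K1\<^sup>2 * (p t \<bullet> p t))"
      using young r2 Ap \<epsilon> pos by (intro add_mono diff_mono mult_left_mono) auto
    also have "\<dots> = - 2 * \<alpha>\<^sup>2 * \<gamma> * (p t \<bullet> p t) + \<epsilon> * M * (p t \<bullet> p t) - \<epsilon> * (A' (q t) \<bullet> A' (q t))"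
      by (simp add: M_def algebra_simps)
    also have "\<dots> \<le> - 2 * \<alpha>\<^sup>2 * \<gamma> * (p t \<bullet> p t) + \<alpha>\<^sup>2 * \<gamma> * (p t \<bullet> p t) - \<epsilon> * (\<kappa>\<^sup>2 * (q t \<bullet> q t))"
      using bel \<epsilon> by (intro diff_mono add_mono mult_right_mono mult_left_mono order_refl) auto
    also have "\<dots> = - (\<gamma> * (\<alpha>\<^sup>2 * (p t \<bullet> p t)) + (\<epsilon> * \<kappa>\<^sup>2) * (q t \<bullet> q t))" by (simp add: algebra_simps)
    also have "\<dots> \<le> - (c * (\<alpha>\<^sup>2 * (p t \<bullet> p t)) + c * (q t \<bullet> q t))"
      unfolding neg_le_iff_le c_def by (intro add_mono mult_right_mono) auto
    also have "\<dots> = - c * E t" by (simp add: E_def power2_norm_eq_inner algebra_simps)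
    also have "\<dots> \<le> - c * (F t / 2)"
    proof -
      have "E t \<ge> 0" by (simp add: E_def)
      then have "F t / 2 \<le> E t" using cross[of t] by (simp add: F_def)
      then show ?thesis using c by simp
    qed
    finally show ?thesis by simp
  qed
  \<comment> \<open>Gronwall's argument: the integrating factor turns \<open>F'_le\<close> into
    monotonicity of \<open>H\<close>.\<close>
  define H where "H t = F t * exp (c / 2 * t)" for t
  have H: "H t \<le> H 0" if "t \<ge> 0" for t
  proof (rule DERIV_nonpos_imp_nonincreasing[OF that])
    fix s
    have "(H has_real_derivative (F' s * exp (c / 2 * s) + F s * (exp (c / 2 * s) * (c / 2)))) (at s)"
      unfolding H_def[abs_def] by (auto intro!: derivative_eq_intros F')
    moreover have "F' s * exp (c / 2 * s) + F s * (exp (c / 2 * s) * (c / 2)) \<le> 0"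
      using mult_right_mono[OF F'_le[of s], of "exp (c / 2 * s)"] by (simp add: algebra_simps)
    ultimately show "\<exists>y. (H has_real_derivative y) (at s) \<and> y \<le> 0" by blast
  qed
  have E_le: "E t \<le> 2 * H 0 * exp (- (c / 2 * t))" if "t \<ge> 0" for t
  proof -
    have "F t \<le> H 0 * exp (- (c / 2 * t))"
      using H[OF that] by (simp add: H_def exp_minus field_simps)
    moreover have "E t / 2 \<le> F t" using cross[of t] by (simp add: F_def)
    ultimately show ?thesis by simp
  qed
  have lim: "((\<lambda>t. 2 * H 0 * exp (- (c / 2 * t))) \<longlongrightarrow> 0) at_top"
    using c by real_asymp
  have E0: "(E \<longlongrightarrow> 0) at_top"
  proof (rule tendsto_sandwich[OF _ _ tendsto_const lim])
    show "\<forall>\<^sub>F t in at_top. E t \<le> 2 * H 0 * exp (- (c / 2 * t))"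
      using eventually_ge_at_top[of 0] by eventually_elim (rule E_le)
  qed (simp add: E_def)
  have "((\<lambda>t. (norm (q t))\<^sup>2) \<longlongrightarrow> 0) at_top"
    by (rule tendsto_sandwich[OF _ _ tendsto_const E0]) (auto simp: E_def)
  then show "(q \<longlongrightarrow> 0) at_top"
    using tendsto_real_sqrt[of "\<lambda>t. (norm (q t))\<^sup>2" 0 at_top] by (simp add: tendsto_norm_zero_iff)
  have "((\<lambda>t. \<alpha>\<^sup>2 * (norm (p t))\<^sup>2) \<longlongrightarrow> 0) at_top"
    by (rule tendsto_sandwich[OF _ _ tendsto_const E0]) (auto simp: E_def)
  then have "((\<lambda>t. (norm (p t))\<^sup>2) \<longlongrightarrow> 0) at_top"
    using tendsto_mult_left[of _ 0 at_top "1 / \<alpha>\<^sup>2"] pos by fastforce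
  then show "(p \<longlongrightarrow> 0) at_top"
    using tendsto_real_sqrt[of "\<lambda>t. (norm (p t))\<^sup>2" 0 at_top] by (simp add: tendsto_norm_zero_iff)
qed


section \<open>Riemann--Stieltjes sums and variation of constants\<close>

definition grid :: "real \<Rightarrow> real \<Rightarrow> nat \<Rightarrow> nat \<Rightarrow> real" where
  "grid a b n i = a + real i * ((b - a) / real n)"

lemma grid_0 [simp]: "grid a b n 0 = a"
  by (simp add: grid_def)

lemma grid_end [simp]: "n > 0 \<Longrightarrow> grid a b n n = b"
  by (simp add: grid_def)

lemma grid_Suc: "grid a b n (Suc i) = grid a b n i + (b - a) / real n"
  by (simp add: grid_def algebra_simps add_divide_distrib diff_divide_distrib)

lemma grid_mono: "a \<le> b \<Longrightarrow> i \<le> j \<Longrightarrow> grid a b n i \<le> grid a b n j"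
  unfolding grid_def by (intro add_left_mono mult_right_mono) auto

lemma grid_in: "a \<le> b \<Longrightarrow> i \<le> n \<Longrightarrow> n > 0 \<Longrightarrow> grid a b n i \<in> {a..b}"
  using grid_mono[of a b 0 i n] grid_mono[of a b i n n] by simp

lemma grid_refine: "n > 0 \<Longrightarrow> m > 0 \<Longrightarrow> grid a b (n * m) (i * m) = grid a b n i"
  by (simp add: grid_def)

lemma integral_grid:
  fixes f :: "real \<Rightarrow> 'b::banach"
  assumes "a \<le> b" "n > 0" "f integrable_on {a..b}"
  shows "(\<Sum>i<n. integral {grid a b n i..grid a b n (Suc i)} f) = integral {a..b} f"
proof -
  have "(\<Sum>i<m. integral {grid a b n i..grid a b n (Suc i)} f) = integral {a..grid a b n m} f" if "m \<le> n" for m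
    using that
  proof (induction m)
    case (Suc m)
    have "f integrable_on {a..grid a b n (Suc m)}"
      by (rule integrable_on_subinterval[OF assms(3)]) (use grid_in[OF assms(1) Suc.prems assms(2)] in auto)
    then have "integral {a..grid a b n m} f + integral {grid a b n m..grid a b n (Suc m)} f = integral {a..grid a b n (Suc m)} f"
      using grid_mono[OF assms(1), of 0 m n] grid_mono[OF assms(1), of m "Suc m" n]
      by (intro Henstock_Kurzweil_Integration.integral_combine) auto
    then show ?case using Suc by simp
  qed simp
  from this[of n] show ?thesis using assms by simp
qed

text \<open>On each cell the error is the integral of \<open>g' s\<close> against \<open>w\<close>
  at the tag minus \<open>w s\<close>, which uniform continuity of \<open>w\<close> makes small. The
  tags are arbitrary because both endpoint rules occur later.\<close>

lemma riemann_stieltjes_tagged: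
  fixes g g' w :: "real \<Rightarrow> 'v::euclidean_space"
  assumes ab: "a \<le> b"
    and g: "\<And>s. (g has_vector_derivative g' s) (at s)"
    and g': "continuous_on {a..b} g'" and w: "continuous_on {a..b} w"
    and \<tau>: "\<And>n i. i < n \<Longrightarrow> \<tau> n i \<in> {grid a b n i..grid a b n (Suc i)}"
  shows "(\<lambda>n. \<Sum>i<n. (g (grid a b n (Suc i)) - g (grid a b n i)) \<bullet> w (\<tau> n i))
    \<longlonglongrightarrow> integral {a..b} (\<lambda>s. g' s \<bullet> w s)"
proof -
  have "compact (g' ` {a..b})" by (intro compact_continuous_image g' compact_Icc)
  then have "bounded (g' ` {a..b})" by (rule compact_imp_bounded)
  then obtain G where G: "G > 0" "\<And>s. s \<in> {a..b} \<Longrightarrow> norm (g' s) \<le> G"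
    unfolding bounded_pos by auto
  have uc: "uniformly_continuous_on {a..b} w"
    by (intro compact_uniformly_continuous w compact_Icc)
  have cont: "continuous_on {a..b} (\<lambda>s. g' s \<bullet> w s)"
    by (intro continuous_intros g' w)
  have "\<exists>n0. \<forall>n\<ge>n0. norm ((\<Sum>i<n. (g (grid a b n (Suc i)) - g (grid a b n i)) \<bullet> w (\<tau> n i))
      - integral {a..b} (\<lambda>s. g' s \<bullet> w s)) < e" if "e > 0" for e
  proof -
    \<comment> \<open>The summand \<open>1\<close> keeps the denominator positive when
      \<open>a = b\<close>.\<close>
    define \<epsilon> where "\<epsilon> = e / (2 * G * (b - a + 1))"
    have \<epsilon>: "\<epsilon> > 0" using G ab that by (simp add: \<epsilon>_def)
    obtain d where d: "d > 0" "\<And>x y. x \<in> {a..b} \<Longrightarrow> y \<in> {a..b} \<Longrightarrow> dist x y < d \<Longrightarrow> dist (w x) (w y) < \<epsilon>"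
      using uc[unfolded uniformly_continuous_on_def] \<epsilon> by metis
    obtain n0 :: nat where n0: "(b - a) / d < real n0" using reals_Archimedean2 by blast
    have "norm ((\<Sum>i<n. (g (grid a b n (Suc i)) - g (grid a b n i)) \<bullet> w (\<tau> n i))
      - integral {a..b} (\<lambda>s. g' s \<bullet> w s)) < e" if n: "n \<ge> Suc n0" for n
    proof -
      have n_pos: "n > 0" using n by simp
      have "real n0 < real n" using n by simp
      then have "(b - a) / d < real n" using n0 by linarith
      then have h: "(b - a) / real n < d" using d n_pos by (simp add: field_simps)
      have each: "norm ((g (grid a b n (Suc i)) - g (grid a b n i)) \<bullet> w (\<tau> n i)
        - integral {grid a b n i..grid a b n (Suc i)} (\<lambda>s. g' s \<bullet> w s)) \<le> G * \<epsilon> * ((b - a) / real n)"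
        if "i < n" for i
      proof -
        let ?l = "grid a b n i" and ?r = "grid a b n (Suc i)"
        have lr: "?l \<le> ?r" "?l \<in> {a..b}" "?r \<in> {a..b}"
          using grid_mono[OF ab, of i "Suc i" n] grid_in[OF ab _ n_pos] that by auto
        have \<tau>i: "\<tau> n i \<in> {?l..?r}" using \<tau> that by blast
        have sub: "{?l..?r} \<subseteq> {a..b}" using lr by auto
        have "(g' has_integral (g ?r - g ?l)) {?l..?r}"
          by (rule fundamental_theorem_of_calculus[OF lr(1)]) (rule has_vector_derivative_at_within[OF g])
        then have 1: "((\<lambda>s. g' s \<bullet> w (\<tau> n i)) has_integral ((g ?r - g ?l) \<bullet> w (\<tau> n i))) {?l..?r}"
          using has_integral_linear[OF _ bounded_linear_inner_left, of g'] by (simp add: o_def)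
        have 2: "((\<lambda>s. g' s \<bullet> w s) has_integral integral {?l..?r} (\<lambda>s. g' s \<bullet> w s)) {?l..?r}"
          by (intro integrable_integral integrable_continuous_real continuous_on_subset[OF cont sub])
        have "norm (g' s \<bullet> w (\<tau> n i) - g' s \<bullet> w s) \<le> G * \<epsilon>" if s: "s \<in> {?l..?r}" for s
        proof -
          have "dist (\<tau> n i) s < d"
            using h s \<tau>i grid_Suc[of a b n i] by (auto simp: dist_real_def)
          then have *: "norm (w (\<tau> n i) - w s) \<le> \<epsilon>"
            using d(2)[of "\<tau> n i" s] s \<tau>i sub by (force simp: dist_norm)
          have "norm (g' s \<bullet> (w (\<tau> n i) - w s)) \<le> norm (g' s) * norm (w (\<tau> n i) - w s)"
            by (simp add: Cauchy_Schwarz_ineq2)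
          also have "\<dots> \<le> G * \<epsilon>" using G s sub * by (intro mult_mono) auto
          finally show ?thesis by (simp add: inner_diff_right)
        qed
        then have "norm ((g ?r - g ?l) \<bullet> w (\<tau> n i) - integral {?l..?r} (\<lambda>s. g' s \<bullet> w s)) \<le> G * \<epsilon> * measure lborel {?l..?r}"
          using G \<epsilon> by (intro has_integral_bound_real[OF _ finite.emptyI has_integral_diff[OF 1 2]]) auto
        then show ?thesis using lr by (simp add: grid_Suc)
      qed
      have "norm ((\<Sum>i<n. (g (grid a b n (Suc i)) - g (grid a b n i)) \<bullet> w (\<tau> n i)) - integral {a..b} (\<lambda>s. g' s \<bullet> w s))
        = norm (\<Sum>i<n. (g (grid a b n (Suc i)) - g (grid a b n i)) \<bullet> w (\<tau> n i)
            - integral {grid a b n i..grid a b n (Suc i)} (\<lambda>s. g' s \<bullet> w s))"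
        using integral_grid[OF ab n_pos integrable_continuous_real[OF cont]] by (simp add: sum_subtractf)
      also have "\<dots> \<le> (\<Sum>i<n. G * \<epsilon> * ((b - a) / real n))"
        by (rule sum_norm_le) (use each in auto)
      also have "\<dots> = G * \<epsilon> * (b - a)" using n_pos by simp
      also have "\<dots> \<le> G * \<epsilon> * (b - a + 1)" using G \<epsilon> by (intro mult_left_mono) auto
      also have "\<dots> = e / 2" using G ab by (simp add: \<epsilon>_def divide_simps)
      also have "\<dots> < e" using \<open>e > 0\<close> by simp
      finally show ?thesis .
    qed
    then show ?thesis by blast
  qed
  then show ?thesis unfolding LIMSEQ_iff by blast
qed

section \<open>Integration by parts and variation of constants\<close>

lemma summation_by_parts:
  fixes g w :: "nat \<Rightarrow> 'v::real_inner"
  shows "(\<Sum>i<n. g i \<bullet> (w (Suc i) - w i)) = g n \<bullet> w n - g 0 \<bullet> w 0 - (\<Sum>i<n. (g (Suc i) - g i) \<bullet> w (Suc i))"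
    and "(\<Sum>i<n. g (Suc i) \<bullet> (w (Suc i) - w i)) = g n \<bullet> w n - g 0 \<bullet> w 0 - (\<Sum>i<n. (g (Suc i) - g i) \<bullet> w i)"
  by (induction n) (simp_all add: inner_diff algebra_simps)

text \<open>Only continuity of \<open>w\<close> is available, since it will be a Brownian path;
  summation by parts moves the differences onto the smooth \<open>g\<close>. Evaluating
  \<open>g\<close> at left endpoints leaves \<open>w\<close> at right endpoints, and
  conversely.\<close>

lemma riemann_stieltjes_by_parts:
  fixes g g' w :: "real \<Rightarrow> 'v::euclidean_space"
  assumes "a \<le> b" "\<And>s. (g has_vector_derivative g' s) (at s)"
    "continuous_on {a..b} g'" "continuous_on {a..b} w"
  shows riemann_left: "(\<lambda>n. \<Sum>i<n. g (grid a b n i) \<bullet> (w (grid a b n (Suc i)) - w (grid a b n i)))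
      \<longlonglongrightarrow> g b \<bullet> w b - g a \<bullet> w a - integral {a..b} (\<lambda>s. g' s \<bullet> w s)"
    and riemann_right: "(\<lambda>n. \<Sum>i<n. g (grid a b n (Suc i)) \<bullet> (w (grid a b n (Suc i)) - w (grid a b n i)))
      \<longlonglongrightarrow> g b \<bullet> w b - g a \<bullet> w a - integral {a..b} (\<lambda>s. g' s \<bullet> w s)"
proof -
  have *: "(\<lambda>n. g b \<bullet> w b - g a \<bullet> w a - (\<Sum>i<n. (g (grid a b n (Suc i)) - g (grid a b n i)) \<bullet> w (\<tau> n i)))
      \<longlonglongrightarrow> g b \<bullet> w b - g a \<bullet> w a - integral {a..b} (\<lambda>s. g' s \<bullet> w s)"
    if "\<And>n i. i < n \<Longrightarrow> \<tau> n i \<in> {grid a b n i..grid a b n (Suc i)}" for \<tau>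
    by (intro tendsto_diff tendsto_const riemann_stieltjes_tagged assms that)
  have gr: "grid a b n i \<le> grid a b n (Suc i)" for n i using assms(1) by (rule grid_mono) simp
  show "(\<lambda>n. \<Sum>i<n. g (grid a b n i) \<bullet> (w (grid a b n (Suc i)) - w (grid a b n i)))
      \<longlonglongrightarrow> g b \<bullet> w b - g a \<bullet> w a - integral {a..b} (\<lambda>s. g' s \<bullet> w s)"
    by (rule Lim_transform_eventually[OF *[of "\<lambda>n i. grid a b n (Suc i)"]])
      (use gr in \<open>auto intro!: eventually_mono[OF eventually_gt_at_top[of 0]]
        simp: summation_by_parts(1)[of "\<lambda>i. g (grid a b n i)" "\<lambda>i. w (grid a b n i)" n for n]\<close>)
  show "(\<lambda>n. \<Sum>i<n. g (grid a b n (Suc i)) \<bullet> (w (grid a b n (Suc i)) - w (grid a b n i)))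
      \<longlonglongrightarrow> g b \<bullet> w b - g a \<bullet> w a - integral {a..b} (\<lambda>s. g' s \<bullet> w s)"
    by (rule Lim_transform_eventually[OF *[of "\<lambda>n i. grid a b n i"]])
      (use gr in \<open>auto intro!: eventually_mono[OF eventually_gt_at_top[of 0]]
        simp: summation_by_parts(2)[of "\<lambda>i. g (grid a b n i)" "\<lambda>i. w (grid a b n i)" n for n]\<close>)
qed

text \<open>The solution \<open>z\<close> is as rough as \<open>w\<close>, but
  \<open>R = z - w\<close> is differentiable. In the derivative of
  \<open>y (t - s) \<bullet> R s\<close> adjointness cancels the terms in \<open>z\<close>, and only
  the pairing with \<open>w\<close> survives.\<close>

lemma variation_of_constants:
  fixes B C :: "'e::euclidean_space \<Rightarrow> 'e"
  assumes adj: "\<And>x y. B x \<bullet> y = x \<bullet> C y" and B: "linear B"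
    and y: "y 0 = \<theta>" "\<And>s. (y has_vector_derivative C (y s)) (at s)"
    and t: "t \<ge> 0" and z: "continuous_on {0..t} z"
    and eq: "\<And>s. s \<in> {0..t} \<Longrightarrow> z s = z0 + integral {0..s} (\<lambda>r. B (z r)) + w s"
  shows "\<theta> \<bullet> z t = y t \<bullet> z0 + \<theta> \<bullet> w t + integral {0..t} (\<lambda>s. C (y (t - s)) \<bullet> w s)"
proof -
  define R where "R s = z0 + integral {0..s} (\<lambda>r. B (z r))" for s
  have zR: "z s = R s + w s" if "s \<in> {0..t}" for s using eq[OF that] by (simp add: R_def)
  have contB: "continuous_on {0..t} (\<lambda>r. B (z r))"
    using B by (intro bounded_linear.continuous_on[OF _ z]) (simp add: linear_conv_bounded_linear)
  have R': "(R has_vector_derivative B (z s)) (at s within {0..t})" if "s \<in> {0..t}" for s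
    unfolding R_def[abs_def]
    using has_vector_derivative_add[OF has_vector_derivative_const[of z0]
        integral_has_vector_derivative[OF contB that]] by simp
  have "((\<lambda>s. C (y (t - s)) \<bullet> w s) has_integral (y (t - t) \<bullet> R t - y (t - 0) \<bullet> R 0)) {0..t}"
  proof (rule fundamental_theorem_of_calculus[OF t])
    fix s assume s: "s \<in> {0..t}"
    have "((\<lambda>s. t - s) has_real_derivative -1) (at s within {0..t})"
      by (auto intro!: derivative_eq_intros)
    moreover have "(y has_vector_derivative C (y (t - s))) (at (t - s) within (\<lambda>s. t - s) ` {0..t})"
      by (rule has_vector_derivative_at_within[OF y(2)])
    ultimately have "((\<lambda>s. y (t - s)) has_vector_derivative - C (y (t - s))) (at s within {0..t})"
      using vector_diff_chain_within[of "\<lambda>s. t - s" "-1" s "{0..t}" y]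
      by (auto simp: o_def has_real_derivative_iff_has_vector_derivative)
    then have "((\<lambda>s. y (t - s) \<bullet> R s) has_vector_derivative (y (t - s) \<bullet> B (z s) + (- C (y (t - s))) \<bullet> R s)) (at s within {0..t})"
      by (rule bounded_bilinear.has_vector_derivative[OF bounded_bilinear_inner _ R'[OF s]])
    also have "y (t - s) \<bullet> B (z s) + (- C (y (t - s))) \<bullet> R s = C (y (t - s)) \<bullet> w s"
    proof -
      have "y (t - s) \<bullet> B (z s) = C (y (t - s)) \<bullet> z s" by (metis adj inner_commute)
      then show ?thesis by (simp add: zR[OF s] inner_add_right)
    qed
    finally show "((\<lambda>s. y (t - s) \<bullet> R s) has_vector_derivative C (y (t - s)) \<bullet> w s) (at s within {0..t})" .
  qed
  then have "integral {0..t} (\<lambda>s. C (y (t - s)) \<bullet> w s) = \<theta> \<bullet> R t - y t \<bullet> z0"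
    using y by (simp add: integral_unique R_def)
  then show ?thesis using zR[of t] t by (simp add: inner_add_right)
qed


section \<open>Weak limits and convergence in mean square\<close>

lemma LIMSEQ_by_subsequences:
  fixes x :: "nat \<Rightarrow> 'a::metric_space"
  assumes "\<And>r :: nat \<Rightarrow> nat. strict_mono r \<Longrightarrow> \<exists>r'. strict_mono r' \<and> (\<lambda>n. x (r (r' n))) \<longlonglongrightarrow> l"
  shows "x \<longlonglongrightarrow> l"
proof (rule ccontr)
  assume "\<not> x \<longlonglongrightarrow> l"
  then obtain e where e: "e > 0" "\<not> (\<forall>\<^sub>F n in sequentially. dist (x n) l < e)"
    unfolding tendsto_iff by blast
  then have "infinite {n. dist (x n) l \<ge> e}"
    by (simp add: not_eventually not_less cofinite_eq_sequentially[symmetric] frequently_cofinite)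
  then obtain r :: "nat \<Rightarrow> nat" where r: "strict_mono r" "\<And>n. dist (x (r n)) l \<ge> e"
    using infinite_enumerate by blast
  obtain r' where r': "(\<lambda>n. x (r (r' n))) \<longlonglongrightarrow> l" using assms[OF r(1)] by blast
  have "\<forall>\<^sub>F n in sequentially. dist (x (r (r' n))) l < e"
    using r' e(1) unfolding tendsto_iff by blast
  moreover have "\<not> dist (x (r (r' n))) l < e" for n using r(2)[of "r' n"] by simp
  ultimately show False by simp
qed

section \<open>Uniqueness of weak limits\<close>

lemma open_real_indicator_limit:
  fixes U :: "'b::metric_space set"
  assumes "open U"
  obtains f :: "nat \<Rightarrow> 'b \<Rightarrow> real" where
    "\<And>n. continuous_on UNIV (f n)" "\<And>n x. 0 \<le> f n x \<and> f n x \<le> 1"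
    "\<And>x. (\<lambda>n. f n x) \<longlonglongrightarrow> indicator U x"
proof (cases "U = UNIV")
  \<comment> \<open>The complement is empty here and \<open>infdist\<close> to the empty set is
    \<open>0\<close>, so the formula of the other case would give the limit \<open>0\<close> in
    place of \<open>1\<close>.\<close>
  case True
  then show ?thesis using that[of "\<lambda>_ _. 1"] by simp
next
  case False
  define f where "f n x = min 1 (real n * infdist x (- U))" for n x
  show ?thesis
  proof (rule that)
    show "continuous_on UNIV (f n)" for n
      unfolding f_def by (intro continuous_intros)
    show "0 \<le> f n x \<and> f n x \<le> 1" for n x by (simp add: f_def infdist_nonneg)
    show "(\<lambda>n. f n x) \<longlonglongrightarrow> indicator U x" for x
    proof (cases "x \<in> U")
      case True
      have "infdist x (- U) > 0"
        using True \<open>open U\<close> False by (intro infdist_pos_not_in_closed) auto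
      then obtain n0 :: nat where n0: "1 < real n0 * infdist x (- U)"
        using ex_less_of_nat_mult by blast
      have "f n x = 1" if "n \<ge> n0" for n
      proof -
        have "real n0 * infdist x (- U) \<le> real n * infdist x (- U)"
          using that by (intro mult_right_mono) (auto simp: infdist_nonneg)
        then show ?thesis using n0 by (simp add: f_def)
      qed
      then have "\<forall>\<^sub>F n in sequentially. f n x = 1" by (auto simp: eventually_sequentially)
      then show ?thesis using True by (simp add: tendsto_eventually)
    qed (simp add: f_def)
  qed
qed

text \<open>Indicators of open sets are bounded pointwise limits of continuous functions, and the
  open sets form an intersection-stable generator of the Borel sets.\<close>

lemma measure_eq_if_integrals_eq:
  fixes \<mu> \<nu> :: "'b::metric_space measure"
  assumes \<mu>: "prob_space \<mu>" "sets \<mu> = sets borel" and \<nu>: "prob_space \<nu>" "sets \<nu> = sets borel"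
    and eq: "\<And>f :: 'b \<Rightarrow> real. continuous_on UNIV f \<Longrightarrow> bounded (range f) \<Longrightarrow> integral\<^sup>L \<mu> f = integral\<^sup>L \<nu> f"
  shows "\<mu> = \<nu>"
proof -
  interpret \<mu>: prob_space \<mu> by fact
  interpret \<nu>: prob_space \<nu> by fact
  have sp: "space \<mu> = UNIV" "space \<nu> = UNIV"
    using sets_eq_imp_space_eq[OF \<mu>(2)] sets_eq_imp_space_eq[OF \<nu>(2)] by auto
  note [measurable_cong] = \<mu>(2) \<nu>(2)
  have open_eq: "emeasure \<mu> U = emeasure \<nu> U" if U: "open U" for U
  proof -
    obtain f :: "nat \<Rightarrow> 'b \<Rightarrow> real" where f: "\<And>n. continuous_on UNIV (f n)"
      "\<And>n x. 0 \<le> f n x \<and> f n x \<le> 1" "\<And>x. (\<lambda>n. f n x) \<longlonglongrightarrow> indicator U x"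
      using open_real_indicator_limit[OF U] by blast
    have [measurable]: "f n \<in> borel_measurable borel" for n
      by (rule borel_measurable_continuous_onI[OF f(1)])
    have [measurable]: "U \<in> sets borel" using U by simp
    have bnd: "norm (f n x) \<le> 1" for n x using f(2)[of n x] by simp
    have "(\<lambda>n. integral\<^sup>L \<mu> (f n)) \<longlonglongrightarrow> integral\<^sup>L \<mu> (indicator U)"
      by (rule integral_dominated_convergence[where w="\<lambda>_. 1"]) (use f(3) bnd in auto)
    moreover have "(\<lambda>n. integral\<^sup>L \<nu> (f n)) \<longlonglongrightarrow> integral\<^sup>L \<nu> (indicator U)"
      by (rule integral_dominated_convergence[where w="\<lambda>_. 1"]) (use f(3) bnd in auto)
    moreover have "integral\<^sup>L \<mu> (f n) = integral\<^sup>L \<nu> (f n)" for n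
      using bnd by (intro eq f(1)) (auto simp: bounded_iff)
    ultimately have "integral\<^sup>L \<mu> (indicator U) = (integral\<^sup>L \<nu> (indicator U) :: real)"
      using LIMSEQ_unique by fastforce
    then have "measure \<mu> U = measure \<nu> U" using sp by simp
    then show ?thesis by (simp add: \<mu>.emeasure_eq_measure \<nu>.emeasure_eq_measure)
  qed
  show ?thesis
  proof (rule measure_eqI_generator_eq[where E="Collect open" and \<Omega>=UNIV and A="\<lambda>_. UNIV"])
    show "Int_stable (Collect open :: 'b set set)" by (auto simp: Int_stable_def)
    show "sets \<mu> = sigma_sets UNIV (Collect open)" "sets \<nu> = sigma_sets UNIV (Collect open)"
      using \<mu> \<nu> by (simp_all add: borel_def)
  qed (use open_eq in auto)
qed

lemma limiting_distribution_unique: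
  fixes Z :: "real \<Rightarrow> 'a \<Rightarrow> 'b::metric_space"
  assumes "limiting_distribution M Z \<mu>" "limiting_distribution M Z \<nu>"
  shows "\<mu> = \<nu>"
proof (rule measure_eq_if_integrals_eq)
  fix f :: "'b \<Rightarrow> real" assume "continuous_on UNIV f" "bounded (range f)"
  then have "((\<lambda>t. integral\<^sup>L (distr M borel (Z t)) f) \<longlongrightarrow> integral\<^sup>L \<mu> f) at_top"
    "((\<lambda>t. integral\<^sup>L (distr M borel (Z t)) f) \<longlongrightarrow> integral\<^sup>L \<nu> f) at_top"
    using assms by (auto simp: limiting_distribution_def)
  then show "integral\<^sup>L \<mu> f = integral\<^sup>L \<nu> f"
    by (rule tendsto_unique[OF trivial_limit_at_top_linorder])
qed (use assms in \<open>auto simp: limiting_distribution_def\<close>)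

text \<open>Measurability is a separate conjunct because integrability of the square does not imply
  it.\<close>

definition sq_int :: "'a measure \<Rightarrow> ('a \<Rightarrow> real) \<Rightarrow> bool" where
  "sq_int M X \<longleftrightarrow> X \<in> borel_measurable M \<and> integrable M (\<lambda>\<omega>. (X \<omega>)\<^sup>2)"

lemma sq_int_mult:
  assumes "sq_int M X" "sq_int M Y" shows "integrable M (\<lambda>\<omega>. X \<omega> * Y \<omega>)"
proof (rule Bochner_Integration.integrable_bound)
  show "integrable M (\<lambda>\<omega>. (X \<omega>)\<^sup>2 + (Y \<omega>)\<^sup>2)"
    "(\<lambda>\<omega>. X \<omega> * Y \<omega>) \<in> borel_measurable M"
    using assms by (auto simp: sq_int_def)
  have "\<bar>x * y\<bar> \<le> x\<^sup>2 + y\<^sup>2" for x y :: real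
  proof -
    have "2 * (\<bar>x\<bar> * \<bar>y\<bar>) \<le> x\<^sup>2 + y\<^sup>2" using sum_squares_bound[of "\<bar>x\<bar>" "\<bar>y\<bar>"] by simp
    moreover have "0 \<le> \<bar>x\<bar> * \<bar>y\<bar>" by simp
    ultimately show ?thesis unfolding abs_mult by linarith
  qed
  then show "AE \<omega> in M. norm (X \<omega> * Y \<omega>) \<le> norm ((X \<omega>)\<^sup>2 + (Y \<omega>)\<^sup>2)" by simp
qed

lemma sq_int_add:
  assumes "sq_int M X" "sq_int M Y" shows "sq_int M (\<lambda>\<omega>. X \<omega> + Y \<omega>)"
  using assms sq_int_mult[OF assms] by (auto simp: sq_int_def power2_sum mult.assoc)

lemma sq_int_cmult: "sq_int M X \<Longrightarrow> sq_int M (\<lambda>\<omega>. c * X \<omega>)"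
  by (auto simp: sq_int_def power_mult_distrib)

lemma sq_int_diff:
  assumes "sq_int M X" "sq_int M Y" shows "sq_int M (\<lambda>\<omega>. X \<omega> - Y \<omega>)"
  using sq_int_add[OF assms(1) sq_int_cmult[OF assms(2), of "-1"]] by simp

lemma sq_int_sum: "(\<And>i. i \<in> I \<Longrightarrow> sq_int M (X i)) \<Longrightarrow> sq_int M (\<lambda>\<omega>. \<Sum>i\<in>I. X i \<omega>)"
proof (induction I rule: infinite_finite_induct)
  case (insert i I)
  then show ?case by (simp add: sq_int_add)
qed (simp_all add: sq_int_def)

text \<open>Pythagoras in mean square; it serves both for the components of one increment and for
  successive increments.\<close>

lemma integral_power2_sum_orthogonal:
  assumes "\<And>i. i \<in> I \<Longrightarrow> sq_int M (X i)" and "finite I"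
    and "\<And>i j. i \<in> I \<Longrightarrow> j \<in> I \<Longrightarrow> i \<noteq> j \<Longrightarrow> (\<integral>\<omega>. X i \<omega> * X j \<omega> \<partial>M) = 0"
  shows "(\<integral>\<omega>. (\<Sum>i\<in>I. X i \<omega>)\<^sup>2 \<partial>M) = (\<Sum>i\<in>I. \<integral>\<omega>. (X i \<omega>)\<^sup>2 \<partial>M)"
proof -
  have "(\<integral>\<omega>. (\<Sum>i\<in>I. X i \<omega>)\<^sup>2 \<partial>M) = (\<integral>\<omega>. (\<Sum>i\<in>I. \<Sum>j\<in>I. X i \<omega> * X j \<omega>) \<partial>M)"
    by (simp add: power2_eq_square sum_product)
  also have "\<dots> = (\<Sum>i\<in>I. \<Sum>j\<in>I. \<integral>\<omega>. X i \<omega> * X j \<omega> \<partial>M)"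
  proof -
    have "integrable M (\<lambda>\<omega>. X i \<omega> * X j \<omega>)" if "i \<in> I" "j \<in> I" for i j
      using assms that by (intro sq_int_mult) auto
    then show ?thesis by (simp add: Bochner_Integration.integral_sum)
  qed
  also have "\<dots> = (\<Sum>i\<in>I. \<Sum>j\<in>I. if j = i then \<integral>\<omega>. (X i \<omega>)\<^sup>2 \<partial>M else 0)"
    using assms by (intro sum.cong) (auto simp: power2_eq_square)
  finally show ?thesis using assms(2) by simp
qed

section \<open>Mean-square limits and bounded continuous test functions\<close>

context prob_space
begin

lemma sq_int_integrable: "sq_int M X \<Longrightarrow> integrable M X"
  using sq_int_mult[of M X "\<lambda>_. 1"] by (simp add: sq_int_def)

lemma expectation_power2_le: "sq_int M X \<Longrightarrow> (expectation X)\<^sup>2 \<le> expectation (\<lambda>\<omega>. (X \<omega>)\<^sup>2)"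
  using variance_positive[of X] variance_eq[OF sq_int_integrable, of X]
  by (auto simp: sq_int_def)

text \<open>Fatou's lemma in the index \<open>m\<close> turns the Cauchy estimate into a bound on
  the distance to the almost sure limit, which is thereby identified as the mean-square limit. First
  and second moments then converge as well.\<close>

lemma L2_limit:
  fixes X :: "nat \<Rightarrow> 'a \<Rightarrow> real"
  assumes X: "\<And>n. sq_int M (X n)" and Y: "Y \<in> borel_measurable M"
    and lim: "AE \<omega> in M. (\<lambda>n. X n \<omega>) \<longlonglongrightarrow> Y \<omega>"
    and Cauchy: "\<And>e. e > 0 \<Longrightarrow> \<exists>N. \<forall>n\<ge>N. \<forall>m\<ge>n. expectation (\<lambda>\<omega>. (X m \<omega> - X n \<omega>)\<^sup>2) \<le> e"
  shows "sq_int M Y"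
    and "(\<lambda>n. expectation (\<lambda>\<omega>. (Y \<omega> - X n \<omega>)\<^sup>2)) \<longlonglongrightarrow> 0"
    and "(\<lambda>n. expectation (\<lambda>\<omega>. (X n \<omega>)\<^sup>2)) \<longlonglongrightarrow> expectation (\<lambda>\<omega>. (Y \<omega>)\<^sup>2)"
    and "(\<lambda>n. expectation (X n)) \<longlonglongrightarrow> expectation Y"
proof -
  have [measurable]: "X n \<in> borel_measurable M" for n using X by (simp add: sq_int_def)
  note [measurable] = Y
  have fatou: "(\<integral>\<^sup>+\<omega>. ennreal ((Y \<omega> - X n \<omega>)\<^sup>2) \<partial>M) \<le> ennreal e"
    if e: "\<And>m. m \<ge> n \<Longrightarrow> expectation (\<lambda>\<omega>. (X m \<omega> - X n \<omega>)\<^sup>2) \<le> e" "e > 0" for n e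
  proof -
    have "(\<integral>\<^sup>+\<omega>. ennreal ((Y \<omega> - X n \<omega>)\<^sup>2) \<partial>M) = (\<integral>\<^sup>+\<omega>. liminf (\<lambda>m. ennreal ((X m \<omega> - X n \<omega>)\<^sup>2)) \<partial>M)"
    proof (rule nn_integral_cong_AE)
      show "AE \<omega> in M. ennreal ((Y \<omega> - X n \<omega>)\<^sup>2) = liminf (\<lambda>m. ennreal ((X m \<omega> - X n \<omega>)\<^sup>2))"
        using lim
      proof eventually_elim
        case (elim \<omega>)
        then have "(\<lambda>m. ennreal ((X m \<omega> - X n \<omega>)\<^sup>2)) \<longlonglongrightarrow> ennreal ((Y \<omega> - X n \<omega>)\<^sup>2)"
          by (intro tendsto_intros)
        then show ?case by (rule lim_imp_Liminf[OF sequentially_bot, symmetric])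
      qed
    qed
    also have "\<dots> \<le> liminf (\<lambda>m. \<integral>\<^sup>+\<omega>. ennreal ((X m \<omega> - X n \<omega>)\<^sup>2) \<partial>M)"
      by (rule nn_integral_liminf) measurable
    also have "\<dots> \<le> limsup (\<lambda>m. \<integral>\<^sup>+\<omega>. ennreal ((X m \<omega> - X n \<omega>)\<^sup>2) \<partial>M)"
      by (rule Liminf_le_Limsup) simp
    also have "\<dots> \<le> ennreal e"
    proof (rule Limsup_bounded)
      have "(\<integral>\<^sup>+\<omega>. ennreal ((X m \<omega> - X n \<omega>)\<^sup>2) \<partial>M) \<le> ennreal e" if "m \<ge> n" for m
      proof -
        have "integrable M (\<lambda>\<omega>. (X m \<omega> - X n \<omega>)\<^sup>2)"
          using sq_int_diff[OF X X] by (simp add: sq_int_def)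
        then show ?thesis using e(1)[OF that] by (subst nn_integral_eq_integral) (auto intro: ennreal_leI)
      qed
      then show "\<forall>\<^sub>F m in sequentially. (\<integral>\<^sup>+\<omega>. ennreal ((X m \<omega> - X n \<omega>)\<^sup>2) \<partial>M) \<le> ennreal e"
        by (auto simp: eventually_sequentially)
    qed
    finally show ?thesis .
  qed
  have D: "sq_int M (\<lambda>\<omega>. Y \<omega> - X n \<omega>) \<and> expectation (\<lambda>\<omega>. (Y \<omega> - X n \<omega>)\<^sup>2) \<le> e"
    if e: "\<And>m. m \<ge> n \<Longrightarrow> expectation (\<lambda>\<omega>. (X m \<omega> - X n \<omega>)\<^sup>2) \<le> e" "e > 0" for n e
  proof -
    have int: "integrable M (\<lambda>\<omega>. (Y \<omega> - X n \<omega>)\<^sup>2)"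
      using fatou[OF e] by (intro integrableI_bounded) (auto intro: le_less_trans)
    then have "ennreal (expectation (\<lambda>\<omega>. (Y \<omega> - X n \<omega>)\<^sup>2)) \<le> ennreal e"
      using fatou[OF e] by (subst nn_integral_eq_integral[symmetric]) auto
    then show ?thesis using int e(2) by (simp add: sq_int_def)
  qed
  obtain N1 where "\<forall>n\<ge>N1. \<forall>m\<ge>n. expectation (\<lambda>\<omega>. (X m \<omega> - X n \<omega>)\<^sup>2) \<le> 1"
    using Cauchy[of 1] by auto
  then have "sq_int M (\<lambda>\<omega>. Y \<omega> - X N1 \<omega>)" using D[of N1 1] by auto
  from sq_int_add[OF this X[of N1]] show sqY: "sq_int M Y" by simp
  have sqD: "sq_int M (\<lambda>\<omega>. Y \<omega> - X n \<omega>)" for n by (rule sq_int_diff[OF sqY X])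
  show D0: "(\<lambda>n. expectation (\<lambda>\<omega>. (Y \<omega> - X n \<omega>)\<^sup>2)) \<longlonglongrightarrow> 0"
  proof (rule LIMSEQ_I)
    fix e :: real assume "e > 0"
    then obtain N where N: "\<forall>n\<ge>N. \<forall>m\<ge>n. expectation (\<lambda>\<omega>. (X m \<omega> - X n \<omega>)\<^sup>2) \<le> e / 2"
      using Cauchy[of "e / 2"] by auto
    have "norm (expectation (\<lambda>\<omega>. (Y \<omega> - X n \<omega>)\<^sup>2) - 0) < e" if "n \<ge> N" for n
    proof -
      have "expectation (\<lambda>\<omega>. (Y \<omega> - X n \<omega>)\<^sup>2) \<le> e / 2" using D[of n "e / 2"] N that \<open>e > 0\<close> by auto
      moreover have "expectation (\<lambda>\<omega>. (Y \<omega> - X n \<omega>)\<^sup>2) \<ge> 0" by (rule integral_nonneg_AE) simp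
      ultimately show ?thesis using \<open>e > 0\<close> by simp
    qed
    then show "\<exists>no. \<forall>n\<ge>no. norm (expectation (\<lambda>\<omega>. (Y \<omega> - X n \<omega>)\<^sup>2) - 0) < e" by blast
  qed
  let ?d = "\<lambda>n. expectation (\<lambda>\<omega>. (Y \<omega> - X n \<omega>)\<^sup>2)"
  have "(\<lambda>n. expectation Y - expectation (X n)) \<longlonglongrightarrow> 0"
  proof (rule Lim_null_comparison)
    show "(\<lambda>n. sqrt (?d n)) \<longlonglongrightarrow> 0" using tendsto_real_sqrt[OF D0] by simp
    have "expectation Y - expectation (X n) = expectation (\<lambda>\<omega>. Y \<omega> - X n \<omega>)" for n
      using sqY X by (simp add: sq_int_integrable)
    then show "\<forall>\<^sub>F n in sequentially. norm (expectation Y - expectation (X n)) \<le> sqrt (?d n)"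
      using expectation_power2_le[OF sqD] by (simp add: real_le_rsqrt)
  qed
  from tendsto_diff[OF tendsto_const[of "expectation Y"] this]
  show "(\<lambda>n. expectation (X n)) \<longlonglongrightarrow> expectation Y" by simp
  define K where "K = expectation (\<lambda>\<omega>. (Y \<omega>)\<^sup>2)"
  have K: "K \<ge> 0" unfolding K_def by (rule integral_nonneg_AE) simp
  \<comment> \<open>The weight \<open>\<delta>\<close> in Young's inequality is free: the first term
    is made small by \<open>\<delta>\<close> alone, and for fixed \<open>\<delta>\<close> the second
    vanishes as \<open>n\<close> grows.\<close>
  have bound: "\<bar>expectation (\<lambda>\<omega>. (X n \<omega>)\<^sup>2) - K\<bar> \<le> \<delta> * K + (1 / \<delta> + 1) * ?d n" if "\<delta> > 0" for n \<delta>
  proof -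
    have pt: "\<bar>x\<^sup>2 - y\<^sup>2\<bar> \<le> \<delta> * y\<^sup>2 + (1 / \<delta> + 1) * (y - x)\<^sup>2" for x y :: real
    proof -
      have "2 * \<bar>y\<bar> * \<bar>y - x\<bar> \<le> \<delta> * y\<^sup>2 + (1 / \<delta>) * (y - x)\<^sup>2"
      proof -
        have "0 \<le> (sqrt \<delta> * \<bar>y\<bar> - \<bar>y - x\<bar> / sqrt \<delta>)\<^sup>2" by simp
        also have "\<dots> = \<delta> * y\<^sup>2 + (1 / \<delta>) * (y - x)\<^sup>2 - 2 * \<bar>y\<bar> * \<bar>y - x\<bar>"
          using that by (simp add: power2_diff power_mult_distrib power_divide)
        finally show ?thesis by simp
      qed
      moreover have "\<bar>x\<^sup>2 - y\<^sup>2\<bar> \<le> 2 * \<bar>y\<bar> * \<bar>y - x\<bar> + (y - x)\<^sup>2"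
      proof -
        have "x\<^sup>2 - y\<^sup>2 = (y - x)\<^sup>2 - 2 * y * (y - x)" by (simp add: power2_eq_square algebra_simps)
        then have "\<bar>x\<^sup>2 - y\<^sup>2\<bar> \<le> \<bar>(y - x)\<^sup>2\<bar> + \<bar>2 * y * (y - x)\<bar>" by (simp only: abs_triangle_ineq4)
        then show ?thesis by (simp add: abs_mult)
      qed
      ultimately show ?thesis by (simp add: algebra_simps)
    qed
    have i: "integrable M (\<lambda>\<omega>. (X n \<omega>)\<^sup>2)" "integrable M (\<lambda>\<omega>. (Y \<omega>)\<^sup>2)" "integrable M (\<lambda>\<omega>. (Y \<omega> - X n \<omega>)\<^sup>2)"
      using X sqY sqD by (auto simp: sq_int_def)
    have "\<bar>expectation (\<lambda>\<omega>. (X n \<omega>)\<^sup>2) - K\<bar> = \<bar>expectation (\<lambda>\<omega>. (X n \<omega>)\<^sup>2 - (Y \<omega>)\<^sup>2)\<bar>"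
      using i by (simp add: K_def)
    also have "\<dots> \<le> expectation (\<lambda>\<omega>. \<bar>(X n \<omega>)\<^sup>2 - (Y \<omega>)\<^sup>2\<bar>)"
      by (rule integral_abs_bound)
    also have "\<dots> \<le> expectation (\<lambda>\<omega>. \<delta> * (Y \<omega>)\<^sup>2 + (1 / \<delta> + 1) * (Y \<omega> - X n \<omega>)\<^sup>2)"
      using i by (intro integral_mono pt) auto
    also have "\<dots> = \<delta> * K + (1 / \<delta> + 1) * ?d n" using i by (simp add: K_def)
    finally show ?thesis .
  qed
  show "(\<lambda>n. expectation (\<lambda>\<omega>. (X n \<omega>)\<^sup>2)) \<longlonglongrightarrow> expectation (\<lambda>\<omega>. (Y \<omega>)\<^sup>2)"
    unfolding K_def[symmetric]
  proof (rule LIMSEQ_I)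
    fix e :: real assume "e > 0"
    \<comment> \<open>Dividing by \<open>K + 1\<close> covers the case \<open>K = 0\<close>.\<close>
    define \<delta> where "\<delta> = e / (2 * (K + 1))"
    have \<delta>: "\<delta> > 0" using \<open>e > 0\<close> K by (simp add: \<delta>_def)
    have "\<delta> * K \<le> \<delta> * (K + 1)" using \<delta> by simp
    also have "\<dots> = e / 2" using K by (simp add: \<delta>_def divide_simps)
    finally have 1: "\<delta> * K \<le> e / 2" .
    have "(\<lambda>n. (1 / \<delta> + 1) * ?d n) \<longlonglongrightarrow> 0" using tendsto_mult_left[OF D0, of "1 / \<delta> + 1"] by simp
    then have "\<forall>\<^sub>F n in sequentially. (1 / \<delta> + 1) * ?d n < e / 2"
      using \<open>e > 0\<close> by (intro order_tendstoD(2)) auto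
    then have "\<forall>\<^sub>F n in sequentially. norm (expectation (\<lambda>\<omega>. (X n \<omega>)\<^sup>2) - K) < e"
    proof eventually_elim
      case (elim n)
      have "norm (expectation (\<lambda>\<omega>. (X n \<omega>)\<^sup>2) - K) \<le> \<delta> * K + (1 / \<delta> + 1) * ?d n"
        using bound[OF \<delta>, of n] by simp
      also have "\<dots> < e / 2 + e / 2" by (rule add_le_less_mono[OF 1 elim])
      finally show ?case by simp
    qed
    then show "\<exists>no. \<forall>n\<ge>no. norm (expectation (\<lambda>\<omega>. (X n \<omega>)\<^sup>2) - K) < e"
      by (simp add: eventually_sequentially)
  qed
qed

lemma expectation_bounded_continuous_AE:
  fixes f :: "'b::{second_countable_topology,real_normed_vector} \<Rightarrow> real"
  assumes f: "continuous_on UNIV f" "bounded (range f)"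
    and [measurable]: "\<And>n. Y n \<in> borel_measurable M" "X \<in> borel_measurable M"
    and lim: "AE \<omega> in M. (\<lambda>n. Y n \<omega>) \<longlonglongrightarrow> X \<omega>"
  shows "(\<lambda>n. expectation (\<lambda>\<omega>. f (Y n \<omega>))) \<longlonglongrightarrow> expectation (\<lambda>\<omega>. f (X \<omega>))"
proof -
  obtain K where K: "\<And>x. norm (f x) \<le> K" using f(2) by (auto simp: bounded_iff)
  have [measurable]: "f \<in> borel_measurable borel" by (rule borel_measurable_continuous_onI[OF f(1)])
  show ?thesis
  proof (rule integral_dominated_convergence[where w="\<lambda>_. K"])
    show "AE \<omega> in M. (\<lambda>n. f (Y n \<omega>)) \<longlonglongrightarrow> f (X \<omega>)"
      using lim by eventually_elim (rule continuous_on_tendsto_compose[OF f(1)], auto)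
  qed (use K in auto)
qed

text \<open>Convergence in mean gives almost sure convergence along a subsequence of any given
  subsequence, and dominated convergence applies there; \<open>LIMSEQ_by_subsequences\<close>
  reassembles the full sequence.\<close>

lemma expectation_bounded_continuous_L1:
  fixes f :: "'b::{second_countable_topology,banach} \<Rightarrow> real"
  assumes f: "continuous_on UNIV f" "bounded (range f)"
    and [measurable]: "\<And>n. Y n \<in> borel_measurable M" "X \<in> borel_measurable M"
    and int: "\<And>n. integrable M (\<lambda>\<omega>. Y n \<omega> - X \<omega>)"
    and lim: "(\<lambda>n. expectation (\<lambda>\<omega>. norm (Y n \<omega> - X \<omega>))) \<longlonglongrightarrow> 0"
  shows "(\<lambda>n. expectation (\<lambda>\<omega>. f (Y n \<omega>))) \<longlonglongrightarrow> expectation (\<lambda>\<omega>. f (X \<omega>))"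
proof (rule LIMSEQ_by_subsequences)
  fix r :: "nat \<Rightarrow> nat" assume r: "strict_mono r"
  have "(\<lambda>n. expectation (\<lambda>\<omega>. norm (Y (r n) \<omega> - X \<omega>))) \<longlonglongrightarrow> 0"
    using LIMSEQ_subseq_LIMSEQ[OF lim r] by (simp add: o_def)
  then obtain r' where r': "strict_mono r'" "AE \<omega> in M. (\<lambda>n. Y (r (r' n)) \<omega> - X \<omega>) \<longlonglongrightarrow> 0"
    using tendsto_L1_AE_subseq[of M "\<lambda>n \<omega>. Y (r n) \<omega> - X \<omega>"] int by auto
  have "AE \<omega> in M. (\<lambda>n. Y (r (r' n)) \<omega>) \<longlonglongrightarrow> X \<omega>"
    using r'(2) by eventually_elim (simp add: LIM_zero_iff)
  then have "(\<lambda>n. expectation (\<lambda>\<omega>. f (Y (r (r' n)) \<omega>))) \<longlonglongrightarrow> expectation (\<lambda>\<omega>. f (X \<omega>))"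
    by (intro expectation_bounded_continuous_AE f) auto
  with r'(1) show "\<exists>r'. strict_mono r' \<and> (\<lambda>n. expectation (\<lambda>\<omega>. f (Y (r (r' n)) \<omega>))) \<longlonglongrightarrow> expectation (\<lambda>\<omega>. f (X \<omega>))"
    by blast
qed

end


section \<open>Wiener integrals\<close>

lemma grid_strict: "a < b \<Longrightarrow> n > 0 \<Longrightarrow> grid a b n i < grid a b n (Suc i)"
  by (simp add: grid_Suc)

lemma grid_ge: "a \<le> b \<Longrightarrow> a \<le> grid a b n i"
  using grid_mono[of a b 0 i n] by simp

lemma (in prob_space) indep_vars_expectation_mult:
  fixes X :: "'i \<Rightarrow> 'a \<Rightarrow> real"
  assumes "indep_vars (\<lambda>_. borel) X I" "i \<in> I" "j \<in> I" "i \<noteq> j" "integrable M (X i)" "integrable M (X j)"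
  shows "expectation (\<lambda>\<omega>. X i \<omega> * X j \<omega>) = expectation (X i) * expectation (X j)"
proof -
  have "indep_vars (\<lambda>_. borel) X {i, j}" by (rule indep_vars_subset[OF assms(1)]) (use assms in auto)
  from indep_vars_lebesgue_integral[OF _ this] show ?thesis using assms by auto
qed

lemma measurable_vec_lambda_PiM:
  "(\<lambda>f. \<chi> n. f n) \<in> borel_measurable (Pi\<^sub>M (UNIV :: 'n::finite set) (\<lambda>_. borel :: real measure))"
proof (rule borel_measurable_euclidean_space[THEN iffD2], rule ballI)
  fix b :: "real ^ 'n" assume "b \<in> Basis"
  then obtain m where "b = axis m 1" by (auto simp: Basis_vec_def)
  then show "(\<lambda>f. (\<chi> n. f n) \<bullet> b) \<in> borel_measurable (Pi\<^sub>M (UNIV :: 'n set) (\<lambda>_. borel))"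
    by (simp add: inner_axis)
qed

section \<open>Increments of Brownian motion over a uniform grid\<close>

context standard_brownian_motion
begin

lemma measurable_increment: "0 \<le> s \<Longrightarrow> 0 \<le> t \<Longrightarrow> (\<lambda>\<omega>. W t \<omega> - W s \<omega>) \<in> borel_measurable M"
  by (intro borel_measurable_diff random_variable_W)

lemma increment_component:
  assumes "0 \<le> s" "s < t"
  shows "sq_int M (\<lambda>\<omega>. W t \<omega> $ n - W s \<omega> $ n)"
    "expectation (\<lambda>\<omega>. W t \<omega> $ n - W s \<omega> $ n) = 0"
    "expectation (\<lambda>\<omega>. (W t \<omega> $ n - W s \<omega> $ n)\<^sup>2) = t - s"
proof -
  let ?X = "\<lambda>\<omega>. W t \<omega> $ n - W s \<omega> $ n" and ?\<sigma> = "sqrt (t - s)"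
  have \<sigma>: "?\<sigma> > 0" using assms by simp
  have D: "distributed M lborel ?X (normal_density 0 ?\<sigma>)" by (rule normal_increments[OF assms])
  have "integrable lborel (\<lambda>x. normal_density 0 ?\<sigma> x * x\<^sup>2)"
    using integrable_normal_moment[OF \<sigma>, of 0 2] by simp
  then have "integrable M (\<lambda>\<omega>. (?X \<omega>)\<^sup>2)"
    using distributed_integrable[OF D, of "\<lambda>x. x\<^sup>2"] by simp
  moreover have "?X \<in> borel_measurable M" using distributed_measurable[OF D] by simp
  ultimately show "sq_int M ?X" by (simp add: sq_int_def)
  show 0: "expectation ?X = 0" by (rule normal_distributed_expectation[OF \<sigma> D])
  show "expectation (\<lambda>\<omega>. (?X \<omega>)\<^sup>2) = t - s"
    using normal_distributed_variance[OF \<sigma> D] assms unfolding 0 by simp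
qed

lemma increment_inner:
  assumes "0 \<le> s" "s < t"
  shows "sq_int M (\<lambda>\<omega>. c \<bullet> (W t \<omega> - W s \<omega>))"
    "expectation (\<lambda>\<omega>. c \<bullet> (W t \<omega> - W s \<omega>)) = 0"
    "expectation (\<lambda>\<omega>. (c \<bullet> (W t \<omega> - W s \<omega>))\<^sup>2) = (t - s) * (c \<bullet> c)"
proof -
  define X where "X n \<omega> = W t \<omega> $ n - W s \<omega> $ n" for n \<omega>
  have X: "sq_int M (X n)" "expectation (X n) = 0" "expectation (\<lambda>\<omega>. (X n \<omega>)\<^sup>2) = t - s" for n
    using increment_component[OF assms, of n] unfolding X_def[abs_def] by auto
  have eq: "(\<lambda>\<omega>. c \<bullet> (W t \<omega> - W s \<omega>)) = (\<lambda>\<omega>. \<Sum>n\<in>UNIV. c $ n * X n \<omega>)"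
    by (simp add: inner_vec_def X_def)
  have sq: "sq_int M (\<lambda>\<omega>. c $ n * X n \<omega>)" for n by (rule sq_int_cmult[OF X(1)])
  show "sq_int M (\<lambda>\<omega>. c \<bullet> (W t \<omega> - W s \<omega>))"
    unfolding eq by (intro sq_int_sum sq)
  show "expectation (\<lambda>\<omega>. c \<bullet> (W t \<omega> - W s \<omega>)) = 0"
    unfolding eq using X sq_int_integrable[OF X(1)] by (simp add: Bochner_Integration.integral_sum)
  have ind: "indep_vars (\<lambda>_. borel) X UNIV"
    using independent_components[OF assms] unfolding X_def[abs_def] .
  have "expectation (\<lambda>\<omega>. (\<Sum>n\<in>UNIV. c $ n * X n \<omega>)\<^sup>2) = (\<Sum>n\<in>UNIV. expectation (\<lambda>\<omega>. (c $ n * X n \<omega>)\<^sup>2))"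
  proof (rule integral_power2_sum_orthogonal)
    fix i j :: 'n assume "i \<noteq> j"
    then have "expectation (\<lambda>\<omega>. X i \<omega> * X j \<omega>) = 0"
      using indep_vars_expectation_mult[OF ind, of i j] X sq_int_integrable[OF X(1)] by simp
    moreover have "(\<lambda>\<omega>. c $ i * X i \<omega> * (c $ j * X j \<omega>)) = (\<lambda>\<omega>. (c $ i * c $ j) * (X i \<omega> * X j \<omega>))"
      by (simp add: ac_simps)
    ultimately show "expectation (\<lambda>\<omega>. c $ i * X i \<omega> * (c $ j * X j \<omega>)) = 0" by simp
  qed (use sq in auto)
  also have "\<dots> = (\<Sum>n\<in>UNIV. (c $ n)\<^sup>2 * (t - s))"
    by (simp add: power_mult_distrib X)
  also have "\<dots> = (\<Sum>n\<in>UNIV. (t - s) * (c $ n * c $ n))"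
    by (intro sum.cong refl) (simp add: power2_eq_square)
  finally show "expectation (\<lambda>\<omega>. (c \<bullet> (W t \<omega> - W s \<omega>))\<^sup>2) = (t - s) * (c \<bullet> c)"
    unfolding fun_cong[OF eq] by (simp add: inner_vec_def sum_distrib_left)
qed

text \<open>Independent components have a product law. What matters later is that it depends on
  \<open>t - s\<close> alone: increments over cells of equal length are identically
  distributed.\<close>

lemma increment_law:
  assumes "0 \<le> s" "s < t"
  shows "distr M borel (\<lambda>\<omega>. W t \<omega> - W s \<omega>) =
    distr (Pi\<^sub>M UNIV (\<lambda>_. density lborel (normal_density 0 (sqrt (t - s))))) borel (\<lambda>f. \<chi> n. f n)"
proof -
  define X where "X n \<omega> = W t \<omega> $ n - W s \<omega> $ n" for n \<omega>
  have [measurable]: "X n \<in> borel_measurable M" for n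
    using increment_component(1)[OF assms, of n] by (simp add: X_def[abs_def] sq_int_def)
  have ind: "indep_vars (\<lambda>_. borel) X UNIV"
    using independent_components[OF assms] unfolding X_def[abs_def] .
  have "distr M (Pi\<^sub>M UNIV (\<lambda>_. borel)) (\<lambda>\<omega>. \<lambda>n\<in>UNIV. X n \<omega>) = Pi\<^sub>M UNIV (\<lambda>n. distr M borel (X n))"
    using ind by (subst (asm) indep_vars_iff_distr_eq_PiM) auto
  also have "(\<lambda>n. distr M borel (X n)) = (\<lambda>_. density lborel (normal_density 0 (sqrt (t - s))))"
  proof
    fix n
    have "distr M borel (X n) = distr M lborel (X n)" by (rule distr_cong) auto
    also have "\<dots> = density lborel (normal_density 0 (sqrt (t - s)))"
      using normal_increments[OF assms, of n] unfolding X_def[abs_def] by (rule distributed_distr_eq_density)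
    finally show "distr M borel (X n) = density lborel (normal_density 0 (sqrt (t - s)))" .
  qed
  finally have *: "distr M (Pi\<^sub>M UNIV (\<lambda>_. borel)) (\<lambda>\<omega>. \<lambda>n\<in>UNIV. X n \<omega>) =
    Pi\<^sub>M UNIV (\<lambda>_. density lborel (normal_density 0 (sqrt (t - s))))" .
  have "(\<lambda>\<omega>. W t \<omega> - W s \<omega>) = (\<lambda>f. \<chi> n. f n) \<circ> (\<lambda>\<omega>. \<lambda>n\<in>UNIV. X n \<omega>)"
    by (simp add: fun_eq_iff X_def vec_eq_iff)
  moreover have "(\<lambda>\<omega>. \<lambda>n\<in>UNIV. X n \<omega>) \<in> measurable M (Pi\<^sub>M UNIV (\<lambda>_. borel))"
    by (intro measurable_restrict) simp
  ultimately show ?thesis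
    unfolding *[symmetric] by (simp only: distr_distr[OF measurable_vec_lambda_PiM])
qed

definition increment :: "real \<Rightarrow> real \<Rightarrow> nat \<Rightarrow> nat \<Rightarrow> 'a \<Rightarrow> real ^ 'n" where
  "increment a b n i \<omega> = W (grid a b n (Suc i)) \<omega> - W (grid a b n i) \<omega>"

lemma measurable_increment_grid [measurable]:
  assumes "0 \<le> a" "a \<le> b" shows "increment a b n i \<in> borel_measurable M"
proof -
  have "0 \<le> grid a b n i" for i using grid_ge[OF assms(2)] assms(1) order_trans by blast
  then show ?thesis unfolding increment_def[abs_def] by (intro measurable_increment)
qed

lemma indep_increments:
  assumes "0 \<le> a" "a < b" "n > 0"
  shows "indep_vars (\<lambda>_. borel) (increment a b n) {..<n}"
  unfolding increment_def[abs_def]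
  using independent_increments[of "grid a b n" n] assms grid_strict[of a b n] by auto

text \<open>Independent and identically distributed increments have the joint law of a power of a
  single measure \<open>D\<close>, and such a product is invariant under permuting the coordinates,
  here by \<open>i \<mapsto> n - 1 - i\<close>.\<close>

lemma increments_reversal:
  fixes \<Phi> :: "(nat \<Rightarrow> real ^ 'n) \<Rightarrow> real"
  assumes ab: "0 \<le> a" "a < b" "n > 0"
    and \<Phi>: "\<Phi> \<in> borel_measurable (Pi\<^sub>M {..<n} (\<lambda>_. borel))"
  shows "expectation (\<lambda>\<omega>. \<Phi> (\<lambda>i\<in>{..<n}. increment a b n i \<omega>)) =
    expectation (\<lambda>\<omega>. \<Phi> (\<lambda>i\<in>{..<n}. increment a b n (n - 1 - i) \<omega>))"
proof -
  let ?P = "Pi\<^sub>M {..<n} (\<lambda>_. borel :: (real ^ 'n) measure)"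
  define D where "D = distr M borel (increment a b n 0)"
  have [measurable]: "increment a b n i \<in> borel_measurable M" for i
    using ab by (intro measurable_increment_grid) auto
  interpret D: prob_space D unfolding D_def by (rule prob_space_distr) simp
  have law: "distr M borel (increment a b n i) = D" for i
  proof -
    have "distr M borel (increment a b n i) =
      distr (Pi\<^sub>M UNIV (\<lambda>_. density lborel (normal_density 0 (sqrt ((b - a) / real n))))) borel (\<lambda>f. \<chi> n. f n)" for i
      unfolding increment_def[abs_def] using ab grid_strict[of a b n i] grid_ge[of a b n i]
      by (subst increment_law) (auto simp: grid_Suc)
    then show ?thesis unfolding D_def by simp
  qed
  have "distr M ?P (\<lambda>\<omega>. \<lambda>i\<in>{..<n}. increment a b n i \<omega>) = Pi\<^sub>M {..<n} (\<lambda>i. distr M borel (increment a b n i))"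
    using indep_increments[OF ab] ab by (subst (asm) indep_vars_iff_distr_eq_PiM) auto
  then have joint: "distr M ?P (\<lambda>\<omega>. \<lambda>i\<in>{..<n}. increment a b n i \<omega>) = Pi\<^sub>M {..<n} (\<lambda>_. D)"
    by (simp add: law)
  have sets: "sets (Pi\<^sub>M {..<n} (\<lambda>_. D)) = sets ?P" by (rule sets_PiM_cong) (auto simp: D_def)
  define rev where "rev f = (\<lambda>i\<in>{..<n}. f (n - 1 - i))" for f :: "nat \<Rightarrow> real ^ 'n"
  have rev_meas: "rev \<in> measurable ?P ?P"
    unfolding rev_def[abs_def] using ab by (intro measurable_restrict measurable_component_singleton) auto
  have rev: "distr (Pi\<^sub>M {..<n} (\<lambda>_. D)) (Pi\<^sub>M {..<n} (\<lambda>_. D)) rev = Pi\<^sub>M {..<n} (\<lambda>_. D)"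
    unfolding rev_def[abs_def]
    by (rule distr_PiM_reindex[where M="\<lambda>_. D"]) (use ab in \<open>auto simp: inj_on_def D.prob_space_axioms\<close>)
  have inc_meas: "(\<lambda>\<omega>. \<lambda>i\<in>{..<n}. increment a b n i \<omega>) \<in> measurable M ?P"
    by (intro measurable_restrict) simp
  have "expectation (\<lambda>\<omega>. \<Phi> (\<lambda>i\<in>{..<n}. increment a b n (n - 1 - i) \<omega>)) =
    expectation (\<lambda>\<omega>. \<Phi> (rev (\<lambda>i\<in>{..<n}. increment a b n i \<omega>)))"
    by (intro Bochner_Integration.integral_cong arg_cong[where f=\<Phi>]) (auto simp: rev_def)
  also have "\<dots> = integral\<^sup>L (Pi\<^sub>M {..<n} (\<lambda>_. D)) (\<lambda>f. \<Phi> (rev f))"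
    unfolding joint[symmetric] by (rule integral_distr[symmetric, OF inc_meas measurable_compose[OF rev_meas \<Phi>]])
  also have "\<dots> = integral\<^sup>L (distr (Pi\<^sub>M {..<n} (\<lambda>_. D)) (Pi\<^sub>M {..<n} (\<lambda>_. D)) rev) \<Phi>"
    using rev_meas \<Phi> sets by (intro integral_distr[symmetric]) (auto cong: measurable_cong_sets)
  also have "\<dots> = expectation (\<lambda>\<omega>. \<Phi> (\<lambda>i\<in>{..<n}. increment a b n i \<omega>))"
    unfolding rev unfolding joint[symmetric] by (rule integral_distr[OF inc_meas \<Phi>])
  finally show ?thesis ..
qed

text \<open>The discrete Ito isometry: independence and mean zero make the summands
  orthogonal.\<close>

lemma increments_second_moment:
  assumes ab: "0 \<le> a" "a < b" "n > 0"
  shows "sq_int M (\<lambda>\<omega>. \<Sum>i<n. c i \<bullet> increment a b n i \<omega>)"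
    and "expectation (\<lambda>\<omega>. \<Sum>i<n. c i \<bullet> increment a b n i \<omega>) = 0"
    and "expectation (\<lambda>\<omega>. (\<Sum>i<n. c i \<bullet> increment a b n i \<omega>)\<^sup>2) = (\<Sum>i<n. (b - a) / real n * (c i \<bullet> c i))"
proof -
  define X where "X i \<omega> = c i \<bullet> increment a b n i \<omega>" for i \<omega>
  have X: "sq_int M (X i)" "expectation (X i) = 0"
    "expectation (\<lambda>\<omega>. (X i \<omega>)\<^sup>2) = (b - a) / real n * (c i \<bullet> c i)" for i
    using increment_inner[of "grid a b n i" "grid a b n (Suc i)" "c i"] ab
      grid_strict[of a b n i] grid_ge[of a b n i]
    unfolding X_def[abs_def] increment_def by (auto simp: grid_Suc)
  show "sq_int M (\<lambda>\<omega>. \<Sum>i<n. c i \<bullet> increment a b n i \<omega>)"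
    using X(1) unfolding X_def by (intro sq_int_sum)
  have "expectation (\<lambda>\<omega>. \<Sum>i<n. X i \<omega>) = 0"
    using X sq_int_integrable[OF X(1)] by (simp add: Bochner_Integration.integral_sum)
  then show "expectation (\<lambda>\<omega>. \<Sum>i<n. c i \<bullet> increment a b n i \<omega>) = 0" unfolding X_def .
  have ind: "indep_vars (\<lambda>_. borel) X {..<n}"
    unfolding X_def[abs_def] by (rule indep_vars_compose2[OF indep_increments[OF ab]]) auto
  have "expectation (\<lambda>\<omega>. (\<Sum>i<n. X i \<omega>)\<^sup>2) = (\<Sum>i<n. expectation (\<lambda>\<omega>. (X i \<omega>)\<^sup>2))"
    using X sq_int_integrable[OF X(1)]
    by (intro integral_power2_sum_orthogonal) (auto simp: indep_vars_expectation_mult[OF ind])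
  then show "expectation (\<lambda>\<omega>. (\<Sum>i<n. c i \<bullet> increment a b n i \<omega>)\<^sup>2) = (\<Sum>i<n. (b - a) / real n * (c i \<bullet> c i))"
    unfolding X(3) unfolding X_def .
qed

text \<open>
  The integral is defined as a limit along dyadic grids, rather than by the pathwise formula of
  \<open>wiener_AE\<close>, because the limit is measurable on an incomplete probability space.
\<close>

definition riemann_sum :: "(real \<Rightarrow> real ^ 'n) \<Rightarrow> real \<Rightarrow> real \<Rightarrow> nat \<Rightarrow> 'a \<Rightarrow> real" where
  "riemann_sum g a b n \<omega> = (\<Sum>i<n. g (grid a b n i) \<bullet> increment a b n i \<omega>)"

definition wiener :: "(real \<Rightarrow> real ^ 'n) \<Rightarrow> real \<Rightarrow> real \<Rightarrow> 'a \<Rightarrow> real" where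
  "wiener g a b \<omega> = lim (\<lambda>k. riemann_sum g a b (2 ^ k) \<omega>)"

text \<open>The stochastic integral of \<open>g\<close> after integration by parts, which makes
  sense for each continuous path; \<open>g'\<close> is meant to be the derivative of
  \<open>g\<close>.\<close>

definition pathwise :: "(real \<Rightarrow> real ^ 'n) \<Rightarrow> (real \<Rightarrow> real ^ 'n) \<Rightarrow> real \<Rightarrow> real \<Rightarrow> 'a \<Rightarrow> real" where
  "pathwise g g' a b \<omega> = g b \<bullet> W b \<omega> - g a \<bullet> W a \<omega> - integral {a..b} (\<lambda>s. g' s \<bullet> W s \<omega>)"

lemma measurable_riemann_sum [measurable]:
  assumes "0 \<le> a" "a \<le> b" shows "riemann_sum g a b n \<in> borel_measurable M"
  using measurable_increment_grid[OF assms] unfolding riemann_sum_def[abs_def] by measurable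

lemma measurable_wiener [measurable]:
  assumes "0 \<le> a" "a \<le> b" shows "wiener g a b \<in> borel_measurable M"
  using measurable_riemann_sum[OF assms] unfolding wiener_def[abs_def] by measurable

lemma filterlim_power2: "filterlim (\<lambda>k. 2 ^ k :: nat) sequentially sequentially"
  by (rule filterlim_subseq) (auto simp: strict_mono_def)

section \<open>Wiener integrals of continuously differentiable integrands and the Ito
  isometry\<close>

context
  fixes g g' :: "real \<Rightarrow> real ^ 'n"
  assumes g: "\<And>s. (g has_vector_derivative g' s) (at s)" and g': "continuous_on UNIV g'"
begin

lemma riemann_sum_AE:
  assumes ab: "0 \<le> a" "a \<le> b"
  shows "AE \<omega> in M. (\<lambda>k. riemann_sum g a b (2 ^ k) \<omega>) \<longlonglongrightarrow> pathwise g g' a b \<omega>"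
  using continuous_paths
proof eventually_elim
  case (elim \<omega>)
  have "(\<lambda>n. riemann_sum g a b n \<omega>) \<longlonglongrightarrow> pathwise g g' a b \<omega>"
    unfolding riemann_sum_def increment_def pathwise_def
    using ab by (intro riemann_left[OF _ g] continuous_on_subset[OF g'] continuous_on_subset[OF elim]) auto
  from filterlim_compose[OF this filterlim_power2] show ?case .
qed

lemma wiener_AE:
  assumes ab: "0 \<le> a" "a \<le> b"
  shows "AE \<omega> in M. wiener g a b \<omega> = pathwise g g' a b \<omega>"
  using riemann_sum_AE[OF ab] by eventually_elim (simp add: wiener_def limI)

lemma wiener_limit:
  assumes ab: "0 \<le> a" "a \<le> b"
  shows "AE \<omega> in M. (\<lambda>k. riemann_sum g a b (2 ^ k) \<omega>) \<longlonglongrightarrow> wiener g a b \<omega>"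
  using riemann_sum_AE[OF ab] wiener_AE[OF ab] by eventually_elim simp

lemma wiener_append:
  assumes abc: "0 \<le> a" "a \<le> b" "b \<le> c"
  shows "AE \<omega> in M. wiener g a c \<omega> = wiener g a b \<omega> + wiener g b c \<omega>"
  using continuous_paths wiener_AE[of a c, OF abc(1) order_trans[OF abc(2,3)]]
    wiener_AE[OF abc(1,2)] wiener_AE[of b c, OF order_trans[OF abc(1,2)] abc(3)]
proof eventually_elim
  case (elim \<omega>)
  have "continuous_on {a..c} (\<lambda>s. g' s \<bullet> W s \<omega>)"
    using abc by (intro continuous_on_inner continuous_on_subset[OF g'] continuous_on_subset[OF elim(1)]) auto
  then have "integral {a..b} (\<lambda>s. g' s \<bullet> W s \<omega>) + integral {b..c} (\<lambda>s. g' s \<bullet> W s \<omega>) = integral {a..c} (\<lambda>s. g' s \<bullet> W s \<omega>)"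
    using abc by (intro Henstock_Kurzweil_Integration.integral_combine integrable_continuous_real)
  then show ?case using elim by (simp add: pathwise_def)
qed

text \<open>A coarse increment is the sum of \<open>m\<close> fine ones, and \<open>j div m\<close>
  is the coarse cell containing the fine cell \<open>j\<close>. Two Riemann sums can so be compared
  over a common family of increments.\<close>

lemma riemann_sum_refine:
  assumes "n > 0" "m > 0"
  shows "riemann_sum g a b n \<omega> = (\<Sum>j<n * m. g (grid a b n (j div m)) \<bullet> increment a b (n * m) j \<omega>)"
proof -
  have "(\<Sum>j<n * m. g (grid a b n (j div m)) \<bullet> increment a b (n * m) j \<omega>)
    = (\<Sum>i<n. \<Sum>j = i * m..<i * m + m. g (grid a b n (j div m)) \<bullet> increment a b (n * m) j \<omega>)"
    by (rule sum.nat_group[symmetric])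
  also have "\<dots> = (\<Sum>i<n. g (grid a b n i) \<bullet> increment a b n i \<omega>)"
  proof (rule sum.cong[OF refl])
    fix i
    have "(\<Sum>j = i * m..<i * m + m. g (grid a b n (j div m)) \<bullet> increment a b (n * m) j \<omega>)
      = (\<Sum>j = i * m..<i * m + m. g (grid a b n i) \<bullet> increment a b (n * m) j \<omega>)"
    proof (rule sum.cong[OF refl])
      fix j assume "j \<in> {i * m..<i * m + m}"
      then have "j div m = i" using assms by (intro div_nat_eqI) (auto simp: ac_simps)
      then show "g (grid a b n (j div m)) \<bullet> increment a b (n * m) j \<omega> = g (grid a b n i) \<bullet> increment a b (n * m) j \<omega>"
        by simp
    qed
    also have "\<dots> = g (grid a b n i) \<bullet> (\<Sum>j = i * m..<i * m + m. increment a b (n * m) j \<omega>)"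
      by (simp add: inner_sum_right)
    also have "(\<Sum>j = i * m..<i * m + m. increment a b (n * m) j \<omega>) = W (grid a b (n * m) (Suc i * m)) \<omega> - W (grid a b (n * m) (i * m)) \<omega>"
      unfolding increment_def by (subst sum_Suc_diff') (auto simp: add.commute)
    also have "\<dots> = increment a b n i \<omega>"
      unfolding grid_refine[OF assms] increment_def ..
    finally show "(\<Sum>j = i * m..<i * m + m. g (grid a b n (j div m)) \<bullet> increment a b (n * m) j \<omega>) = g (grid a b n i) \<bullet> increment a b n i \<omega>" .
  qed
  finally show ?thesis by (simp add: riemann_sum_def)
qed

lemma continuous_integrand: "continuous_on A g"
  by (intro continuous_at_imp_continuous_on ballI has_vector_derivative_continuous[OF g])

text \<open>Over the finer grid the difference of two sums has the coefficients \<open>c j\<close>,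
  the oscillation of \<open>g\<close> within a coarse cell. Uniform continuity bounds them, and the
  discrete isometry converts this into a bound in mean square.\<close>

lemma riemann_sum_Cauchy:
  assumes ab: "0 \<le> a" "a < b" and e: "e > 0"
  shows "\<exists>N. \<forall>k\<ge>N. \<forall>l\<ge>k. expectation (\<lambda>\<omega>. (riemann_sum g a b (2 ^ l) \<omega> - riemann_sum g a b (2 ^ k) \<omega>)\<^sup>2) \<le> e"
proof -
  define \<epsilon> where "\<epsilon> = sqrt (e / (b - a))"
  have \<epsilon>: "\<epsilon> > 0" "\<epsilon>\<^sup>2 * (b - a) = e" using e ab by (auto simp: \<epsilon>_def)
  have "uniformly_continuous_on {a..b} g"
    by (intro compact_uniformly_continuous continuous_integrand compact_Icc)
  then obtain d where d: "d > 0" "\<And>x y. x \<in> {a..b} \<Longrightarrow> y \<in> {a..b} \<Longrightarrow> dist x y < d \<Longrightarrow> dist (g x) (g y) < \<epsilon>"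
    using \<epsilon>(1) unfolding uniformly_continuous_on_def by metis
  obtain N :: nat where N: "(b - a) / d < real N" using reals_Archimedean2 by blast
  show ?thesis
  proof (intro exI[of _ N] allI impI)
    fix k l assume kl: "k \<ge> N" "l \<ge> k"
    define n m where "n = (2 ^ k :: nat)" and "m = (2 ^ (l - k) :: nat)"
    have nm: "n > 0" "m > 0" "2 ^ l = n * m"
      using kl by (auto simp: n_def m_def power_add[symmetric])
    have "real N < real n" unfolding n_def using kl less_exp[of k] by linarith
    then have "(b - a) / d < real n" using N by linarith
    then have h: "(b - a) / real n < d" using d nm by (simp add: field_simps)
    define c where "c j = g (grid a b (n * m) j) - g (grid a b n (j div m))" for j
    have c: "c j \<bullet> c j \<le> \<epsilon>\<^sup>2" if j: "j < n * m" for j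
    proof -
      have jm: "j div m < n" using j nm by (simp add: less_mult_imp_div_less)
      have lo: "grid a b n (j div m) \<le> grid a b (n * m) j"
        unfolding grid_refine[OF nm(1,2), symmetric] using ab by (intro grid_mono) auto
      have "j \<le> Suc (j div m) * m" using nm dividend_less_div_times[of m j] by simp
      then have hi: "grid a b (n * m) j \<le> grid a b n (Suc (j div m))"
        unfolding grid_refine[OF nm(1,2), symmetric] using ab by (intro grid_mono) auto
      have "dist (grid a b (n * m) j) (grid a b n (j div m)) < d"
        using lo hi h by (simp add: dist_real_def grid_Suc)
      moreover have "grid a b (n * m) j \<in> {a..b}" "grid a b n (j div m) \<in> {a..b}"
        using ab j jm nm by (auto intro!: grid_in simp del: atLeastAtMost_iff)
      ultimately have "norm (c j) \<le> \<epsilon>"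
        using d(2) by (force simp: c_def dist_norm)
      then show ?thesis using power_mono[of "norm (c j)" \<epsilon> 2] by (simp add: power2_norm_eq_inner)
    qed
    have "riemann_sum g a b (2 ^ l) \<omega> - riemann_sum g a b (2 ^ k) \<omega> = (\<Sum>j<n * m. c j \<bullet> increment a b (n * m) j \<omega>)" for \<omega>
      unfolding n_def[symmetric] nm(3) riemann_sum_refine[OF nm(1,2)]
      by (simp add: riemann_sum_def c_def inner_diff_left sum_subtractf)
    then have "expectation (\<lambda>\<omega>. (riemann_sum g a b (2 ^ l) \<omega> - riemann_sum g a b (2 ^ k) \<omega>)\<^sup>2)
      = (\<Sum>j<n * m. (b - a) / real (n * m) * (c j \<bullet> c j))"
      using increments_second_moment(3)[OF ab, of "n * m" c] nm by simp
    also have "\<dots> \<le> (\<Sum>j<n * m. (b - a) / real (n * m) * \<epsilon>\<^sup>2)"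
      using ab c by (intro sum_mono mult_left_mono) auto
    also have "\<dots> = \<epsilon>\<^sup>2 * (b - a)" using nm by simp
    finally show "expectation (\<lambda>\<omega>. (riemann_sum g a b (2 ^ l) \<omega> - riemann_sum g a b (2 ^ k) \<omega>)\<^sup>2) \<le> e"
      using \<epsilon> by simp
  qed
qed

text \<open>Second moments of the Riemann sums are Riemann sums of \<open>g s \<bullet> g s\<close>,
  and \<open>L2_limit\<close> lets both the first and the second moments pass to the limit.\<close>

lemma wiener_isometry:
  assumes ab: "0 \<le> a" "a \<le> b"
  shows "sq_int M (wiener g a b)" "expectation (wiener g a b) = 0"
    "expectation (\<lambda>\<omega>. (wiener g a b \<omega>)\<^sup>2) = integral {a..b} (\<lambda>s. g s \<bullet> g s)"
proof -
  have "sq_int M (wiener g a b) \<and> expectation (wiener g a b) = 0 \<and>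
    expectation (\<lambda>\<omega>. (wiener g a b \<omega>)\<^sup>2) = integral {a..b} (\<lambda>s. g s \<bullet> g s)"
  proof (cases "a = b")
    case True
    have "grid a a n i = a" for n i by (simp add: grid_def)
    then have "wiener g a b = (\<lambda>_. 0)"
      using True by (simp add: fun_eq_iff wiener_def riemann_sum_def increment_def)
    then show ?thesis using True by (simp add: sq_int_def)
  next
    case False
    then have lt: "a < b" using ab by simp
    define X where "X k = riemann_sum g a b (2 ^ k)" for k
    have X: "sq_int M (X k)" "expectation (X k) = 0"
      "expectation (\<lambda>\<omega>. (X k \<omega>)\<^sup>2) = (\<Sum>i<2 ^ k. (b - a) / real (2 ^ k) * (g (grid a b (2 ^ k) i) \<bullet> g (grid a b (2 ^ k) i)))" for k
      using increments_second_moment[OF ab(1) lt, of "2 ^ k" "\<lambda>i. g (grid a b (2 ^ k) i)"]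
      unfolding X_def riemann_sum_def[abs_def] by auto
    have lim: "AE \<omega> in M. (\<lambda>k. X k \<omega>) \<longlonglongrightarrow> wiener g a b \<omega>"
      unfolding X_def by (rule wiener_limit[OF ab])
    note L2 = L2_limit[OF X(1) measurable_wiener[OF ab] lim]
    have Cauchy: "\<exists>N. \<forall>k\<ge>N. \<forall>l\<ge>k. expectation (\<lambda>\<omega>. (X l \<omega> - X k \<omega>)\<^sup>2) \<le> e" if "e > 0" for e
      unfolding X_def by (rule riemann_sum_Cauchy[OF ab(1) lt that])
    \<comment> \<open>An ordinary Riemann sum, read as a Stieltjes sum with the identity as
      integrator; on the reals the inner product is multiplication.\<close>
    have "(\<lambda>n. \<Sum>i<n. (grid a b n (Suc i) - grid a b n i) \<bullet> (g (grid a b n i) \<bullet> g (grid a b n i)))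
      \<longlonglongrightarrow> integral {a..b} (\<lambda>s. 1 \<bullet> (g s \<bullet> g s))"
      using grid_mono[OF ab(2)]
      by (intro riemann_stieltjes_tagged[OF ab(2), where g="\<lambda>s. s" and g'="\<lambda>_. 1" and \<tau>="\<lambda>n i. grid a b n i"]
          continuous_intros continuous_integrand) auto
    from filterlim_compose[OF this filterlim_power2]
    have "(\<lambda>k. expectation (\<lambda>\<omega>. (X k \<omega>)\<^sup>2)) \<longlonglongrightarrow> integral {a..b} (\<lambda>s. g s \<bullet> g s)"
      by (simp add: X(3) grid_Suc)
    then have "expectation (\<lambda>\<omega>. (wiener g a b \<omega>)\<^sup>2) = integral {a..b} (\<lambda>s. g s \<bullet> g s)"
      using L2(3)[OF Cauchy] LIMSEQ_unique by blast
    moreover have "expectation (wiener g a b) = 0"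
      using L2(4)[OF Cauchy] X(2) by (simp add: LIMSEQ_const_iff)
    ultimately show ?thesis using L2(1)[OF Cauchy] by blast
  qed
  then show "sq_int M (wiener g a b)" "expectation (wiener g a b) = 0"
    "expectation (\<lambda>\<omega>. (wiener g a b \<omega>)\<^sup>2) = integral {a..b} (\<lambda>s. g s \<bullet> g s)" by auto
qed

end

end


section \<open>Limiting covariance of a linear stochastic differential equation\<close>

text \<open>The continuous mapping theorem: test functions pull back along \<open>\<phi>\<close>. It
  carries the limit from pairs over to stacked vectors.\<close>

lemma limiting_distribution_continuous_map:
  fixes Z :: "real \<Rightarrow> 'a \<Rightarrow> 'b::topological_space" and \<phi> :: "'b \<Rightarrow> 'c::topological_space"
  assumes lim: "limiting_distribution M Z \<mu>" and \<phi>: "continuous_on UNIV \<phi>"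
    and Z: "\<And>t. t \<ge> 0 \<Longrightarrow> Z t \<in> borel_measurable M"
  shows "limiting_distribution M (\<lambda>t \<omega>. \<phi> (Z t \<omega>)) (distr \<mu> borel \<phi>)"
proof -
  have \<mu>: "prob_space \<mu>" "sets \<mu> = sets borel" using lim by (auto simp: limiting_distribution_def)
  have \<phi>_borel: "\<phi> \<in> borel_measurable borel" by (rule borel_measurable_continuous_onI[OF \<phi>])
  then have \<phi>_\<mu>: "\<phi> \<in> borel_measurable \<mu>" using \<mu>(2) by (simp cong: measurable_cong_sets)
  show ?thesis
    unfolding limiting_distribution_def
  proof (intro conjI allI impI)
    show "prob_space (distr \<mu> borel \<phi>)" by (rule prob_space.prob_space_distr[OF \<mu>(1) \<phi>_\<mu>])
    fix f :: "'c \<Rightarrow> real" assume f: "continuous_on UNIV f" "bounded (range f)"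
    have fb: "f \<in> borel_measurable borel" by (rule borel_measurable_continuous_onI[OF f(1)])
    have "continuous_on UNIV (\<lambda>x. f (\<phi> x))"
      by (rule continuous_on_compose2[OF f(1) \<phi>]) auto
    moreover have "bounded (range (\<lambda>x. f (\<phi> x)))"
      by (rule bounded_subset[OF f(2)]) auto
    ultimately have "((\<lambda>t. integral\<^sup>L (distr M borel (Z t)) (\<lambda>x. f (\<phi> x))) \<longlongrightarrow> integral\<^sup>L \<mu> (\<lambda>x. f (\<phi> x))) at_top"
      using lim unfolding limiting_distribution_def by blast
    moreover have "integral\<^sup>L \<mu> (\<lambda>x. f (\<phi> x)) = integral\<^sup>L (distr \<mu> borel \<phi>) f"
      by (rule integral_distr[OF \<phi>_\<mu> fb, symmetric])
    moreover have "\<forall>\<^sub>F t in at_top. integral\<^sup>L (distr M borel (Z t)) (\<lambda>x. f (\<phi> x)) =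
      integral\<^sup>L (distr M borel (\<lambda>\<omega>. \<phi> (Z t \<omega>))) f"
      using eventually_ge_at_top[of 0]
    proof eventually_elim
      case (elim t)
      show ?case
        by (simp add: integral_distr[OF Z[OF elim] measurable_compose[OF \<phi>_borel fb]]
            integral_distr[OF measurable_compose[OF Z[OF elim] \<phi>_borel] fb])
    qed
    ultimately show "((\<lambda>t. integral\<^sup>L (distr M borel (\<lambda>\<omega>. \<phi> (Z t \<omega>))) f) \<longlongrightarrow> integral\<^sup>L (distr \<mu> borel \<phi>) f) at_top"
      by (simp only:) (rule Lim_transform_eventually)
  qed simp
qed

lemma (in prob_space) expectation_abs_le_sqrt:
  assumes "sq_int M X" shows "expectation (\<lambda>\<omega>. \<bar>X \<omega>\<bar>) \<le> sqrt (expectation (\<lambda>\<omega>. (X \<omega>)\<^sup>2))"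
proof -
  have "sq_int M (\<lambda>\<omega>. \<bar>X \<omega>\<bar>)" using assms by (auto simp: sq_int_def)
  from expectation_power2_le[OF this] show ?thesis by (simp add: real_le_rsqrt)
qed

text \<open>\<open>C\<close> and \<open>G'\<close> are the transposes of drift and noise matrix, and
  \<open>S\<close> stands for the quadratic form of the sought covariance, given through its
  behaviour along the transposed flow. A conserved quantity is allowed: flows need only converge,
  and \<open>S_limit\<close> requires \<open>S\<close> to vanish in the limit.\<close>

locale linear_sde = standard_brownian_motion M W
  for M :: "'a measure" and W :: "real \<Rightarrow> 'a \<Rightarrow> real ^ 'n::finite" +
  fixes B C :: "'e::euclidean_space \<Rightarrow> 'e" and G :: "real ^ 'n \<Rightarrow> 'e" and G' :: "'e \<Rightarrow> real ^ 'n"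
    and z :: "real \<Rightarrow> 'a \<Rightarrow> 'e" and z0 :: 'e and S :: "'e \<Rightarrow> real"
  assumes linear_B: "linear B" and linear_C: "linear C" and linear_G': "linear G'"
    and adj_B: "B x \<bullet> x' = x \<bullet> C x'" and adj_G: "G w \<bullet> x = w \<bullet> G' x"
    and z_measurable: "t \<ge> 0 \<Longrightarrow> z t \<in> borel_measurable M"
    and z_solution: "AE \<omega> in M. continuous_on {0..} (\<lambda>t. z t \<omega>) \<and>
      (\<forall>t\<ge>0. z t \<omega> = z0 + integral {0..t} (\<lambda>s. B (z s \<omega>)) + G (W t \<omega>))"
    and S_derivative: "(\<And>t. (y has_vector_derivative C (y t)) (at t)) \<Longrightarrow>
      ((\<lambda>t. S (y t)) has_real_derivative - (G' (y s) \<bullet> G' (y s))) (at s)"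
    and S_limit: "(\<And>t. (y has_vector_derivative C (y t)) (at t)) \<Longrightarrow> ((\<lambda>t. S (y t)) \<longlongrightarrow> 0) at_top"
    and flow_convergent: "(\<And>t. (y has_vector_derivative C (y t)) (at t)) \<Longrightarrow> \<exists>l. (y \<longlongrightarrow> l) at_top"
begin

section \<open>Variance of the noise along the transposed flow\<close>

definition flow :: "(real \<Rightarrow> 'e) \<Rightarrow> bool" where
  "flow y \<longleftrightarrow> (\<forall>t. (y has_vector_derivative C (y t)) (at t))"

lemma flowD: "flow y \<Longrightarrow> (y has_vector_derivative C (y t)) (at t)"
  by (simp add: flow_def)

lemma flow_add: "flow x \<Longrightarrow> flow y \<Longrightarrow> flow (\<lambda>t. x t + y t)"
  by (simp add: flow_def linear_add[OF linear_C] has_vector_derivative_add)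

lemma flow_diff: "flow x \<Longrightarrow> flow y \<Longrightarrow> flow (\<lambda>t. x t - y t)"
  by (simp add: flow_def linear_diff[OF linear_C] has_vector_derivative_diff)

lemma continuous_flow: "flow y \<Longrightarrow> continuous_on A y"
  by (intro continuous_at_imp_continuous_on ballI has_vector_derivative_continuous[OF flowD])

lemma integrand_derivative:
  assumes "flow y"
  shows "((\<lambda>s. G' (y s)) has_vector_derivative G' (C (y s))) (at s)"
    and "continuous_on A (\<lambda>s. G' (C (y s)))"
proof -
  have bl: "bounded_linear G'" "bounded_linear C"
    using linear_G' linear_C by (simp_all add: linear_conv_bounded_linear)
  show "((\<lambda>s. G' (y s)) has_vector_derivative G' (C (y s))) (at s)"
    by (rule bounded_linear.has_vector_derivative[OF bl(1) flowD[OF assms]])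
  show "continuous_on A (\<lambda>s. G' (C (y s)))"
    by (intro bounded_linear.continuous_on[OF bl(1)] bounded_linear.continuous_on[OF bl(2)] continuous_flow assms)
qed

lemma integral_noise_power:
  assumes y: "flow y" and "a \<le> b"
  shows "integral {a..b} (\<lambda>s. G' (y s) \<bullet> G' (y s)) = S (y a) - S (y b)"
proof -
  have "((\<lambda>s. - (G' (y s) \<bullet> G' (y s))) has_integral (S (y b) - S (y a))) {a..b}"
    using S_derivative[of y, OF flowD[OF y]] assms(2)
    by (intro fundamental_theorem_of_calculus)
      (auto simp: has_real_derivative_iff_has_vector_derivative intro: has_vector_derivative_at_within)
  from has_integral_neg[OF this] show ?thesis by (simp add: integral_unique)
qed

lemma noise_moments:
  assumes y: "flow y" and ab: "0 \<le> a" "a \<le> b"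
  shows "sq_int M (wiener (\<lambda>s. G' (y s)) a b)" "expectation (wiener (\<lambda>s. G' (y s)) a b) = 0"
    "expectation (\<lambda>\<omega>. (wiener (\<lambda>s. G' (y s)) a b \<omega>)\<^sup>2) = S (y a) - S (y b)"
  using wiener_isometry[OF integrand_derivative[OF y] ab] integral_noise_power[OF y ab(2)] by auto

lemma S_mono: assumes "flow y" "0 \<le> a" "a \<le> b" shows "S (y b) \<le> S (y a)"
proof -
  have "expectation (\<lambda>\<omega>. (wiener (\<lambda>s. G' (y s)) a b \<omega>)\<^sup>2) \<ge> 0" by (rule integral_nonneg_AE) simp
  then show ?thesis using noise_moments(3)[OF assms] by simp
qed

text \<open>By the isometry \<open>S\<close> decreases along a flow, as a drop of \<open>S\<close>
  is a second moment; being decreasing with limit \<open>0\<close>, it is nonnegative.\<close>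

lemma S_nonneg: assumes "flow y" "0 \<le> a" shows "0 \<le> S (y a)"
proof (rule tendsto_upperbound[OF S_limit[of y, OF flowD[OF assms(1)]]])
  show "\<forall>\<^sub>F t in at_top. S (y t) \<le> S (y a)"
    using eventually_ge_at_top[of a] by eventually_elim (rule S_mono[OF assms])
qed simp

lemma noise_increment:
  assumes y: "flow y" and st: "0 \<le> s" "s \<le> t"
  shows "expectation (\<lambda>\<omega>. (wiener (\<lambda>s. G' (y s)) 0 t \<omega> - wiener (\<lambda>s. G' (y s)) 0 s \<omega>)\<^sup>2) = S (y s) - S (y t)"
proof -
  have [measurable]: "wiener (\<lambda>s. G' (y s)) a b \<in> borel_measurable M" if "0 \<le> a" "a \<le> b" for a b
    by (rule measurable_wiener[OF that])
  have "AE \<omega> in M. (wiener (\<lambda>s. G' (y s)) 0 t \<omega> - wiener (\<lambda>s. G' (y s)) 0 s \<omega>)\<^sup>2 = (wiener (\<lambda>s. G' (y s)) s t \<omega>)\<^sup>2"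
    using wiener_append[OF integrand_derivative[OF y], of 0 s t] st by auto
  then have "expectation (\<lambda>\<omega>. (wiener (\<lambda>s. G' (y s)) 0 t \<omega> - wiener (\<lambda>s. G' (y s)) 0 s \<omega>)\<^sup>2)
     = expectation (\<lambda>\<omega>. (wiener (\<lambda>s. G' (y s)) s t \<omega>)\<^sup>2)"
    using st by (intro integral_cong_AE) auto
  then show ?thesis using noise_moments(3)[OF y st] by simp
qed

text \<open>The integral over \<open>[s, t]\<close> has second moment at most
  \<open>S (y s)\<close>, which tends to \<open>0\<close>, so the integrals up to time
  \<open>t\<close> are Cauchy in mean square. The limit \<open>V\<close> is kept arbitrary so that
  sums and differences of coordinates can be inserted for it.\<close>

lemma noise_limit:
  assumes y: "flow y" and r: "strict_mono r" and V: "V \<in> borel_measurable M"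
    and lim: "AE \<omega> in M. (\<lambda>n. wiener (\<lambda>s. G' (y s)) 0 (real (r n)) \<omega>) \<longlonglongrightarrow> V \<omega>"
  shows "sq_int M V" "expectation V = 0" "expectation (\<lambda>\<omega>. (V \<omega>)\<^sup>2) = S (y 0)"
    and "t \<ge> 0 \<Longrightarrow> expectation (\<lambda>\<omega>. (V \<omega> - wiener (\<lambda>s. G' (y s)) 0 t \<omega>)\<^sup>2) = S (y t)"
proof -
  define X where "X n = wiener (\<lambda>s. G' (y s)) 0 (real (r n))" for n
  have lim': "AE \<omega> in M. (\<lambda>n. X n \<omega>) \<longlonglongrightarrow> V \<omega>" using lim by (simp add: X_def)
  have X: "sq_int M (X n)" "expectation (X n) = 0" "expectation (\<lambda>\<omega>. (X n \<omega>)\<^sup>2) = S (y 0) - S (y (real (r n)))" for n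
    unfolding X_def by (auto intro!: noise_moments y)
  have r_lim: "filterlim (\<lambda>n. real (r n)) at_top sequentially"
    by (rule filterlim_compose[OF filterlim_real_sequentially filterlim_subseq[OF r]])
  have S0: "(\<lambda>n. S (y (real (r n)))) \<longlonglongrightarrow> 0"
    by (rule filterlim_compose[OF S_limit[of y, OF flowD[OF y]] r_lim])
  have diff: "expectation (\<lambda>\<omega>. (X m \<omega> - X n \<omega>)\<^sup>2) = S (y (real (r n))) - S (y (real (r m)))" if "n \<le> m" for m n
    unfolding X_def using strict_mono_less_eq[OF r, of n m] that by (intro noise_increment y) auto
  have Cauchy: "\<exists>N. \<forall>n\<ge>N. \<forall>m\<ge>n. expectation (\<lambda>\<omega>. (X m \<omega> - X n \<omega>)\<^sup>2) \<le> e" if "e > 0" for e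
  proof -
    have "\<forall>\<^sub>F n in sequentially. S (y (real (r n))) < e" using S0 that by (rule order_tendstoD(2))
    then obtain N where N: "\<And>n. n \<ge> N \<Longrightarrow> S (y (real (r n))) < e" by (auto simp: eventually_sequentially)
    have "expectation (\<lambda>\<omega>. (X m \<omega> - X n \<omega>)\<^sup>2) \<le> e" if "n \<ge> N" "m \<ge> n" for n m
      using N[OF that(1)] diff[OF that(2)] S_nonneg[OF y, of "real (r m)"] by simp
    then show ?thesis by blast
  qed
  note L2 = L2_limit[OF X(1) V lim' Cauchy]
  show sqV: "sq_int M V" by (rule L2(1))
  show "expectation V = 0" using L2(4) X(2) by (simp add: LIMSEQ_const_iff)
  have "(\<lambda>n. S (y 0) - S (y (real (r n)))) \<longlonglongrightarrow> S (y 0) - 0" by (intro tendsto_intros S0)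
  then show "expectation (\<lambda>\<omega>. (V \<omega>)\<^sup>2) = S (y 0)"
    using L2(3) X(3) LIMSEQ_unique by fastforce
  show "expectation (\<lambda>\<omega>. (V \<omega> - wiener (\<lambda>s. G' (y s)) 0 t \<omega>)\<^sup>2) = S (y t)" if t: "t \<ge> 0"
  proof -
    define J where "J = wiener (\<lambda>s. G' (y s)) 0 t"
    have sqJ: "sq_int M J" unfolding J_def using t by (intro noise_moments y) auto
    have "(\<lambda>\<omega>. V \<omega> - J \<omega>) \<in> borel_measurable M" using sqV sqJ by (auto simp: sq_int_def)
    moreover have "AE \<omega> in M. (\<lambda>n. X n \<omega> - J \<omega>) \<longlonglongrightarrow> V \<omega> - J \<omega>"
      using lim' by eventually_elim (intro tendsto_intros)
    \<comment> \<open>Subtracting the fixed variable \<open>J\<close> does not change the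
      differences, so \<open>L2_limit\<close> applies a second time and yields the distance to
      \<open>J\<close>.\<close>
    moreover have "\<exists>N. \<forall>n\<ge>N. \<forall>m\<ge>n. expectation (\<lambda>\<omega>. (X m \<omega> - J \<omega> - (X n \<omega> - J \<omega>))\<^sup>2) \<le> e" if "e > 0" for e
      using Cauchy[OF that] by simp
    ultimately have "(\<lambda>n. expectation (\<lambda>\<omega>. (X n \<omega> - J \<omega>)\<^sup>2)) \<longlonglongrightarrow> expectation (\<lambda>\<omega>. (V \<omega> - J \<omega>)\<^sup>2)"
      by (intro L2_limit(3)[OF sq_int_diff[OF X(1) sqJ]])
    moreover have "(\<lambda>n. expectation (\<lambda>\<omega>. (X n \<omega> - J \<omega>)\<^sup>2)) \<longlonglongrightarrow> S (y t)"
    proof (rule Lim_transform_eventually)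
      show "(\<lambda>n. S (y t) - S (y (real (r n)))) \<longlonglongrightarrow> S (y t)" using tendsto_diff[OF tendsto_const S0] by simp
      have "\<forall>\<^sub>F n in sequentially. t \<le> real (r n)" using r_lim by (simp add: filterlim_at_top)
      then show "\<forall>\<^sub>F n in sequentially. S (y t) - S (y (real (r n))) = expectation (\<lambda>\<omega>. (X n \<omega> - J \<omega>)\<^sup>2)"
        by eventually_elim (simp add: X_def J_def noise_increment[OF y t])
    qed
    ultimately show ?thesis unfolding J_def by (rule LIMSEQ_unique)
  qed
qed

section \<open>Reversal of time in law\<close>

definition basis_flow :: "'e \<Rightarrow> real \<Rightarrow> 'e" where
  "basis_flow b = (SOME y. y 0 = b \<and> flow y)"

lemma basis_flow_0 [simp]: "basis_flow b 0 = b" and flow_basis_flow: "flow (basis_flow b)"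
proof -
  obtain y where "y 0 = b" "\<And>t. (y has_vector_derivative C (y t)) (at t)"
    using linear_ode_solution[OF linear_C, of b] by blast
  then have "\<exists>y. y 0 = b \<and> flow y" unfolding flow_def by blast
  from someI_ex[OF this] show "basis_flow b 0 = b" "flow (basis_flow b)"
    unfolding basis_flow_def by auto
qed

abbreviation kernel :: "'e \<Rightarrow> real \<Rightarrow> real ^ 'n" where
  "kernel b s \<equiv> G' (basis_flow b s)"

text \<open>
  For the integrand \<open>s \<mapsto> kernel b (t - s)\<close>, the right endpoint of the \<open>i\<close>-th of \<open>n\<close> intervals gives the
  left grid point \<open>n - 1 - i\<close>, so only the increments appear in reversed order.
\<close>

lemma solution_riemann:
  assumes t: "t > 0"
  shows "AE \<omega> in M. (\<lambda>k. basis_flow b t \<bullet> z0 +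
      (\<Sum>i<2 ^ k. kernel b (grid 0 t (2 ^ k) i) \<bullet> increment 0 t (2 ^ k) (2 ^ k - 1 - i) \<omega>)) \<longlonglongrightarrow> z t \<omega> \<bullet> b"
  using z_solution continuous_paths W_zero
proof eventually_elim
  case (elim \<omega>)
  let ?y = "basis_flow b"
  have y: "flow ?y" by (rule flow_basis_flow)
  have G_W: "x \<bullet> G w = G' x \<bullet> w" for x w by (metis adj_G inner_commute)
  have "b \<bullet> z t \<omega> = ?y t \<bullet> z0 + b \<bullet> G (W t \<omega>) + integral {0..t} (\<lambda>s. C (?y (t - s)) \<bullet> G (W s \<omega>))"
    using elim t by (intro variation_of_constants[OF adj_B linear_B, where z="\<lambda>s. z s \<omega>"] flowD[OF y])
      (auto intro: continuous_on_subset)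
  \<comment> \<open>Almost surely \<open>W 0\<close> vanishes, so its boundary term may be inserted;
    the bracket then has the form of the limit in \<open>riemann_right\<close>.\<close>
  then have zb: "z t \<omega> \<bullet> b = ?y t \<bullet> z0 + (kernel b (t - t) \<bullet> W t \<omega> - kernel b (t - 0) \<bullet> W 0 \<omega>
      - integral {0..t} (\<lambda>s. - G' (C (?y (t - s))) \<bullet> W s \<omega>))"
    using elim by (simp add: G_W inner_commute[of b])
  have rev_deriv: "((\<lambda>s. kernel b (t - s)) has_vector_derivative - G' (C (?y (t - s)))) (at s)" for s
  proof -
    have "((\<lambda>s. t - s) has_vector_derivative -1) (at s)"
      by (auto intro!: derivative_eq_intros simp: has_real_derivative_iff_has_vector_derivative[symmetric])
    then show ?thesis
      using vector_diff_chain_at[of "\<lambda>s. t - s" "-1" s "kernel b" "G' (C (?y (t - s)))"] integrand_derivative(1)[OF y, of "t - s"]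
      by (simp add: o_def)
  qed
  have "continuous_on A (\<lambda>s. - G' (C (?y (t - s))))" for A
    by (intro continuous_intros continuous_on_compose2[OF integrand_derivative(2)[OF y, of UNIV]]) auto
  then have "(\<lambda>n. \<Sum>i<n. kernel b (t - grid 0 t n (Suc i)) \<bullet> (W (grid 0 t n (Suc i)) \<omega> - W (grid 0 t n i) \<omega>))
      \<longlonglongrightarrow> kernel b (t - t) \<bullet> W t \<omega> - kernel b (t - 0) \<bullet> W 0 \<omega> - integral {0..t} (\<lambda>s. - G' (C (?y (t - s))) \<bullet> W s \<omega>)"
    using t by (intro riemann_right[where g="\<lambda>s. kernel b (t - s)"] rev_deriv continuous_on_subset[OF elim(2)]) auto
  from filterlim_compose[OF this filterlim_power2]
  have "(\<lambda>k. ?y t \<bullet> z0 + (\<Sum>i<2 ^ k. kernel b (t - grid 0 t (2 ^ k) (Suc i)) \<bullet> increment 0 t (2 ^ k) i \<omega>)) \<longlonglongrightarrow> z t \<omega> \<bullet> b"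
    unfolding zb increment_def by (intro tendsto_add tendsto_const)
  moreover have "(\<Sum>i<n. kernel b (t - grid 0 t n (Suc i)) \<bullet> increment 0 t n i \<omega>)
    = (\<Sum>i<n. kernel b (grid 0 t n i) \<bullet> increment 0 t n (n - 1 - i) \<omega>)" if "n > 0" for n
  proof -
    have "(\<Sum>i<n. kernel b (t - grid 0 t n (Suc i)) \<bullet> increment 0 t n i \<omega>)
      = (\<Sum>i<n. kernel b (t - grid 0 t n (Suc (n - Suc i))) \<bullet> increment 0 t n (n - Suc i) \<omega>)"
      by (rule sum.nat_diff_reindex[symmetric])
    also have "\<dots> = (\<Sum>i<n. kernel b (grid 0 t n i) \<bullet> increment 0 t n (n - 1 - i) \<omega>)"
    proof (rule sum.cong[OF refl])
      fix i assume "i \<in> {..<n}"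
      then have "t - grid 0 t n (Suc (n - Suc i)) = grid 0 t n i"
        using that by (simp add: grid_def Suc_diff_Suc of_nat_diff field_simps)
      then show "kernel b (t - grid 0 t n (Suc (n - Suc i))) \<bullet> increment 0 t n (n - Suc i) \<omega>
        = kernel b (grid 0 t n i) \<bullet> increment 0 t n (n - 1 - i) \<omega>" by simp
    qed
    finally show ?thesis .
  qed
  ultimately show ?case by simp
qed

text \<open>To be compared with \<open>z t\<close> in law at one fixed time, not as a process. Its
  random part depends on \<open>t\<close> only through the upper limit of the integrals, which makes
  convergence in mean possible.\<close>

definition reversed :: "real \<Rightarrow> 'a \<Rightarrow> 'e" where
  "reversed t \<omega> = (\<Sum>b\<in>Basis. (basis_flow b t \<bullet> z0 + wiener (kernel b) 0 t \<omega>) *\<^sub>R b)"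

lemma measurable_reversed: "t \<ge> 0 \<Longrightarrow> reversed t \<in> borel_measurable M"
  unfolding reversed_def[abs_def]
  by (intro borel_measurable_sum borel_measurable_scaleR borel_measurable_add borel_measurable_const measurable_wiener) auto

text \<open>The increments of the driving noise over a uniform grid are exchangeable.\<close>

lemma solution_reversed:
  fixes f :: "'e \<Rightarrow> real"
  assumes t: "t > 0" and f: "continuous_on UNIV f" "bounded (range f)"
  shows "expectation (\<lambda>\<omega>. f (z t \<omega>)) = expectation (\<lambda>\<omega>. f (reversed t \<omega>))"
proof -
  have [measurable]: "f \<in> borel_measurable borel" by (rule borel_measurable_continuous_onI[OF f(1)])
  \<comment> \<open>The approximations of \<open>z t\<close> and of \<open>reversed t\<close> are
    the same function \<open>\<Psi> n\<close> of the family of increments, taken once in reversed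
    and once in natural order.\<close>
  define \<Psi> where "\<Psi> n F = (\<Sum>b\<in>Basis. (basis_flow b t \<bullet> z0 + (\<Sum>i<n. kernel b (grid 0 t n i) \<bullet> F i)) *\<^sub>R b)"
    for n and F :: "nat \<Rightarrow> real ^ 'n"
  have inc [measurable]: "increment 0 t n i \<in> borel_measurable M" for n i
    using t by (intro measurable_increment_grid) auto
  have "(\<lambda>k. expectation (\<lambda>\<omega>. f (\<Psi> (2 ^ k) (\<lambda>i. increment 0 t (2 ^ k) (2 ^ k - 1 - i) \<omega>))))
    \<longlonglongrightarrow> expectation (\<lambda>\<omega>. f (z t \<omega>))"
  proof (rule expectation_bounded_continuous_AE[OF f])
    show "(\<lambda>\<omega>. \<Psi> (2 ^ k) (\<lambda>i. increment 0 t (2 ^ k) (2 ^ k - 1 - i) \<omega>)) \<in> borel_measurable M" for k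
      unfolding \<Psi>_def by measurable
    show "z t \<in> borel_measurable M" using t by (intro z_measurable) simp
    have "AE \<omega> in M. \<forall>b\<in>Basis. (\<lambda>k. basis_flow b t \<bullet> z0 +
      (\<Sum>i<2 ^ k. kernel b (grid 0 t (2 ^ k) i) \<bullet> increment 0 t (2 ^ k) (2 ^ k - 1 - i) \<omega>)) \<longlonglongrightarrow> z t \<omega> \<bullet> b"
      by (intro AE_finite_allI solution_riemann t) simp
    then show "AE \<omega> in M. (\<lambda>k. \<Psi> (2 ^ k) (\<lambda>i. increment 0 t (2 ^ k) (2 ^ k - 1 - i) \<omega>)) \<longlonglongrightarrow> z t \<omega>"
    proof eventually_elim
      case (elim \<omega>)
      have "(\<lambda>k. \<Psi> (2 ^ k) (\<lambda>i. increment 0 t (2 ^ k) (2 ^ k - 1 - i) \<omega>)) \<longlonglongrightarrow> (\<Sum>b\<in>Basis. (z t \<omega> \<bullet> b) *\<^sub>R b)"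
        unfolding \<Psi>_def using elim by (intro tendsto_sum tendsto_scaleR tendsto_const) auto
      then show ?case by (simp add: euclidean_representation)
    qed
  qed
  moreover have "(\<lambda>k. expectation (\<lambda>\<omega>. f (\<Psi> (2 ^ k) (\<lambda>i. increment 0 t (2 ^ k) i \<omega>))))
    \<longlonglongrightarrow> expectation (\<lambda>\<omega>. f (reversed t \<omega>))"
  proof (rule expectation_bounded_continuous_AE[OF f])
    show "(\<lambda>\<omega>. \<Psi> (2 ^ k) (\<lambda>i. increment 0 t (2 ^ k) i \<omega>)) \<in> borel_measurable M" for k
      unfolding \<Psi>_def by measurable
    show "reversed t \<in> borel_measurable M" using t by (intro measurable_reversed) simp
    have "AE \<omega> in M. \<forall>b\<in>Basis. (\<lambda>k. riemann_sum (kernel b) 0 t (2 ^ k) \<omega>) \<longlonglongrightarrow> wiener (kernel b) 0 t \<omega>"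
      using t by (intro AE_finite_allI wiener_limit[OF integrand_derivative[OF flow_basis_flow]]) auto
    then show "AE \<omega> in M. (\<lambda>k. \<Psi> (2 ^ k) (\<lambda>i. increment 0 t (2 ^ k) i \<omega>)) \<longlonglongrightarrow> reversed t \<omega>"
    proof eventually_elim
      case (elim \<omega>)
      then show ?case
        unfolding \<Psi>_def reversed_def riemann_sum_def
        by (intro tendsto_sum tendsto_scaleR tendsto_add tendsto_const) auto
    qed
  qed
  moreover have "expectation (\<lambda>\<omega>. f (\<Psi> n (\<lambda>i. increment 0 t n i \<omega>))) =
    expectation (\<lambda>\<omega>. f (\<Psi> n (\<lambda>i. increment 0 t n (n - 1 - i) \<omega>)))" if "n > 0" for n
  proof -
    have restrict: "\<Psi> n (\<lambda>i\<in>{..<n}. F i) = \<Psi> n F" for F by (simp add: \<Psi>_def)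
    have "(\<lambda>F. f (\<Psi> n F)) \<in> borel_measurable (Pi\<^sub>M {..<n} (\<lambda>_. borel))"
    proof -
      have "(\<lambda>F. F i) \<in> measurable (Pi\<^sub>M {..<n} (\<lambda>_. borel :: (real ^ 'n) measure)) borel" if "i < n" for i
        using that by (intro measurable_component_singleton) simp
      then have "\<Psi> n \<in> borel_measurable (Pi\<^sub>M {..<n} (\<lambda>_. borel))"
        unfolding \<Psi>_def[abs_def]
        by (intro borel_measurable_sum borel_measurable_scaleR borel_measurable_add borel_measurable_const borel_measurable_inner) auto
      then show ?thesis by measurable
    qed
    from increments_reversal[OF _ t that this] show ?thesis by (simp add: restrict)
  qed
  ultimately show ?thesis using LIMSEQ_unique by fastforce
qed

text \<open>Collecting all coordinates in one vector \<open>Y n\<close> gives a single subsequence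
  and a single measurable limit for all of them. The sequence is Cauchy in mean because each
  coordinate is controlled by \<open>sqrt (S (basis_flow b (real i)))\<close>.\<close>

lemma limit_exists:
  "\<exists>r U. strict_mono (r :: nat \<Rightarrow> nat) \<and> U \<in> borel_measurable M \<and>
    (\<forall>b\<in>Basis. AE \<omega> in M. (\<lambda>n. wiener (kernel b) 0 (real (r n)) \<omega>) \<longlonglongrightarrow> U \<omega> \<bullet> (b::'e))"
proof -
  define Y where "Y n \<omega> = (\<Sum>b\<in>Basis. wiener (kernel b) 0 (real n) \<omega> *\<^sub>R b)" for n :: nat and \<omega>
  have sq: "sq_int M (wiener (kernel b) 0 (real n))" for b and n :: nat
    by (intro noise_moments flow_basis_flow) auto
  have int: "integrable M (Y n)" for n
    unfolding Y_def[abs_def] by (intro Bochner_Integration.integrable_sum integrable_scaleR_left sq_int_integrable sq)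
  have bound: "expectation (\<lambda>\<omega>. norm (Y i \<omega> - Y j \<omega>)) \<le> (\<Sum>b\<in>Basis. sqrt (S (basis_flow b (real i))))" if "i \<le> j" for i j
  proof -
    have sqd: "sq_int M (\<lambda>\<omega>. wiener (kernel b) 0 (real i) \<omega> - wiener (kernel b) 0 (real j) \<omega>)" for b
      by (rule sq_int_diff[OF sq sq])
    have "norm (Y i \<omega> - Y j \<omega>) \<le> (\<Sum>b\<in>Basis. \<bar>wiener (kernel b) 0 (real i) \<omega> - wiener (kernel b) 0 (real j) \<omega>\<bar>)" for \<omega>
      unfolding Y_def sum_subtractf[symmetric] scaleR_diff_left[symmetric]
      by (rule order_trans[OF norm_sum]) simp
    then have "expectation (\<lambda>\<omega>. norm (Y i \<omega> - Y j \<omega>)) \<le>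
      expectation (\<lambda>\<omega>. \<Sum>b\<in>Basis. \<bar>wiener (kernel b) 0 (real i) \<omega> - wiener (kernel b) 0 (real j) \<omega>\<bar>)"
      using integrable_abs[OF sq_int_integrable[OF sqd]]
      by (intro integral_mono integrable_norm Bochner_Integration.integrable_diff int Bochner_Integration.integrable_sum)
    also have "\<dots> = (\<Sum>b\<in>Basis. expectation (\<lambda>\<omega>. \<bar>wiener (kernel b) 0 (real i) \<omega> - wiener (kernel b) 0 (real j) \<omega>\<bar>))"
      using sq_int_integrable[OF sqd] by (intro Bochner_Integration.integral_sum integrable_abs)
    also have "\<dots> \<le> (\<Sum>b\<in>Basis. sqrt (S (basis_flow b (real i))))"
    proof (rule sum_mono)
      fix b :: 'e
      have "expectation (\<lambda>\<omega>. (wiener (kernel b) 0 (real i) \<omega> - wiener (kernel b) 0 (real j) \<omega>)\<^sup>2)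
        = S (basis_flow b (real i)) - S (basis_flow b (real j))"
        using noise_increment[OF flow_basis_flow, of "real i" "real j" b] that by (simp add: power2_commute)
      also have "\<dots> \<le> S (basis_flow b (real i))" using S_nonneg[OF flow_basis_flow, of "real j" b] by simp
      finally have "sqrt (expectation (\<lambda>\<omega>. (wiener (kernel b) 0 (real i) \<omega> - wiener (kernel b) 0 (real j) \<omega>)\<^sup>2))
        \<le> sqrt (S (basis_flow b (real i)))" by (rule real_sqrt_le_mono)
      with expectation_abs_le_sqrt[OF sqd]
      show "expectation (\<lambda>\<omega>. \<bar>wiener (kernel b) 0 (real i) \<omega> - wiener (kernel b) 0 (real j) \<omega>\<bar>) \<le> sqrt (S (basis_flow b (real i)))"
        by (rule order_trans)
    qed
    finally show ?thesis .
  qed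
  have "(\<lambda>n. S (basis_flow b (real n))) \<longlonglongrightarrow> 0" for b
    by (rule filterlim_compose[OF S_limit[of "basis_flow b", OF flowD[OF flow_basis_flow]] filterlim_real_sequentially])
  then have "(\<lambda>n. \<Sum>b\<in>(Basis::'e set). sqrt (S (basis_flow b (real n)))) \<longlonglongrightarrow> (\<Sum>b\<in>(Basis::'e set). sqrt 0)"
    by (intro tendsto_sum tendsto_real_sqrt)
  then have lim0: "(\<lambda>n. \<Sum>b\<in>(Basis::'e set). sqrt (S (basis_flow b (real n)))) \<longlonglongrightarrow> 0" by simp
  have Cauchy_Y: "\<exists>N. \<forall>i\<ge>N. \<forall>j\<ge>N. expectation (\<lambda>\<omega>. norm (Y i \<omega> - Y j \<omega>)) < e" if e: "e > 0" for e
  proof -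
    obtain N where N: "\<And>n. n \<ge> N \<Longrightarrow> (\<Sum>b\<in>(Basis::'e set). sqrt (S (basis_flow b (real n)))) < e"
      using order_tendstoD(2)[OF lim0 e] by (auto simp: eventually_sequentially)
    have "expectation (\<lambda>\<omega>. norm (Y i \<omega> - Y j \<omega>)) < e" if "i \<ge> N" "j \<ge> N" for i j
      using bound[of i j] bound[of j i] N[OF that(1)] N[OF that(2)]
      by (cases "i \<le> j") (auto simp: norm_minus_commute[of "Y i _"])
    then show ?thesis by blast
  qed
  obtain r where r: "strict_mono r" "AE \<omega> in M. Cauchy (\<lambda>i. Y (r i) \<omega>)"
    by (rule cauchy_L1_AE_cauchy_subseq[where s=Y, OF int Cauchy_Y])
  define U where "U \<omega> = lim (\<lambda>i. Y (r i) \<omega>)" for \<omega>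
  have [measurable]: "Y n \<in> borel_measurable M" for n using int[of n] by simp
  have "U \<in> borel_measurable M" unfolding U_def[abs_def] by measurable
  moreover have "AE \<omega> in M. (\<lambda>n. wiener (kernel b) 0 (real (r n)) \<omega>) \<longlonglongrightarrow> U \<omega> \<bullet> b" if b: "b \<in> Basis" for b
    using r(2)
  proof eventually_elim
    case (elim \<omega>)
    then have "(\<lambda>i. Y (r i) \<omega>) \<longlonglongrightarrow> U \<omega>"
      unfolding U_def using Cauchy_convergent_iff convergent_LIMSEQ_iff by blast
    then have "(\<lambda>i. Y (r i) \<omega> \<bullet> b) \<longlonglongrightarrow> U \<omega> \<bullet> b" by (intro tendsto_intros)
    moreover have "Y n \<omega> \<bullet> b = wiener (kernel b) 0 (real n) \<omega>" for n
      using b by (simp add: Y_def inner_sum_left inner_Basis if_distrib cong: if_cong)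
    ultimately show ?case by simp
  qed
  ultimately show ?thesis using r(1) by blast
qed

text \<open>Riemann sums are exactly additive in the integrand, hence so are their almost sure
  limits. Together with \<open>wiener_flow_diff\<close>, the same fact for \<open>x - y\<close> and
  \<open>y\<close>, this prepares the polarization.\<close>

lemma wiener_flow_add:
  assumes "flow x" "flow y" "0 \<le> a" "a \<le> b"
  shows "AE \<omega> in M. wiener (\<lambda>s. G' (x s + y s)) a b \<omega> = wiener (\<lambda>s. G' (x s)) a b \<omega> + wiener (\<lambda>s. G' (y s)) a b \<omega>"
  using wiener_limit[OF integrand_derivative[OF flow_add[OF assms(1,2)]] assms(3,4)]
    wiener_limit[OF integrand_derivative[OF assms(1)] assms(3,4)] wiener_limit[OF integrand_derivative[OF assms(2)] assms(3,4)]
proof eventually_elim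
  case (elim \<omega>)
  have "(\<lambda>k. riemann_sum (\<lambda>s. G' (x s + y s)) a b (2 ^ k) \<omega>) \<longlonglongrightarrow> wiener (\<lambda>s. G' (x s)) a b \<omega> + wiener (\<lambda>s. G' (y s)) a b \<omega>"
    using tendsto_add[OF elim(2,3)]
    by (simp add: riemann_sum_def linear_add[OF linear_G'] inner_add_left sum.distrib)
  then show ?case using elim(1) LIMSEQ_unique by blast
qed

lemma wiener_flow_diff:
  assumes "flow x" "flow y" "0 \<le> a" "a \<le> b"
  shows "AE \<omega> in M. wiener (\<lambda>s. G' (x s - y s)) a b \<omega> = wiener (\<lambda>s. G' (x s)) a b \<omega> - wiener (\<lambda>s. G' (y s)) a b \<omega>"
  using wiener_flow_add[OF flow_diff[OF assms(1,2)] assms(2-4)] by eventually_elim simp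

text \<open>The limit law is that of \<open>m + U\<close>, with \<open>m\<close> the limit of the
  deterministic part and \<open>U\<close> the noise integrated over all times. The distance from
  \<open>reversed t\<close> to \<open>m + U\<close> is bounded in mean by the error in
  \<open>m\<close> plus terms \<open>sqrt (S (basis_flow b t))\<close>.\<close>

theorem limiting_covariance:
  obtains \<mu> where "limiting_distribution M z \<mu>" "\<And>b. b \<in> Basis \<Longrightarrow> integrable \<mu> (\<lambda>x. (x \<bullet> b)\<^sup>2)"
    "\<And>b c. b \<in> Basis \<Longrightarrow> c \<in> Basis \<Longrightarrow>
      (\<integral>x. (x \<bullet> b - (\<integral>x. x \<bullet> b \<partial>\<mu>)) * (x \<bullet> c - (\<integral>x. x \<bullet> c \<partial>\<mu>)) \<partial>\<mu>) = (S (b + c) - S (b - c)) / 4"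
proof -
  obtain r U where r: "strict_mono (r :: nat \<Rightarrow> nat)" and U [measurable]: "U \<in> borel_measurable M"
    and lim: "\<And>b :: 'e. b \<in> Basis \<Longrightarrow> AE \<omega> in M. (\<lambda>n. wiener (kernel b) 0 (real (r n)) \<omega>) \<longlonglongrightarrow> U \<omega> \<bullet> b"
    using limit_exists by blast
  have "\<exists>l. ((\<lambda>t. basis_flow b t \<bullet> z0) \<longlongrightarrow> l) at_top" for b
  proof -
    obtain l where "(basis_flow b \<longlongrightarrow> l) at_top"
      using flow_convergent[of "basis_flow b", OF flowD[OF flow_basis_flow]] by blast
    from tendsto_inner[OF this tendsto_const] show ?thesis by blast
  qed
  then obtain l where l: "\<And>b. ((\<lambda>t. basis_flow b t \<bullet> z0) \<longlongrightarrow> l b) at_top" by metis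
  define m :: 'e where "m = (\<Sum>b\<in>Basis. l b *\<^sub>R b)"
  have m: "m \<bullet> b = l b" if "b \<in> Basis" for b
    using that by (simp add: m_def inner_sum_left inner_Basis if_distrib cong: if_cong)
  define \<mu> where "\<mu> = distr M borel (\<lambda>\<omega>. m + U \<omega>)"
  have Ub: "(\<lambda>\<omega>. U \<omega> \<bullet> b) \<in> borel_measurable M" for b by measurable
  note noise_b = noise_limit[OF flow_basis_flow r Ub lim]
  have sqU: "sq_int M (\<lambda>\<omega>. U \<omega> \<bullet> b)" if "b \<in> Basis" for b by (rule noise_b(1)[OF that])
  have meanU: "expectation (\<lambda>\<omega>. U \<omega> \<bullet> b) = 0" if "b \<in> Basis" for b by (rule noise_b(2)[OF that])
  \<comment> \<open>Polarization: second moments are known for single flows only, so the flows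
    started at \<open>b + c\<close> and \<open>b - c\<close> are used.\<close>
  have covU: "expectation (\<lambda>\<omega>. (U \<omega> \<bullet> b) * (U \<omega> \<bullet> c)) = (S (b + c) - S (b - c)) / 4"
    if bc: "b \<in> Basis" "c \<in> Basis" for b c
  proof -
    have "AE \<omega> in M. \<forall>n. wiener (\<lambda>s. G' (basis_flow b s + basis_flow c s)) 0 (real (r n)) \<omega>
        = wiener (kernel b) 0 (real (r n)) \<omega> + wiener (kernel c) 0 (real (r n)) \<omega>"
      unfolding AE_all_countable by (intro allI wiener_flow_add flow_basis_flow) auto
    with lim[OF bc(1)] lim[OF bc(2)]
    have "AE \<omega> in M. (\<lambda>n. wiener (\<lambda>s. G' (basis_flow b s + basis_flow c s)) 0 (real (r n)) \<omega>) \<longlonglongrightarrow> U \<omega> \<bullet> b + U \<omega> \<bullet> c"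
      by eventually_elim (simp add: tendsto_add)
    then have plus: "expectation (\<lambda>\<omega>. (U \<omega> \<bullet> b + U \<omega> \<bullet> c)\<^sup>2) = S (b + c)"
      using noise_limit(3)[OF flow_add[OF flow_basis_flow flow_basis_flow] r borel_measurable_add[OF Ub Ub], of b c b c] by simp
    have "AE \<omega> in M. \<forall>n. wiener (\<lambda>s. G' (basis_flow b s - basis_flow c s)) 0 (real (r n)) \<omega>
        = wiener (kernel b) 0 (real (r n)) \<omega> - wiener (kernel c) 0 (real (r n)) \<omega>"
      unfolding AE_all_countable by (intro allI wiener_flow_diff flow_basis_flow) auto
    with lim[OF bc(1)] lim[OF bc(2)]
    have "AE \<omega> in M. (\<lambda>n. wiener (\<lambda>s. G' (basis_flow b s - basis_flow c s)) 0 (real (r n)) \<omega>) \<longlonglongrightarrow> U \<omega> \<bullet> b - U \<omega> \<bullet> c"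
      by eventually_elim (simp add: tendsto_diff)
    then have minus: "expectation (\<lambda>\<omega>. (U \<omega> \<bullet> b - U \<omega> \<bullet> c)\<^sup>2) = S (b - c)"
      using noise_limit(3)[OF flow_diff[OF flow_basis_flow flow_basis_flow] r borel_measurable_diff[OF Ub Ub], of b c b c] by simp
    have "expectation (\<lambda>\<omega>. (U \<omega> \<bullet> b + U \<omega> \<bullet> c)\<^sup>2 - (U \<omega> \<bullet> b - U \<omega> \<bullet> c)\<^sup>2) = S (b + c) - S (b - c)"
      using sq_int_add[OF sqU sqU, OF bc] sq_int_diff[OF sqU sqU, OF bc] plus minus by (simp add: sq_int_def)
    moreover have "(\<lambda>\<omega>. (U \<omega> \<bullet> b + U \<omega> \<bullet> c)\<^sup>2 - (U \<omega> \<bullet> b - U \<omega> \<bullet> c)\<^sup>2) = (\<lambda>\<omega>. 4 * ((U \<omega> \<bullet> b) * (U \<omega> \<bullet> c)))"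
      by (simp add: fun_eq_iff power2_eq_square algebra_simps)
    ultimately show ?thesis by simp
  qed
  have sqm: "sq_int M (\<lambda>\<omega>. (m + U \<omega>) \<bullet> b)" if "b \<in> Basis" for b
    unfolding inner_add_left using sqU[OF that] by (intro sq_int_add) (simp_all add: sq_int_def)
  have meas_mU: "(\<lambda>\<omega>. m + U \<omega>) \<in> borel_measurable M" by measurable
  have mean: "(\<integral>x. x \<bullet> b \<partial>\<mu>) = m \<bullet> b" if "b \<in> Basis" for b
    unfolding \<mu>_def using meanU[OF that] sq_int_integrable[OF sqU[OF that]]
    by (subst integral_distr[OF meas_mU]) (auto simp: inner_add_left prob_space)
  show ?thesis
  proof (rule that)
    show "integrable \<mu> (\<lambda>x. (x \<bullet> b)\<^sup>2)" if "b \<in> Basis" for b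
      unfolding \<mu>_def using sqm[OF that] by (subst integrable_distr_eq[OF meas_mU]) (auto simp: sq_int_def)
    show "(\<integral>x. (x \<bullet> b - (\<integral>x. x \<bullet> b \<partial>\<mu>)) * (x \<bullet> c - (\<integral>x. x \<bullet> c \<partial>\<mu>)) \<partial>\<mu>) = (S (b + c) - S (b - c)) / 4"
      if "b \<in> Basis" "c \<in> Basis" for b c
      unfolding mean[OF that(1)] mean[OF that(2)] unfolding \<mu>_def
      using covU[OF that] by (subst integral_distr[OF meas_mU]) (auto simp: inner_add_left)
    show "limiting_distribution M z \<mu>"
      unfolding limiting_distribution_def
    proof (intro conjI allI impI)
      show "prob_space \<mu>" unfolding \<mu>_def by (rule prob_space_distr[OF meas_mU])
      show "sets \<mu> = sets borel" by (simp add: \<mu>_def)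
      fix f :: "'e \<Rightarrow> real" assume f: "continuous_on UNIV f" "bounded (range f)"
      have fb: "f \<in> borel_measurable borel" by (rule borel_measurable_continuous_onI[OF f(1)])
      \<comment> \<open>Replacing \<open>t\<close> by \<open>max 0 t\<close> makes measurability and
        integrability hold for all real \<open>t\<close>, and nothing changes near infinity.\<close>
      define D where "D t \<omega> = reversed (max 0 t) \<omega> - (m + U \<omega>)" for t \<omega>
      have D: "D t \<omega> = (\<Sum>b\<in>Basis. ((basis_flow b (max 0 t) \<bullet> z0 - l b) - (U \<omega> \<bullet> b - wiener (kernel b) 0 (max 0 t) \<omega>)) *\<^sub>R b)" for t \<omega>
      proof -
        have "U \<omega> = (\<Sum>b\<in>Basis. (U \<omega> \<bullet> b) *\<^sub>R b)" by (simp add: euclidean_representation)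
        then have "D t \<omega> = reversed (max 0 t) \<omega> - (m + (\<Sum>b\<in>Basis. (U \<omega> \<bullet> b) *\<^sub>R b))" by (simp add: D_def)
        then show ?thesis
          by (simp add: reversed_def m_def sum.distrib[symmetric] sum_subtractf[symmetric] algebra_simps)
      qed
      have sqW: "sq_int M (wiener (kernel b) 0 (max 0 t))" for b t
        by (intro noise_moments flow_basis_flow) auto
      have sqD: "sq_int M (\<lambda>\<omega>. U \<omega> \<bullet> b - wiener (kernel b) 0 (max 0 t) \<omega>)" if "b \<in> Basis" for b t
        by (rule sq_int_diff[OF sqU[OF that] sqW])
      have intD: "integrable M (D t)" for t
        unfolding D[abs_def]
        by (intro Bochner_Integration.integrable_sum integrable_scaleR_left
            Bochner_Integration.integrable_diff[OF integrable_const sq_int_integrable[OF sqD]])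
      have D_le: "expectation (\<lambda>\<omega>. norm (D t \<omega>)) \<le>
          (\<Sum>b\<in>Basis. \<bar>basis_flow b t \<bullet> z0 - l b\<bar> + sqrt (S (basis_flow b t)))" if t: "t \<ge> 0" for t
      proof -
        have mx: "max 0 t = t" using t by simp
        have "norm (D t \<omega>) \<le> (\<Sum>b\<in>Basis. \<bar>basis_flow b t \<bullet> z0 - l b\<bar> + \<bar>U \<omega> \<bullet> b - wiener (kernel b) 0 t \<omega>\<bar>)" for \<omega>
          unfolding D mx by (rule sum_norm_le) (simp add: abs_triangle_ineq4)
        then have "expectation (\<lambda>\<omega>. norm (D t \<omega>)) \<le>
          expectation (\<lambda>\<omega>. \<Sum>b\<in>Basis. \<bar>basis_flow b t \<bullet> z0 - l b\<bar> + \<bar>U \<omega> \<bullet> b - wiener (kernel b) 0 t \<omega>\<bar>)"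
          using integrable_abs[OF sq_int_integrable[OF sqD[of _ t, unfolded mx]]]
          by (intro integral_mono integrable_norm intD Bochner_Integration.integrable_sum Bochner_Integration.integrable_add integrable_const)
        also have "\<dots> = (\<Sum>b\<in>Basis. \<bar>basis_flow b t \<bullet> z0 - l b\<bar> + expectation (\<lambda>\<omega>. \<bar>U \<omega> \<bullet> b - wiener (kernel b) 0 t \<omega>\<bar>))"
          using sq_int_integrable[OF sqD[of _ t, unfolded mx]]
          by (subst Bochner_Integration.integral_sum) (auto simp: prob_space intro!: sum.cong)
        also have "\<dots> \<le> (\<Sum>b\<in>Basis. \<bar>basis_flow b t \<bullet> z0 - l b\<bar> + sqrt (S (basis_flow b t)))"
        proof (intro sum_mono add_left_mono)
          fix b :: 'e assume b: "b \<in> Basis"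
          show "expectation (\<lambda>\<omega>. \<bar>U \<omega> \<bullet> b - wiener (kernel b) 0 t \<omega>\<bar>) \<le> sqrt (S (basis_flow b t))"
            using expectation_abs_le_sqrt[OF sqD[OF b, of t, unfolded mx]] noise_b(4)[OF b t] by simp
        qed
        finally show ?thesis .
      qed
      have "((\<lambda>t. \<Sum>b\<in>(Basis::'e set). \<bar>basis_flow b t \<bullet> z0 - l b\<bar> + sqrt (S (basis_flow b t))) \<longlongrightarrow>
          (\<Sum>b\<in>(Basis::'e set). \<bar>l b - l b\<bar> + sqrt 0)) at_top"
        by (intro tendsto_sum tendsto_add tendsto_rabs tendsto_diff tendsto_const l tendsto_real_sqrt S_limit flowD flow_basis_flow)
      then have bound0: "((\<lambda>t. \<Sum>b\<in>(Basis::'e set). \<bar>basis_flow b t \<bullet> z0 - l b\<bar> + sqrt (S (basis_flow b t))) \<longlongrightarrow> 0) at_top"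
        by simp
      have D0: "((\<lambda>t. expectation (\<lambda>\<omega>. norm (D t \<omega>))) \<longlongrightarrow> 0) at_top"
      proof (rule tendsto_sandwich[OF _ _ tendsto_const bound0])
        show "\<forall>\<^sub>F t in at_top. 0 \<le> expectation (\<lambda>\<omega>. norm (D t \<omega>))"
          by (intro always_eventually allI integral_nonneg_AE) simp
        show "\<forall>\<^sub>F t in at_top. expectation (\<lambda>\<omega>. norm (D t \<omega>)) \<le>
            (\<Sum>b\<in>Basis. \<bar>basis_flow b t \<bullet> z0 - l b\<bar> + sqrt (S (basis_flow b t)))"
          using eventually_ge_at_top[of 0] by eventually_elim (rule D_le)
      qed
      have "((\<lambda>t. expectation (\<lambda>\<omega>. f (reversed (max 0 t) \<omega>))) \<longlongrightarrow> expectation (\<lambda>\<omega>. f (m + U \<omega>))) at_top"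
      \<comment> \<open>The passage from convergence in mean to test functions works with
        subsequences, so the limit in \<open>t\<close> is tested along sequences.\<close>
      proof (rule tendsto_at_topI_sequentially)
        fix X :: "nat \<Rightarrow> real" assume X: "filterlim X at_top sequentially"
        show "(\<lambda>n. expectation (\<lambda>\<omega>. f (reversed (max 0 (X n)) \<omega>))) \<longlonglongrightarrow> expectation (\<lambda>\<omega>. f (m + U \<omega>))"
          using intD filterlim_compose[OF D0 X] unfolding D_def[abs_def]
          by (intro expectation_bounded_continuous_L1[OF f] measurable_reversed meas_mU) auto
      qed
      moreover have "\<forall>\<^sub>F t in at_top. expectation (\<lambda>\<omega>. f (reversed (max 0 t) \<omega>)) = integral\<^sup>L (distr M borel (z t)) f"
        using eventually_gt_at_top[of 0]
      proof eventually_elim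
        case (elim t)
        then show ?case
          using solution_reversed[OF elim f] integral_distr[OF z_measurable fb, of t] by simp
      qed
      ultimately show "((\<lambda>t. integral\<^sup>L (distr M borel (z t)) f) \<longlongrightarrow> integral\<^sup>L \<mu> f) at_top"
        unfolding \<mu>_def integral_distr[OF meas_mU fb] by (rule Lim_transform_eventually)
    qed
  qed
qed

end


section \<open>The model\<close>

text \<open>The matrix \<open>B\<close> acting on pairs of distances and centred velocities;
  \<open>dual_drift\<close> is its transpose, by \<open>inner_drift\<close>.\<close>

definition drift :: "real \<Rightarrow> real \<Rightarrow> real \<Rightarrow>
    (real ^ 'n::{finite,linorder}) \<times> (real ^ 'n::{finite,linorder}) \<Rightarrow> (real ^ 'n::{finite,linorder}) \<times> (real ^ 'n::{finite,linorder})" where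
  "drift \<alpha> \<beta> \<gamma> x =
    (fdiff (snd x), - (\<alpha>\<^sup>2 *\<^sub>R bdiff (fst x)) - \<beta> *\<^sub>R bdiff (fdiff (snd x)) - \<gamma> *\<^sub>R snd x)"

definition dual_drift :: "real \<Rightarrow> real \<Rightarrow> real \<Rightarrow>
    (real ^ 'n::{finite,linorder}) \<times> (real ^ 'n::{finite,linorder}) \<Rightarrow> (real ^ 'n::{finite,linorder}) \<times> (real ^ 'n::{finite,linorder})" where
  "dual_drift \<alpha> \<beta> \<gamma> x =
    (- (\<alpha>\<^sup>2 *\<^sub>R fdiff (snd x)), bdiff (fst x) - \<beta> *\<^sub>R bdiff (fdiff (snd x)) - \<gamma> *\<^sub>R snd x)"

lemma linear_drift: "linear (drift \<alpha> \<beta> \<gamma>)"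
  by (rule linearI) (simp_all add: drift_def linear_add[OF linear_fdiff] linear_add[OF linear_bdiff]
      linear_scale[OF linear_fdiff] linear_scale[OF linear_bdiff] algebra_simps)

lemma linear_dual_drift: "linear (dual_drift \<alpha> \<beta> \<gamma>)"
  by (rule linearI) (simp_all add: dual_drift_def linear_add[OF linear_fdiff] linear_add[OF linear_bdiff]
      linear_scale[OF linear_fdiff] linear_scale[OF linear_bdiff] algebra_simps)

lemma inner_bdiff: "bdiff x \<bullet> y = x \<bullet> fdiff y"
  by (metis inner_commute inner_fdiff)

lemma inner_drift: "drift \<alpha> \<beta> \<gamma> x \<bullet> y = x \<bullet> dual_drift \<alpha> \<beta> \<gamma> y"
  by (cases x; cases y)
    (simp add: drift_def dual_drift_def inner_fdiff inner_bdiff inner_diff_left inner_diff_right)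

lemma dual_flow_components:
  assumes "\<And>t. (y has_vector_derivative dual_drift \<alpha> \<beta> \<gamma> (y t)) (at t)"
  shows "((\<lambda>t. fst (y t)) has_vector_derivative - (\<alpha>\<^sup>2 *\<^sub>R fdiff (snd (y t)))) (at t)"
    and "((\<lambda>t. snd (y t)) has_vector_derivative
      bdiff (fst (y t)) - \<beta> *\<^sub>R bdiff (fdiff (snd (y t))) - \<gamma> *\<^sub>R snd (y t)) (at t)"
  using bounded_linear.has_vector_derivative[OF bounded_linear_fst assms]
    bounded_linear.has_vector_derivative[OF bounded_linear_snd assms] by (simp_all add: dual_drift_def)

text \<open>The mean of the first component is conserved; everything else is damped.\<close>

lemma dual_flow_limit:
  fixes y :: "real \<Rightarrow> (real ^ 'n::{finite,linorder}) \<times> (real ^ 'n::{finite,linorder})"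
  assumes pos: "\<alpha> > 0" "\<beta> > 0" "\<gamma> > 0"
    and y: "\<And>t. (y has_vector_derivative dual_drift \<alpha> \<beta> \<gamma> (y t)) (at t)"
  obtains c where "(y \<longlongrightarrow> (c *\<^sub>R 1, 0)) at_top"
proof -
  note comp = dual_flow_components[OF y]
  define c where "c = (fst (y 0) \<bullet> 1) / real CARD('n)"
  \<comment> \<open>Removing the conserved mean leaves vectors orthogonal to \<open>1\<close>, where
    \<open>bdiff\<close> is bounded below as \<open>damped_flow_decay\<close> requires.\<close>
  define q where "q t = fst (y t) - c *\<^sub>R 1" for t
  have "((\<lambda>t. fst (y t) \<bullet> 1) has_real_derivative 0) (at t)" for t
    using bounded_linear.has_vector_derivative[OF bounded_linear_inner_left comp(1), of 1 t]
    by (simp add: has_real_derivative_iff_has_vector_derivative)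
  then have "fst (y t) \<bullet> 1 = fst (y 0) \<bullet> 1" for t by (intro DERIV_isconst_all) blast
  then have mean: "q t \<bullet> 1 = 0" for t
    by (simp add: q_def c_def inner_diff_left inner_one_one)
  have bq: "bdiff (q t) = bdiff (fst (y t))" for t
    by (simp add: q_def linear_diff[OF linear_bdiff] linear_scale[OF linear_bdiff])
  obtain \<kappa> where \<kappa>: "\<kappa> > 0" "\<And>x :: real ^ 'n::{finite,linorder}. x \<bullet> 1 = 0 \<Longrightarrow> \<kappa> * norm x \<le> norm (bdiff x)"
    using bdiff_bounded_below by blast
  have q': "(q has_vector_derivative - (\<alpha>\<^sup>2 *\<^sub>R fdiff (snd (y t)))) (at t)" for t
    unfolding q_def[abs_def] using has_vector_derivative_diff[OF comp(1) has_vector_derivative_const] by simp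
  have "(q \<longlongrightarrow> 0) at_top" "((\<lambda>t. snd (y t)) \<longlongrightarrow> 0) at_top"
    using damped_flow_decay[OF linear_fdiff linear_bdiff inner_fdiff pos \<kappa>(1) q' comp(2)[folded bq] \<kappa>(2)[OF mean]]
    by auto
  from tendsto_Pair[OF tendsto_add[OF this(1) tendsto_const[of "c *\<^sub>R 1"]] this(2)]
  have "(y \<longlongrightarrow> (c *\<^sub>R 1, 0)) at_top" by (simp add: q_def)
  then show ?thesis by (rule that)
qed

lemma deriv_potential: "deriv (potential \<alpha>) x = \<alpha>\<^sup>2 * x"
  unfolding potential_def[abs_def]
  by (rule DERIV_imp_deriv) (auto intro!: derivative_eq_intros simp: power2_eq_square)

lemma continuous_stacked: "continuous_on UNIV (\<lambda>z. stacked (fst z) (snd z))"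
  unfolding stacked_def
proof (rule continuous_on_vec_lambda)
  fix i :: "'a + 'a"
  show "continuous_on UNIV (\<lambda>z. case i of Inl n \<Rightarrow> fst z $ n | Inr n \<Rightarrow> snd z $ n)"
    by (cases i) (auto intro!: continuous_intros)
qed

lemma has_real_derivative_quadratic_form:
  fixes V :: "real ^ 'n ^ 'n"
  assumes f: "(f has_vector_derivative f') (at t)" and sym: "\<And>x y. (V *v x) \<bullet> y = x \<bullet> (V *v y)"
  shows "((\<lambda>t. f t \<bullet> (V *v f t)) has_real_derivative 2 * (f' \<bullet> (V *v f t))) (at t)"
proof -
  have "((\<lambda>t. V *v f t) has_vector_derivative V *v f') (at t)"
    by (rule bounded_linear.has_vector_derivative[OF matrix_vector_mul_bounded_linear f])
  from bounded_bilinear.has_vector_derivative[OF bounded_bilinear_inner f this]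
  show ?thesis
    using sym[of f' "f t"] by (simp add: has_real_derivative_iff_has_vector_derivative inner_commute[of "f t"])
qed

text \<open>Centring the velocities at \<open>u\<close> absorbs the constant force, and differences
  do not see the shift, so the drift becomes linear. The scalar equations are the coordinates of one
  vector-valued integral equation.\<close>

lemma model_pathwise:
  assumes "solves_model M W \<alpha> \<beta> \<gamma> \<sigma> u Q0 p0 Q p"
  shows "AE \<omega> in M. continuous_on {0..} (\<lambda>t. (Q t \<omega>, p t \<omega> - u *\<^sub>R 1)) \<and>
    (\<forall>t\<ge>0. (Q t \<omega>, p t \<omega> - u *\<^sub>R 1) = (Q0, p0 - u *\<^sub>R 1)
      + integral {0..t} (\<lambda>s. drift \<alpha> \<beta> \<gamma> (Q s \<omega>, p s \<omega> - u *\<^sub>R 1)) + (0, \<sigma> *\<^sub>R W t \<omega>))"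
proof -
  have "AE \<omega> in M.
      continuous_on {0..} (\<lambda>t. Q t \<omega>) \<and> continuous_on {0..} (\<lambda>t. p t \<omega>) \<and>
      (\<forall>t\<ge>0. \<forall>n.
        Q t \<omega> $ n = Q0 $ n + integral {0..t} (\<lambda>s. p s \<omega> $ nxt n - p s \<omega> $ n) \<and>
        p t \<omega> $ n = p0 $ n
          + integral {0..t} (\<lambda>s.
              deriv (potential \<alpha>) (Q s \<omega> $ n) - deriv (potential \<alpha>) (Q s \<omega> $ prv n)
              + \<beta> * (p s \<omega> $ nxt n - 2 * p s \<omega> $ n + p s \<omega> $ prv n)
              + \<gamma> * (u - p s \<omega> $ n))
          + \<sigma> * W t \<omega> $ n)"
    using assms unfolding solves_model_def by blast
  then show ?thesis
  proof eventually_elim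
    case (elim \<omega>)
    let ?z = "\<lambda>t. (Q t \<omega>, p t \<omega> - u *\<^sub>R 1)"
    have cont: "continuous_on {0..} ?z" using elim by (intro continuous_intros) auto
    have "?z t = (Q0, p0 - u *\<^sub>R 1) + integral {0..t} (\<lambda>s. drift \<alpha> \<beta> \<gamma> (?z s)) + (0, \<sigma> *\<^sub>R W t \<omega>)"
      if t: "t \<ge> 0" for t
    proof -
      have "continuous_on {0..t} (\<lambda>s. drift \<alpha> \<beta> \<gamma> (?z s))"
        using linear_drift continuous_on_subset[OF cont]
        by (intro bounded_linear.continuous_on[of "drift \<alpha> \<beta> \<gamma>"]) (auto simp: linear_conv_bounded_linear)
      then have int: "(\<lambda>s. drift \<alpha> \<beta> \<gamma> (?z s)) integrable_on {0..t}" by (rule integrable_continuous_real)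
      have "fst (integral {0..t} (\<lambda>s. drift \<alpha> \<beta> \<gamma> (?z s))) $ n = integral {0..t} (\<lambda>s. fst (drift \<alpha> \<beta> \<gamma> (?z s)) $ n)" for n
        using integral_linear[OF int bounded_linear_compose[OF bounded_linear_vec_nth[of n] bounded_linear_fst]] by (simp add: o_def)
      moreover have "snd (integral {0..t} (\<lambda>s. drift \<alpha> \<beta> \<gamma> (?z s))) $ n = integral {0..t} (\<lambda>s. snd (drift \<alpha> \<beta> \<gamma> (?z s)) $ n)" for n
        using integral_linear[OF int bounded_linear_compose[OF bounded_linear_vec_nth[of n] bounded_linear_snd]] by (simp add: o_def)
      moreover have "(\<lambda>s. fst (drift \<alpha> \<beta> \<gamma> (?z s)) $ n) = (\<lambda>s. p s \<omega> $ nxt n - p s \<omega> $ n)" for n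
        by (simp add: drift_def fdiff_def)
      moreover have "(\<lambda>s. snd (drift \<alpha> \<beta> \<gamma> (?z s)) $ n) = (\<lambda>s.
              deriv (potential \<alpha>) (Q s \<omega> $ n) - deriv (potential \<alpha>) (Q s \<omega> $ prv n)
              + \<beta> * (p s \<omega> $ nxt n - 2 * p s \<omega> $ n + p s \<omega> $ prv n)
              + \<gamma> * (u - p s \<omega> $ n))" for n
        by (rule ext) (simp add: drift_def fdiff_def bdiff_def deriv_potential algebra_simps)
      ultimately show ?thesis using elim t by (simp add: prod_eq_iff vec_eq_iff)
    qed
    then show ?case using cont by blast
  qed
qed

lemma inner_matrix_axis: "axis k 1 \<bullet> (V *v axis l 1) = V $ k $ l"
  for V :: "real ^ 'n ^ 'n"
  by (simp add: inner_axis' matrix_vector_mult_basis column_def)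

theorem proposition10:
  fixes M :: "'a measure"
    and W Q p :: "real \<Rightarrow> 'a \<Rightarrow> real ^ 'n::{finite,linorder}"
    and q0 p0 :: "real ^ 'n::{finite,linorder}"
    and L \<alpha> \<beta> \<gamma> \<sigma> u :: real
    and N :: nat
    and v :: "nat \<Rightarrow> real"
    and V1 V2 V3 :: "real ^ 'n::{finite,linorder} ^ 'n::{finite,linorder}"
  assumes "N = CARD('n)" and "N \<ge> 3"
    and "\<alpha> > 0" and "\<beta> > 0" and "\<gamma> > 0"
    and "standard_brownian_motion M W"
    and "\<And>n. 0 \<le> q0 $ n" and "mono (\<lambda>n. q0 $ n)" and "\<And>n. q0 $ n \<le> L"
    and "solves_model M W \<alpha> \<beta> \<gamma> \<sigma> u (distances L q0) p0 Q p"
    and "\<And>j. j < N \<Longrightarrow>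
      v j = \<sigma>\<^sup>2 / (2 * real N) *
        (\<Sum>k = 0..N - 1. cos (2 * pi * real j * real k / real N) /
          (\<gamma> + 4 * \<beta> * (sin (pi * real k / real N))\<^sup>2))"
    and "V3 = circulant v"
    and "V2 = 0"
    and "V1 = (1 / \<alpha>\<^sup>2) *\<^sub>R (V3 - (\<sigma>\<^sup>2 / (2 * \<gamma> * real N)) *\<^sub>R (\<chi> i j. 1))"
  shows "(\<exists>\<mu>. limiting_distribution M (\<lambda>t \<omega>. stacked (Q t \<omega>) (p t \<omega> - u *\<^sub>R 1)) \<mu>) \<and>
    (\<forall>\<mu>. limiting_distribution M (\<lambda>t \<omega>. stacked (Q t \<omega>) (p t \<omega> - u *\<^sub>R 1)) \<mu> \<longrightarrow>
      square_integrable \<mu> \<and>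
      covariance_matrix \<mu> = block_matrix V1 V2 (transpose V2) V3)"
proof -
  note pos = assms(3-5)
  have N: "N > 0" using assms(2) by simp
  note circ_args = N assms(4,5,11,1,12)
  have V3_sym: "V3 $ i $ j = V3 $ j $ i" for i j
    by (rule circulant_sym[OF circ_args])
  have V3_inner: "(V3 *v x) \<bullet> y = x \<bullet> (V3 *v y)" for x y
    by (rule inner_circulant[OF circ_args])
  have V3_fdiff: "fdiff (V3 *v x) = V3 *v fdiff x" for x
    by (rule fdiff_circulant[OF circ_args])
  have V3_resolvent: "\<gamma> *\<^sub>R (V3 *v x) + \<beta> *\<^sub>R bdiff (fdiff (V3 *v x)) = (\<sigma>\<^sup>2 / 2) *\<^sub>R x" for x
    by (rule circulant_resolvent[OF circ_args])
  have V3_one: "V3 *v 1 = (\<sigma>\<^sup>2 / (2 * \<gamma>)) *\<^sub>R 1"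
    by (rule circulant_one[OF circ_args])
  define c where "c = \<sigma>\<^sup>2 / (2 * \<gamma> * real N)"
  have V1_sym: "V1 $ i $ j = V1 $ j $ i" for i j
    using V3_sym[of i j] by (simp add: assms(14))
  have V1_mult: "V1 *v x = (1 / \<alpha>\<^sup>2) *\<^sub>R (V3 *v x - (c * (1 \<bullet> x)) *\<^sub>R 1)" for x
  proof -
    have "((\<chi> i j. 1) :: real ^ 'n::{finite,linorder} ^ 'n::{finite,linorder}) *v x = (1 \<bullet> x) *\<^sub>R 1"
      by (simp add: vec_eq_iff matrix_vector_mult_def inner_vec_def)
    then show ?thesis
      unfolding assms(14) c_def[symmetric]
      by (simp add: scaleR_matrix_vector_assoc[symmetric] matrix_vector_mult_diff_rdistrib)
  qed
  have V1_inner: "(V1 *v x) \<bullet> y = x \<bullet> (V1 *v y)" for x y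
    by (simp add: V1_mult V3_inner inner_diff_left inner_diff_right inner_commute[of x 1] ac_simps)
  \<comment> \<open>The conserved direction lies in the kernel of \<open>V1\<close>, matching the
    deterministic total length; this is what sends \<open>S\<close> to \<open>0\<close> at the
    flow's limit \<open>(l *\<^sub>R 1, 0)\<close>.\<close>
  have V1_one: "V1 *v 1 = 0"
    using N by (simp add: V1_mult V3_one inner_one_one c_def assms(1)[symmetric] field_simps)
  \<comment> \<open>The quadratic form of the asserted covariance matrix on pairs; there is no mixed
    term since \<open>V2 = 0\<close>.\<close>
  define S where "S x = fst x \<bullet> (V1 *v fst x) + snd x \<bullet> (V3 *v snd x)" for x
  define z where "z t \<omega> = (Q t \<omega>, p t \<omega> - u *\<^sub>R 1)" for t \<omega>
  define G where "G w = (0 :: real ^ 'n::{finite,linorder}, \<sigma> *\<^sub>R w)" for w :: "real ^ 'n::{finite,linorder}"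
  define G' where "G' x = \<sigma> *\<^sub>R snd x" for x :: "(real ^ 'n::{finite,linorder}) \<times> (real ^ 'n::{finite,linorder})"
  interpret standard_brownian_motion M W by fact
  have z_meas: "z t \<in> borel_measurable M" if "t \<ge> 0" for t
  proof -
    have "Q t \<in> borel_measurable M" "p t \<in> borel_measurable M"
      using assms(10) that unfolding solves_model_def by auto
    then show ?thesis unfolding z_def[abs_def]
      by (intro borel_measurable_Pair borel_measurable_diff borel_measurable_const)
  qed
  interpret linear_sde M W "drift \<alpha> \<beta> \<gamma>" "dual_drift \<alpha> \<beta> \<gamma>" G G' z "(distances L q0, p0 - u *\<^sub>R 1)" S
  proof (intro linear_sde.intro linear_sde_axioms.intro)
    show "linear G'" by (rule linearI) (simp_all add: G'_def scaleR_right_distrib)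
    show "G w \<bullet> x = w \<bullet> G' x" for w x by (cases x) (simp add: G_def G'_def)
    show "AE \<omega> in M. continuous_on {0..} (\<lambda>t. z t \<omega>) \<and>
      (\<forall>t\<ge>0. z t \<omega> = (distances L q0, p0 - u *\<^sub>R 1) + integral {0..t} (\<lambda>s. drift \<alpha> \<beta> \<gamma> (z s \<omega>)) + G (W t \<omega>))"
      unfolding z_def G_def by (rule model_pathwise[OF assms(10)])
    fix y :: "real \<Rightarrow> (real ^ 'n::{finite,linorder}) \<times> (real ^ 'n::{finite,linorder})"
    assume y: "\<And>t. (y has_vector_derivative dual_drift \<alpha> \<beta> \<gamma> (y t)) (at t)"
    obtain l where l: "(y \<longlongrightarrow> (l *\<^sub>R 1, 0)) at_top" using dual_flow_limit[OF pos y] .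
    then show "\<exists>l. (y \<longlongrightarrow> l) at_top" by blast
    have "((\<lambda>t. S (y t)) \<longlongrightarrow> S (l *\<^sub>R 1, 0)) at_top"
      unfolding S_def
      by (intro tendsto_intros tendsto_fst[OF l] tendsto_snd[OF l]
          bounded_linear.tendsto[OF matrix_vector_mul_bounded_linear])
    then show "((\<lambda>t. S (y t)) \<longlongrightarrow> 0) at_top"
      by (simp add: S_def V1_one matrix_vector_mult_scaleR)
    fix s
    define q r where "q = fst (y s)" and "r = snd (y s)"
    have "((\<lambda>t. S (y t)) has_real_derivative 2 * (- (\<alpha>\<^sup>2 *\<^sub>R fdiff r) \<bullet> (V1 *v q))
      + 2 * ((bdiff q - \<beta> *\<^sub>R bdiff (fdiff r) - \<gamma> *\<^sub>R r) \<bullet> (V3 *v r))) (at s)"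
      unfolding S_def q_def r_def
      by (intro DERIV_add has_real_derivative_quadratic_form dual_flow_components[OF y] V1_inner V3_inner)
    also have "2 * (- (\<alpha>\<^sup>2 *\<^sub>R fdiff r) \<bullet> (V1 *v q))
      + 2 * ((bdiff q - \<beta> *\<^sub>R bdiff (fdiff r) - \<gamma> *\<^sub>R r) \<bullet> (V3 *v r)) = - (G' (y s) \<bullet> G' (y s))"
    proof -
      \<comment> \<open>The all-ones part of \<open>V1\<close> is invisible here because
        \<open>fdiff r\<close> is orthogonal to \<open>1\<close>. The expression then cancels
        against the one in the next step.\<close>
      have 1: "\<alpha>\<^sup>2 * (fdiff r \<bullet> (V1 *v q)) = fdiff r \<bullet> (V3 *v q)"
        using pos(1) by (simp add: V1_mult inner_diff_right)
      have 2: "bdiff q \<bullet> (V3 *v r) = fdiff r \<bullet> (V3 *v q)"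
        by (metis V3_fdiff V3_inner inner_bdiff inner_commute)
      \<comment> \<open>Adjointness moves the differences onto \<open>V3 *v r\<close>, where
        \<open>V3_resolvent\<close> evaluates the damping to the noise intensity.\<close>
      have "(\<beta> *\<^sub>R bdiff (fdiff r) + \<gamma> *\<^sub>R r) \<bullet> (V3 *v r) = r \<bullet> (\<gamma> *\<^sub>R (V3 *v r) + \<beta> *\<^sub>R bdiff (fdiff (V3 *v r)))"
        by (simp add: inner_add_left inner_add_right inner_bdiff inner_fdiff)
      then have 3: "(\<beta> *\<^sub>R bdiff (fdiff r) + \<gamma> *\<^sub>R r) \<bullet> (V3 *v r) = \<sigma>\<^sup>2 / 2 * (r \<bullet> r)"
        by (simp add: V3_resolvent)
      have "- (\<alpha>\<^sup>2 *\<^sub>R fdiff r) \<bullet> (V1 *v q) + (bdiff q - \<beta> *\<^sub>R bdiff (fdiff r) - \<gamma> *\<^sub>R r) \<bullet> (V3 *v r)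
        = - (\<alpha>\<^sup>2 * (fdiff r \<bullet> (V1 *v q))) + bdiff q \<bullet> (V3 *v r) - (\<beta> *\<^sub>R bdiff (fdiff r) + \<gamma> *\<^sub>R r) \<bullet> (V3 *v r)"
        by (simp add: inner_diff_left inner_add_left)
      then have "- (\<alpha>\<^sup>2 *\<^sub>R fdiff r) \<bullet> (V1 *v q) + (bdiff q - \<beta> *\<^sub>R bdiff (fdiff r) - \<gamma> *\<^sub>R r) \<bullet> (V3 *v r)
        = - (\<sigma>\<^sup>2 / 2 * (r \<bullet> r))" unfolding 1 2 3 by simp
      moreover have "G' (y s) \<bullet> G' (y s) = \<sigma>\<^sup>2 * (r \<bullet> r)" by (simp add: G'_def r_def power2_eq_square)
      ultimately show ?thesis by simp
    qed
    finally show "((\<lambda>t. S (y t)) has_real_derivative - (G' (y s) \<bullet> G' (y s))) (at s)" .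
  qed (fact assms(6) linear_drift linear_dual_drift inner_drift z_meas)+
  obtain \<mu> where \<mu>: "limiting_distribution M z \<mu>"
    and sq: "\<And>b. b \<in> Basis \<Longrightarrow> integrable \<mu> (\<lambda>x. (x \<bullet> b)\<^sup>2)"
    and cov: "\<And>b c. b \<in> Basis \<Longrightarrow> c \<in> Basis \<Longrightarrow>
      (\<integral>x. (x \<bullet> b - (\<integral>x. x \<bullet> b \<partial>\<mu>)) * (x \<bullet> c - (\<integral>x. x \<bullet> c \<partial>\<mu>)) \<partial>\<mu>) = (S (b + c) - S (b - c)) / 4"
    by (rule limiting_covariance) (rule that; assumption)
  define \<phi> where "\<phi> z = stacked (fst z) (snd z)" for z :: "(real ^ 'n::{finite,linorder}) \<times> (real ^ 'n::{finite,linorder})"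
  define \<nu> where "\<nu> = distr \<mu> borel \<phi>"
  have \<phi>: "continuous_on UNIV \<phi>" unfolding \<phi>_def[abs_def] by (rule continuous_stacked)
  have "limiting_distribution M (\<lambda>t \<omega>. \<phi> (z t \<omega>)) \<nu>"
    unfolding \<nu>_def by (rule limiting_distribution_continuous_map[OF \<mu> \<phi> z_meas])
  then have \<nu>: "limiting_distribution M (\<lambda>t \<omega>. stacked (Q t \<omega>) (p t \<omega> - u *\<^sub>R 1)) \<nu>"
    by (simp add: \<phi>_def z_def)
  have "sets \<mu> = sets borel" using \<mu> by (simp add: limiting_distribution_def)
  then have \<phi>_meas: "\<phi> \<in> borel_measurable \<mu>"
    using borel_measurable_continuous_onI[OF \<phi>] by (simp cong: measurable_cong_sets)
  \<comment> \<open>The basis pair whose inner product reads off the \<open>i\<close>-th coordinate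
    of the stacked vector.\<close>
  define e :: "'n + 'n \<Rightarrow> (real ^ 'n::{finite,linorder}) \<times> (real ^ 'n::{finite,linorder})"
    where "e i = (case i of Inl n \<Rightarrow> (axis n 1, 0) | Inr n \<Rightarrow> (0, axis n 1))" for i
  have e_Basis: "e i \<in> Basis" for i
    by (cases i) (auto simp: e_def Basis_prod_def axis_in_Basis_iff)
  have \<phi>_e: "\<phi> x $ i = x \<bullet> e i" for x i
    by (cases i; cases x) (auto simp: \<phi>_def stacked_def e_def inner_axis)
  have comp_meas: "(\<lambda>x :: real ^ ('n + 'n). x $ i) \<in> borel_measurable borel" for i by measurable
  have mean: "(\<integral>x. x $ i \<partial>\<nu>) = (\<integral>x. x \<bullet> e i \<partial>\<mu>)" for i
    unfolding \<nu>_def by (subst integral_distr[OF \<phi>_meas]) (auto simp: \<phi>_e)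
  have "covariance_matrix \<nu> $ i $ j = block_matrix V1 V2 (transpose V2) V3 $ i $ j" for i j
  proof -
    have "covariance_matrix \<nu> $ i $ j = (S (e i + e j) - S (e i - e j)) / 4"
      unfolding cov[OF e_Basis e_Basis, symmetric] mean[symmetric] covariance_matrix_def
      unfolding \<nu>_def by (simp add: integral_distr[OF \<phi>_meas] \<phi>_e)
    \<comment> \<open>Polarization is undone: symmetry of \<open>V1\<close> and \<open>V3\<close>
      merges the two mixed terms of each square, and a matrix entry is left.\<close>
    also have "\<dots> = fst (e i) \<bullet> (V1 *v fst (e j)) + snd (e i) \<bullet> (V3 *v snd (e j))"
      using V1_inner[of "fst (e i)" "fst (e j)"] V3_inner[of "snd (e i)" "snd (e j)"]
      by (simp add: S_def matrix_vector_right_distrib matrix_vector_mult_diff_distrib inner_add_left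
          inner_add_right inner_diff_left inner_diff_right inner_commute)
    also have "\<dots> = block_matrix V1 V2 (transpose V2) V3 $ i $ j"
      by (cases i; cases j) (simp_all add: e_def block_matrix_def inner_matrix_axis assms(13) transpose_def)
    finally show ?thesis .
  qed
  then have "covariance_matrix \<nu> = block_matrix V1 V2 (transpose V2) V3" by (simp add: vec_eq_iff)
  moreover have "square_integrable \<nu>"
    unfolding square_integrable_def \<nu>_def
    by (intro allI, subst integrable_distr_eq[OF \<phi>_meas]) (auto simp: \<phi>_e intro!: sq e_Basis)
  \<comment> \<open>The measure \<open>\<nu>\<close> witnesses existence, and any other limiting
    distribution equals it by uniqueness.\<close>
  ultimately show ?thesis using \<nu> limiting_distribution_unique[OF _ \<nu>] by blast
qed

end
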